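(* Let $\mathcal X$ be a real separable Hilbert space, let $C\in L_1^+(\mathcal X)$, let $U\colon\mathcal X\to\mathbb R$ be Fréchet differentiable, and let $P,Q$ be Borel probability measures on $\mathcal X$ such that $P\ll N_C$ with $\frac{dP}{dN_C}\propto \exp(-U)$, and $$\mathbb E_Q[\|X\|_{\mathcal X}^2]<\infty,\quad \mathbb E_Q[\|C\,DU(X)\|_{\mathcal X}]<\infty,\quad e^{-U/2}\in W^{1,2}_C(\mathcal X),\quad \mathbb E_{N_C}[\|C^{1/2}DU(X)\|_{\mathcal X}^2]<\infty .$$ Let $k\colon\mathcal X\times\mathcal X\to\mathbb R$ be a kernel such that $k(x,y)=\widehat\mu(x-y)$ for all $x,y\in\mathcal X$, for some finite Borel measure $\mu$ on $\mathcal X$, and set $K(x,y)=k(x,y)I_{\mathcal X}$. (i) If $k\in C_b^{(2,2)}(\mathcal X\times\mathcal X)$, then $$\mathrm{KSD}_{\mathcal A,k}(Q,P)^2=\int_{\mathcal X}\left|\mathbb E_Q\big[\mathcal A(e^{i\langle s,\cdot\rangle_{\mathcal X}})(X)\big]\right|_{\mathbb C}^2\,d\mu(s).$$ (ii) If $k\in C_b^{(1,1)}(\mathcal X\times\mathcal X)$, then $$\mathrm{KSD}_{\mathcal A_v,K}(Q,P)^2=\int_{\mathcal X}\left\|\mathbb E_Q\big[\Gamma(e^{i\langle s,\cdot\rangle_{\mathcal X}})(X)\big]\right\|_{\mathcal X_{\mathbb C}}^2\,d\mu(s).$$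
   Context: Spaces and measures. $\mathcal X$ may be finite or infinite dimensional. $L(\mathcal X)$ is the space of bounded linear operators on $\mathcal X$, $I_{\mathcal X}$ the identity; $L_1^+(\mathcal X)$ is the set of symmetric, positive definite (in the sense $\langle Cx,x\rangle_{\mathcal X}\ge 0$; injectivity is stated separately when required), trace class operators. $N_C$ is the centred Gaussian measure on $\mathcal X$ with covariance operator $C$. For a Borel measure $\mu$, $\widehat\mu(s)=\int_{\mathcal X}e^{i\langle s,x\rangle_{\mathcal X}}\,d\mu(x)$. In $\mathbb E_Q[f(X)]$, $X$ has law $Q$. Derivatives. $D$ is the Fréchet derivative; for real-valued $f$, $Df(x)$ is identified with an element of $\mathcal X$ by Riesz representation, $Df(x)[y]=\langle y,Df(x)\rangle_{\mathcal X}$. $D_1,D_2$ are partial Fréchet derivatives in the first and second argument. $C_b^{(\alpha,\alpha)}(\mathcal X\times\mathcal X)$ is the set of $F\colon\mathcal X\times\mathcal X\to\mathbb R$ such that $D_1^iD_2^jF$ exists, is continuous and is bounded (in operator norm) for all $0\le i,j\le\alpha$. $W^{1,2}_C(\mathcal X)$ is the Malliavin–Sobolev space of $f\in L^2(\mathcal X;N_C)$ whose Malliavin derivative $C^{1/2}Df$ lies in $L^2(\mathcal X,\mathcal X;N_C)$. Kernels. A kernel is a symmetric positive definite function $k\colon\mathcal X\times\mathcal X\to\mathbb R$; $\mathcal H_k$ is its reproducing kernel Hilbert space with norm $\|\cdot\|_k$. For $K=kI_{\mathcal X}$, $\mathcal H_K$ is the Hilbert space of functions $F\colon\mathcal X\to\mathcal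 X$ with $F_i=\langle F(\cdot),e_i\rangle_{\mathcal X}\in\mathcal H_k$ for all $i$ and $\|F\|_K^2=\sum_i\|F_i\|_k^2<\infty$, for any orthonormal basis $\{e_i\}$ of $\mathcal X$ (independent of the basis). Operators and discrepancies. For scalar functions $f$ and for $F\colon\mathcal X\to\mathcal X$, $$\mathcal A f(x)=\mathrm{Tr}[CD^2f(x)]-\langle Df(x),x+C\,DU(x)\rangle_{\mathcal X},$$ $$\mathcal A_vF(x)=\mathrm{Tr}[C\,DF(x)]-\langle F(x),x+C\,DU(x)\rangle_{\mathcal X},$$ $$\Gamma f(x)=C\,Df(x)-(x+C\,DU(x))f(x).$$ $\mathcal A$ and $\Gamma$ are extended complex-linearly to complex-valued functions; then $\Gamma f$ takes values in the complexification $\mathcal X_{\mathbb C}=\{a+ib: a,b\in\mathcal X\}$, with inner product $\langle a+ib,c+id\rangle_{\mathcal X_{\mathbb C}}=\langle a,c\rangle+\langle b,d\rangle+i\langle b,c\rangle-i\langle a,d\rangle$. The discrepancies are $$\mathrm{KSD}_{\mathcal A,k}(Q,P)=\sup_{f\in\mathcal H_k,\|f\|_k\le1}|\mathbb E_Q[\mathcal Af(X)]|,\qquad \mathrm{KSD}_{\mathcal A_v,K}(Q,P)=\sup_{F\in\mathcal H_K,\|F\|_K\le1}|\mathbb E_Q[\mathcal A_vF(X)]|.$$ *)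

theory Defs
  imports "HOL-Probability.Probability"
begin

text \<open>
  Throughout, a real separable Hilbert space is a type of sort
  {real_inner, banach, second_countable_topology}; no dimension restriction is imposed.
\<close>

definition onb :: "'a::real_inner set \<Rightarrow> bool" where
  "onb B \<longleftrightarrow> pairwise orthogonal B \<and> (\<forall>e\<in>B. norm e = 1) \<and> closure (span B) = UNIV"

text \<open>An arbitrary fixed orthonormal basis.  It is used only in quantities that do not depend on
  the choice of the basis: the trace of trace class operators, and the space and norm of the
  vector-valued functions attached to \<open>K = k I\<close>.\<close>

definition some_onb :: "'a::real_inner set" where
  "some_onb = (SOME B. onb B)"

definition op_trace :: "('a::real_inner \<Rightarrow> 'a) \<Rightarrow> real" where
  "op_trace T = (\<Sum>\<^sub>\<infinity>e\<in>some_onb. inner (T e) e)"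

definition sym_pos_op :: "('a::real_inner \<Rightarrow>\<^sub>L 'a) \<Rightarrow> bool" where
  "sym_pos_op C \<longleftrightarrow> (\<forall>x y. inner (blinfun_apply C x) y = inner x (blinfun_apply C y)) \<and>
     (\<forall>x. inner (blinfun_apply C x) x \<ge> 0)"

text \<open>For a symmetric positive \<open>C\<close> one has \<open>|C| = C\<close>, so trace class means
  that the series of the diagonal entries of \<open>C\<close> itself converges.\<close>

definition L1_plus :: "('a::real_inner \<Rightarrow>\<^sub>L 'a) set" where
  "L1_plus = {C. sym_pos_op C \<and>
     (\<forall>B. onb B \<longrightarrow> (\<lambda>e. inner (blinfun_apply C e) e) summable_on B)}"

definition op_sqrt :: "('a::real_inner \<Rightarrow>\<^sub>L 'a) \<Rightarrow> ('a \<Rightarrow>\<^sub>L 'a)" where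
  "op_sqrt C = (THE S. sym_pos_op S \<and> S o\<^sub>L S = C)"

text \<open>\<open>N\<close> is the centred Gaussian measure with covariance operator \<open>C\<close>: all continuous linear
  functionals are centred, possibly degenerate, normal variables, with covariances given
  by \<open>C\<close>.  This determines \<open>N\<close> uniquely.\<close>

definition centred_gaussian ::
  "('a::{real_inner, banach, second_countable_topology} \<Rightarrow>\<^sub>L 'a) \<Rightarrow> 'a measure \<Rightarrow> bool" where
  "centred_gaussian C N \<longleftrightarrow> prob_space N \<and> sets N = sets borel \<and>
     (\<forall>s. \<exists>\<sigma>\<ge>0. distr N borel (\<lambda>x. inner s x) =
        (if \<sigma> = 0 then return borel 0 else density lborel (\<lambda>t. ennreal (normal_density 0 \<sigma> t)))) \<and>
     (\<forall>s t. (\<integral>x. inner s x * inner t x \<partial>N) = inner (blinfun_apply C s) t)"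

definition wave :: "'a::real_inner \<Rightarrow> 'a \<Rightarrow> complex" where
  "wave s x = exp (\<i> * complex_of_real (inner s x))"

definition fourier :: "'a::real_inner measure \<Rightarrow> 'a \<Rightarrow> complex" where
  "fourier \<mu> s = (\<integral>x. wave s x \<partial>\<mu>)"

text \<open>The Riesz representative of the Frechet derivative of a real-valued function.\<close>

definition grad :: "('a::real_inner \<Rightarrow> real) \<Rightarrow> 'a \<Rightarrow> 'a" where
  "grad f x = (THE g. GDERIV f x :> g)"

text \<open>\<open>D\<^sup>2 f(x)\<close> as an operator on the space, again through Riesz representation.\<close>

definition hess :: "('a::real_inner \<Rightarrow> real) \<Rightarrow> 'a \<Rightarrow> 'a \<Rightarrow> 'a" where
  "hess f x = frechet_derivative (grad f) (at x)"

definition differentiable1 :: "('a::real_normed_vector \<Rightarrow> 'a \<Rightarrow> 'v::real_normed_vector) \<Rightarrow> bool" where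
  "differentiable1 F \<longleftrightarrow> (\<forall>x y. (\<lambda>u. F u y) differentiable (at x))"

definition differentiable2 :: "('a::real_normed_vector \<Rightarrow> 'a \<Rightarrow> 'v::real_normed_vector) \<Rightarrow> bool" where
  "differentiable2 F \<longleftrightarrow> (\<forall>x y. (\<lambda>v. F x v) differentiable (at y))"

definition D1 :: "('a::real_normed_vector \<Rightarrow> 'a \<Rightarrow> 'v::real_normed_vector) \<Rightarrow> 'a \<Rightarrow> 'a \<Rightarrow> 'a \<Rightarrow>\<^sub>L 'v" where
  "D1 F x y = Blinfun (frechet_derivative (\<lambda>u. F u y) (at x))"

definition D2 :: "('a::real_normed_vector \<Rightarrow> 'a \<Rightarrow> 'v::real_normed_vector) \<Rightarrow> 'a \<Rightarrow> 'a \<Rightarrow> 'a \<Rightarrow>\<^sub>L 'v" where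
  "D2 F x y = Blinfun (frechet_derivative (\<lambda>v. F x v) (at y))"

definition cont_bdd :: "('a::real_normed_vector \<Rightarrow> 'a \<Rightarrow> 'v::real_normed_vector) \<Rightarrow> bool" where
  "cont_bdd F \<longleftrightarrow> continuous_on UNIV (\<lambda>(x, y). F x y) \<and> bounded (range (\<lambda>(x, y). F x y))"

text \<open>\<open>D\<^sub>1\<^sup>i F\<close> exists and is continuous and bounded for \<open>i \<le> 1\<close>, respectively \<open>i \<le> 2\<close>.  The types
  of the iterated derivatives vary with their order, which is why the two orders are
  spelled out separately.\<close>

definition Cb1_fst :: "('a::real_normed_vector \<Rightarrow> 'a \<Rightarrow> 'v::real_normed_vector) \<Rightarrow> bool" where
  "Cb1_fst F \<longleftrightarrow> cont_bdd F \<and> differentiable1 F \<and> cont_bdd (D1 F)"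

definition Cb2_fst :: "('a::real_normed_vector \<Rightarrow> 'a \<Rightarrow> 'v::real_normed_vector) \<Rightarrow> bool" where
  "Cb2_fst F \<longleftrightarrow> cont_bdd F \<and> differentiable1 F \<and> cont_bdd (D1 F) \<and>
     differentiable1 (D1 F) \<and> cont_bdd (D1 (D1 F))"

definition Cb_1_1 :: "('a::real_normed_vector \<Rightarrow> 'a \<Rightarrow> real) set" where
  "Cb_1_1 = {F. Cb1_fst F \<and> differentiable2 F \<and> Cb1_fst (D2 F)}"

definition Cb_2_2 :: "('a::real_normed_vector \<Rightarrow> 'a \<Rightarrow> real) set" where
  "Cb_2_2 = {F. Cb2_fst F \<and> differentiable2 F \<and> Cb2_fst (D2 F) \<and>
     differentiable2 (D2 F) \<and> Cb2_fst (D2 (D2 F))}"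

text \<open>Real trigonometric polynomials, that is, real and imaginary parts of finite linear
  combinations of exponentials.\<close>

definition trig_poly :: "('a::real_inner \<Rightarrow> real) set" where
  "trig_poly = {\<phi>. \<exists>S a b. finite S \<and>
     \<phi> = (\<lambda>x. \<Sum>h\<in>S. a h * cos (inner h x) + b h * sin (inner h x))}"

text \<open>The domain of the Malliavin derivative, which is the closure in \<open>L\<^sup>2(N)\<close> of
  the operator \<open>C\<^sup>1\<^sup>/\<^sup>2 D\<close> defined on trigonometric polynomials; \<open>G\<close> below is the
  Malliavin derivative of \<open>f\<close>.\<close>

definition malliavin_W12 ::
  "('a::{real_inner, banach, second_countable_topology} \<Rightarrow>\<^sub>L 'a) \<Rightarrow> 'a measure \<Rightarrow> ('a \<Rightarrow> real) set" where
  "malliavin_W12 C N = {f. f \<in> borel_measurable N \<and> integrable N (\<lambda>x. (f x)\<^sup>2) \<and>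
     (\<exists>G \<phi>. G \<in> borel_measurable N \<and> integrable N (\<lambda>x. (norm (G x))\<^sup>2) \<and>
        (\<forall>n::nat. \<phi> n \<in> trig_poly) \<and>
        (\<lambda>n. \<integral>\<^sup>+x. ennreal ((\<phi> n x - f x)\<^sup>2) \<partial>N) \<longlonglongrightarrow> 0 \<and>
        (\<lambda>n. \<integral>\<^sup>+x. ennreal ((norm (blinfun_apply (op_sqrt C) (grad (\<phi> n) x) - G x))\<^sup>2) \<partial>N)
          \<longlonglongrightarrow> 0)}"

definition pd_kernel :: "('a \<Rightarrow> 'a \<Rightarrow> real) \<Rightarrow> bool" where
  "pd_kernel k \<longleftrightarrow> (\<forall>x y. k x y = k y x) \<and>
     (\<forall>S a. finite S \<longrightarrow> (\<Sum>x\<in>S. \<Sum>y\<in>S. a x * a y * k x y) \<ge> 0)"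

definition rkhs_norm :: "(('a \<Rightarrow> real) \<Rightarrow> ('a \<Rightarrow> real) \<Rightarrow> real) \<Rightarrow> ('a \<Rightarrow> real) \<Rightarrow> real" where
  "rkhs_norm ip f = sqrt (ip f f)"

text \<open>\<open>H\<close> with inner product \<open>ip\<close> is the reproducing kernel Hilbert space of \<open>k\<close>.
  By the Moore--Aronszajn theorem, every kernel \<open>k\<close> has exactly one such \<open>H\<close>, and \<open>ip\<close> is
  uniquely determined on \<open>H\<close>.\<close>

definition rkhs ::
  "('a \<Rightarrow> 'a \<Rightarrow> real) \<Rightarrow> ('a \<Rightarrow> real) set \<Rightarrow> (('a \<Rightarrow> real) \<Rightarrow> ('a \<Rightarrow> real) \<Rightarrow> real) \<Rightarrow> bool" where
  "rkhs k H ip \<longleftrightarrow>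
     (\<lambda>x. 0) \<in> H \<and>
     (\<forall>f\<in>H. \<forall>g\<in>H. \<forall>a b. (\<lambda>x. a * f x + b * g x) \<in> H) \<and>
     (\<forall>f\<in>H. \<forall>g\<in>H. ip f g = ip g f) \<and>
     (\<forall>f\<in>H. \<forall>g\<in>H. \<forall>h\<in>H. \<forall>a b. ip (\<lambda>x. a * f x + b * g x) h = a * ip f h + b * ip g h) \<and>
     (\<forall>f\<in>H. ip f f \<ge> 0 \<and> (ip f f = 0 \<longrightarrow> f = (\<lambda>x. 0))) \<and>
     (\<forall>f. (\<forall>n::nat. f n \<in> H) \<and>
          (\<forall>\<epsilon>>0. \<exists>M. \<forall>m\<ge>M. \<forall>n\<ge>M. rkhs_norm ip (\<lambda>x. f m x - f n x) < \<epsilon>) \<longrightarrow>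
          (\<exists>g\<in>H. (\<lambda>n. rkhs_norm ip (\<lambda>x. f n x - g x)) \<longlonglongrightarrow> 0)) \<and>
     (\<forall>x. (\<lambda>y. k y x) \<in> H) \<and>
     (\<forall>f\<in>H. \<forall>x. f x = ip f (\<lambda>y. k y x))"

definition vrkhs ::
  "('a \<Rightarrow> real) set \<Rightarrow> (('a \<Rightarrow> real) \<Rightarrow> ('a \<Rightarrow> real) \<Rightarrow> real) \<Rightarrow> ('a::real_inner \<Rightarrow> 'a) set" where
  "vrkhs H ip = {F. (\<forall>e\<in>some_onb. (\<lambda>x. inner (F x) e) \<in> H) \<and>
     (\<lambda>e. (rkhs_norm ip (\<lambda>x. inner (F x) e))\<^sup>2) summable_on some_onb}"

definition vrkhs_norm ::
  "(('a \<Rightarrow> real) \<Rightarrow> ('a \<Rightarrow> real) \<Rightarrow> real) \<Rightarrow> ('a::real_inner \<Rightarrow> 'a) \<Rightarrow> real" where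
  "vrkhs_norm ip F = sqrt (\<Sum>\<^sub>\<infinity>e\<in>some_onb. (rkhs_norm ip (\<lambda>x. inner (F x) e))\<^sup>2)"

definition stein_op ::
  "('a::real_inner \<Rightarrow>\<^sub>L 'a) \<Rightarrow> ('a \<Rightarrow> real) \<Rightarrow> ('a \<Rightarrow> real) \<Rightarrow> 'a \<Rightarrow> real" where
  "stein_op C U f x = op_trace (\<lambda>h. blinfun_apply C (hess f x h))
     - inner (grad f x) (x + blinfun_apply C (grad U x))"

definition stein_op_v ::
  "('a::real_inner \<Rightarrow>\<^sub>L 'a) \<Rightarrow> ('a \<Rightarrow> real) \<Rightarrow> ('a \<Rightarrow> 'a) \<Rightarrow> 'a \<Rightarrow> real" where
  "stein_op_v C U F x = op_trace (\<lambda>h. blinfun_apply C (frechet_derivative F (at x) h))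
     - inner (F x) (x + blinfun_apply C (grad U x))"

definition Gamma_op ::
  "('a::real_inner \<Rightarrow>\<^sub>L 'a) \<Rightarrow> ('a \<Rightarrow> real) \<Rightarrow> ('a \<Rightarrow> real) \<Rightarrow> 'a \<Rightarrow> 'a" where
  "Gamma_op C U f x = blinfun_apply C (grad f x) - f x *\<^sub>R (x + blinfun_apply C (grad U x))"

text \<open>Complex-linear extensions.  The complexification of the space is represented by pairs, with
  \<open>(a, b)\<close> standing for \<open>a + i b\<close>.\<close>

definition stein_op_complex ::
  "('a::real_inner \<Rightarrow>\<^sub>L 'a) \<Rightarrow> ('a \<Rightarrow> real) \<Rightarrow> ('a \<Rightarrow> complex) \<Rightarrow> 'a \<Rightarrow> complex" where
  "stein_op_complex C U f x =
     Complex (stein_op C U (\<lambda>y. Re (f y)) x) (stein_op C U (\<lambda>y. Im (f y)) x)"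

definition Gamma_op_complex ::
  "('a::real_inner \<Rightarrow>\<^sub>L 'a) \<Rightarrow> ('a \<Rightarrow> real) \<Rightarrow> ('a \<Rightarrow> complex) \<Rightarrow> 'a \<Rightarrow> 'a \<times> 'a" where
  "Gamma_op_complex C U f x =
     (Gamma_op C U (\<lambda>y. Re (f y)) x, Gamma_op C U (\<lambda>y. Im (f y)) x)"

definition cplx_inner :: "'a::real_inner \<times> 'a \<Rightarrow> 'a \<times> 'a \<Rightarrow> complex" where
  "cplx_inner z w = complex_of_real (inner (fst z) (fst w) + inner (snd z) (snd w))
     + \<i> * complex_of_real (inner (snd z) (fst w)) - \<i> * complex_of_real (inner (fst z) (snd w))"

definition cplx_norm :: "'a::real_inner \<times> 'a \<Rightarrow> real" where
  "cplx_norm z = sqrt (Re (cplx_inner z z))"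

text \<open>Hence the Bochner integral of the product type is the one of the complexification.\<close>

lemma cplx_norm_eq_norm: "cplx_norm z = norm z"
  by (simp add: cplx_norm_def cplx_inner_def norm_prod_def power2_norm_eq_inner)

text \<open>The discrepancies take values in \<open>[0, \<infinity>]\<close>, so that the suprema need no boundedness proviso.
  The target measure enters only through the operators, that is, through \<open>C\<close> and \<open>U\<close>.\<close>

definition KSD ::
  "('a::{real_inner, banach, second_countable_topology} \<Rightarrow>\<^sub>L 'a) \<Rightarrow> ('a \<Rightarrow> real) \<Rightarrow>
   ('a \<Rightarrow> real) set \<Rightarrow> (('a \<Rightarrow> real) \<Rightarrow> ('a \<Rightarrow> real) \<Rightarrow> real) \<Rightarrow> 'a measure \<Rightarrow> ennreal" where
  "KSD C U H ip Q =
     (SUP f \<in> {f \<in> H. rkhs_norm ip f \<le> 1}. ennreal \<bar>\<integral>x. stein_op C U f x \<partial>Q\<bar>)"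

definition KSD_v ::
  "('a::{real_inner, banach, second_countable_topology} \<Rightarrow>\<^sub>L 'a) \<Rightarrow> ('a \<Rightarrow> real) \<Rightarrow>
   ('a \<Rightarrow> real) set \<Rightarrow> (('a \<Rightarrow> real) \<Rightarrow> ('a \<Rightarrow> real) \<Rightarrow> real) \<Rightarrow> 'a measure \<Rightarrow> ennreal" where
  "KSD_v C U H ip Q =
     (SUP F \<in> {F \<in> vrkhs H ip. vrkhs_norm ip F \<le> 1}. ennreal \<bar>\<integral>x. stein_op_v C U F x \<partial>Q\<bar>)"

end

theory Submission
  imports Defs
begin

text \<open>
  The kernel has the feature map \<open>x \<mapsto> wave s x\<close> into the complex \<open>L\<^sup>2(\<mu>)\<close>, so a function of the
  form \<open>f x = \<integral> Re (cnj (g s) * wave s x) d\<mu>(s)\<close> is mapped by \<open>f \<mapsto> E\<^sub>Q[A f]\<close> to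
  \<open>\<integral> Re (cnj (g s) * \<theta> s) d\<mu>(s)\<close> with \<open>\<theta> s = E\<^sub>Q[A (wave s)]\<close>. If \<open>h\<close> is the Riesz representer
  of this functional in the RKHS, then evaluating it at kernel sections shows that \<open>h\<close> itself is of
  that form with \<open>g = \<theta>\<close>. Hence the squared discrepancy is \<open>\<parallel>h\<parallel>\<^sup>2 = E\<^sub>Q[A h] = \<integral> \<bar>\<theta>\<bar>\<^sup>2 d\<mu>\<close>.
  For \<open>K = k I\<close> the same is done in every direction of an orthonormal basis.

  In infinite dimensions \<open>\<integral> \<parallel>s\<parallel>\<^sup>2 d\<mu>(s)\<close> may be infinite; smoothness of \<open>k\<close> only bounds the
  directional moments \<open>\<integral> \<langle>s, u\<rangle>\<^sup>2 d\<mu>(s)\<close> by a multiple of \<open>\<parallel>u\<parallel>\<^sup>2\<close> (and similarly the fourth moments).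
  This suffices because traces against \<open>C\<close> are integrals over \<open>N\<close>, whose second moment is finite.
\<close>

section \<open>Abstract Hilbert spaces and orthonormal bases\<close>

text \<open>The space \<open>H\<close> is given only by the axioms in \<open>rkhs\<close>: its
  elements are not known to be differentiable, nor to have the form \<open>synth g\<close>.
  Differentiability is won from the reproducing property: an increment of \<open>f\<close> is its
  inner product with a combination of sections whose squared norm is an increment of
  \<open>k\<close>. Bounds on mixed derivatives of \<open>k\<close> thus become Lipschitz bounds
  linear in \<open>nrm f\<close>, and since combinations of sections are dense, derivatives pass to
  the limit uniformly. The same bounds make the Stein functional bounded, so that Riesz applies. On
  the side of \<open>\<mu>\<close>, the same increments of \<open>k\<close> are squared
  \<open>L\<^sup>2\<close> norms of increments of \<open>wave\<close>, and Fatou turns them into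
  directional moments. Under \<open>Q\<close> only a first moment of \<open>x + C DU(x)\<close> is
  at hand, so in the scalar case square integrability of \<open>\<theta>\<close> rests on a weighted
  Cauchy--Schwarz inequality. In the vector case no representer in \<open>vrkhs H ip\<close> is
  assembled: finitely many directions are treated at a time and monotone convergence
  finishes.\<close>

lemma tendsto_power2_zero_iff:
  fixes f :: "'b \<Rightarrow> real"
  shows "((\<lambda>x. (f x)\<^sup>2) \<longlongrightarrow> 0) F \<longleftrightarrow> (f \<longlongrightarrow> 0) F"
proof
  assume "((\<lambda>x. (f x)\<^sup>2) \<longlongrightarrow> 0) F"
  then show "(f \<longlongrightarrow> 0) F"
    using tendsto_real_sqrt[of "\<lambda>x. (f x)\<^sup>2" 0 F] by (simp add: tendsto_rabs_zero_iff)
next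
  assume "(f \<longlongrightarrow> 0) F"
  then show "((\<lambda>x. (f x)\<^sup>2) \<longlongrightarrow> 0) F" by (auto intro: tendsto_null_power)
qed

text \<open>Carrier, linear combination and form are explicit so that the function space
  \<open>H\<close>, the square integrable functions and a whole Hilbert type are all instances. The
  form is only semidefinite, as befits functions that are not identified almost everywhere.\<close>

locale pre_hilbert_on =
  fixes V :: "'v set" and comb :: "real \<Rightarrow> 'v \<Rightarrow> real \<Rightarrow> 'v \<Rightarrow> 'v" and ip :: "'v \<Rightarrow> 'v \<Rightarrow> real"
  assumes comb_in: "f \<in> V \<Longrightarrow> g \<in> V \<Longrightarrow> comb a f b g \<in> V"
    and ip_sym: "f \<in> V \<Longrightarrow> g \<in> V \<Longrightarrow> ip f g = ip g f"
    and ip_comb: "f \<in> V \<Longrightarrow> g \<in> V \<Longrightarrow> h \<in> V \<Longrightarrow> ip (comb a f b g) h = a * ip f h + b * ip g h"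
    and ip_nonneg: "f \<in> V \<Longrightarrow> 0 \<le> ip f f"
begin

lemma ip_comb_right: "f \<in> V \<Longrightarrow> g \<in> V \<Longrightarrow> h \<in> V \<Longrightarrow> ip h (comb a f b g) = a * ip h f + b * ip h g"
  by (metis comb_in ip_comb ip_sym)

lemma ip_comb_self:
  "f \<in> V \<Longrightarrow> g \<in> V \<Longrightarrow> ip (comb a f b g) (comb a f b g) = a\<^sup>2 * ip f f + 2 * a * b * ip f g + b\<^sup>2 * ip g g"
  by (simp add: ip_comb ip_comb_right comb_in ip_sym[of g f] power2_eq_square algebra_simps)

lemma Cauchy_Schwarz:
  assumes "f \<in> V" "g \<in> V"
  shows "(ip f g)\<^sup>2 \<le> ip f f * ip g g"
proof -
  have *: "0 \<le> a\<^sup>2 * ip f f + 2 * a * b * ip f g + b\<^sup>2 * ip g g" for a b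
    using ip_nonneg[OF comb_in[OF assms, of a b]] by (simp only: ip_comb_self[OF assms])
  show ?thesis
  proof (cases "ip g g = 0")
    case True
    have "ip f g = 0"
    proof (rule ccontr)
      assume "ip f g \<noteq> 0"
      \<comment> \<open>With \<open>ip g g = 0\<close> the quadratic is affine in its second
        coefficient; this choice of it makes the value \<open>-1\<close>.\<close>
      then show False
        using *[of 1 "- (ip f f + 1) / (2 * ip f g)"] True by (simp add: field_simps)
    qed
    with True show ?thesis by simp
  next
    case False
    then have pos: "ip g g > 0" using ip_nonneg[OF assms(2)] by simp
    have "0 \<le> ip g g * (ip f f * ip g g - (ip f g)\<^sup>2)"
      using *[of "ip g g" "- ip f g"] by (simp add: power2_eq_square algebra_simps)
    then show ?thesis using pos by (simp add: zero_le_mult_iff)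
  qed
qed

lemma Cauchy_Schwarz_sqrt:
  assumes "f \<in> V" "g \<in> V"
  shows "\<bar>ip f g\<bar> \<le> sqrt (ip f f) * sqrt (ip g g)"
  using Cauchy_Schwarz[OF assms] by (metis real_sqrt_abs real_sqrt_le_iff real_sqrt_mult)

end

locale hilbert_on = pre_hilbert_on +
  assumes ip_complete: "(\<And>n::nat. w n \<in> V) \<Longrightarrow>
      (\<And>\<epsilon>. \<epsilon> > 0 \<Longrightarrow> \<exists>M. \<forall>m\<ge>M. \<forall>n\<ge>M. ip (comb 1 (w m) (-1) (w n)) (comb 1 (w m) (-1) (w n)) < \<epsilon>) \<Longrightarrow>
      \<exists>g\<in>V. (\<lambda>n. ip (comb 1 (w n) (-1) g) (comb 1 (w n) (-1) g)) \<longlonglongrightarrow> 0"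
begin

lemma tendsto_ip:
  assumes "\<And>n::nat. w n \<in> V" "h \<in> V" "v \<in> V"
    and lim: "(\<lambda>n. ip (comb 1 (w n) (-1) h) (comb 1 (w n) (-1) h)) \<longlonglongrightarrow> 0"
  shows "(\<lambda>n. ip (w n) v) \<longlonglongrightarrow> ip h v"
proof -
  have "(\<lambda>n. ip (w n) v - ip h v) \<longlonglongrightarrow> 0"
  proof (rule Lim_null_comparison)
    show "\<forall>\<^sub>F n in sequentially. norm (ip (w n) v - ip h v)
        \<le> sqrt (ip (comb 1 (w n) (-1) h) (comb 1 (w n) (-1) h)) * sqrt (ip v v)"
    proof (intro always_eventually allI)
      show "norm (ip (w n) v - ip h v)
          \<le> sqrt (ip (comb 1 (w n) (-1) h) (comb 1 (w n) (-1) h)) * sqrt (ip v v)" for n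
        using Cauchy_Schwarz_sqrt[OF comb_in[OF assms(1,2)] assms(3), of 1 n "-1"] assms(1-3)
        by (simp add: ip_comb)
    qed
    show "(\<lambda>n. sqrt (ip (comb 1 (w n) (-1) h) (comb 1 (w n) (-1) h)) * sqrt (ip v v)) \<longlonglongrightarrow> 0"
      using tendsto_mult[OF tendsto_real_sqrt[OF lim] tendsto_const[of "sqrt (ip v v)"]] by simp
  qed
  then show ?thesis by (simp add: LIM_zero_cancel)
qed

text \<open>The representer is the minimiser of \<open>v \<mapsto> ip v v - 2 l v\<close>; by the parallelogram law every
  minimising sequence is Cauchy.\<close>

lemma Riesz_subspace:
  assumes W: "W \<subseteq> V" "W \<noteq> {}"
    and W_comb: "\<And>a f b g. f \<in> W \<Longrightarrow> g \<in> W \<Longrightarrow> comb a f b g \<in> W"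
    and lin: "\<And>a f b g. f \<in> W \<Longrightarrow> g \<in> W \<Longrightarrow> l (comb a f b g) = a * l f + b * l g"
    and c: "0 \<le> c" and bdd: "\<And>v. v \<in> W \<Longrightarrow> (l v)\<^sup>2 \<le> c * ip v v"
  obtains h w where "h \<in> V" "\<And>n::nat. w n \<in> W"
    "(\<lambda>n. ip (comb 1 (w n) (-1) h) (comb 1 (w n) (-1) h)) \<longlonglongrightarrow> 0" "\<And>v. v \<in> W \<Longrightarrow> ip h v = l v"
proof -
  define J where "J v = ip v v - 2 * l v" for v
  define m where "m = Inf (J ` W)"
  have lower: "- c \<le> J v" if v: "v \<in> W" for v
  proof -
    have q: "0 \<le> ip v v" using ip_nonneg W v by blast
    have "\<bar>l v\<bar> \<le> sqrt c * sqrt (ip v v)"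
      using bdd[OF v] by (metis real_sqrt_abs real_sqrt_le_iff real_sqrt_mult)
    moreover have "2 * (sqrt c * sqrt (ip v v)) \<le> c + ip v v"
      using c q zero_le_power2[of "sqrt c - sqrt (ip v v)"] by (simp add: power2_diff)
    ultimately show ?thesis unfolding J_def by linarith
  qed
  have bb: "bdd_below (J ` W)" using lower by (auto intro!: bdd_belowI)
  have m_le: "m \<le> J v" if "v \<in> W" for v
    unfolding m_def using that bb by (simp add: cInf_lower)
  have "\<exists>v\<in>W. J v < m + 1 / (real n + 1)" for n
  proof -
    have "m < m + 1 / (real n + 1)" by simp
    then show ?thesis
      unfolding m_def using W(2) by (subst (asm) cInf_less_iff) (auto simp: bb)
  qed
  then obtain w where w: "\<And>n. w n \<in> W" "\<And>n. J (w n) < m + 1 / (real n + 1)" by metis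
  have wV: "w n \<in> V" for n using w W by auto
  have par: "ip (comb 1 (w i) (-1) (w j)) (comb 1 (w i) (-1) (w j)) \<le> 2 / (real i + 1) + 2 / (real j + 1)" for i j
  proof -
    have "m \<le> J (comb (1/2) (w i) (1/2) (w j))" using m_le W_comb w by blast
    also have "\<dots> = (J (w i) + J (w j)) / 2 - ip (comb 1 (w i) (-1) (w j)) (comb 1 (w i) (-1) (w j)) / 4"
      unfolding J_def by (simp add: ip_comb_self[OF wV wV] lin[OF w(1) w(1)] power2_eq_square field_simps)
    finally have "ip (comb 1 (w i) (-1) (w j)) (comb 1 (w i) (-1) (w j)) \<le> 2 * (1 / (real i + 1)) + 2 * (1 / (real j + 1))"
      using w(2)[of i] w(2)[of j] by argo
    then show ?thesis by simp
  qed
  have "\<exists>g\<in>V. (\<lambda>n. ip (comb 1 (w n) (-1) g) (comb 1 (w n) (-1) g)) \<longlonglongrightarrow> 0"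
  proof (rule ip_complete[OF wV])
    fix \<epsilon> :: real assume \<epsilon>: "\<epsilon> > 0"
    obtain M where M: "4 / \<epsilon> < real M" using reals_Archimedean2 by blast
    have small: "2 / (real i + 1) < \<epsilon> / 2" if "i \<ge> M" for i
    proof -
      have "4 / \<epsilon> < real i + 1" using M that by linarith
      then show ?thesis using \<epsilon> by (simp add: field_simps)
    qed
    show "\<exists>M. \<forall>i\<ge>M. \<forall>j\<ge>M. ip (comb 1 (w i) (-1) (w j)) (comb 1 (w i) (-1) (w j)) < \<epsilon>"
    proof (intro exI[of _ M] allI impI)
      fix i j assume "M \<le> i" "M \<le> j"
      then show "ip (comb 1 (w i) (-1) (w j)) (comb 1 (w i) (-1) (w j)) < \<epsilon>"
        using par[of i j] small[of i] small[of j] by linarith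
    qed
  qed
  then obtain h where h: "h \<in> V" "(\<lambda>n. ip (comb 1 (w n) (-1) h) (comb 1 (w n) (-1) h)) \<longlonglongrightarrow> 0" by blast
  have "ip h v = l v" if v: "v \<in> W" for v
  proof -
    have vV: "v \<in> V" using v W by auto
    have q: "0 \<le> ip v v" using ip_nonneg vV by blast
    have "(ip (w n) v - l v)\<^sup>2 \<le> (ip v v + 1) * (1 / (real n + 1))" for n
    proof -
      define r where "r = ip (w n) v - l v"
      \<comment> \<open>Nearly the minimiser \<open>- r / ip v v\<close> of \<open>J\<close> along
        \<open>v\<close>; the \<open>+ 1\<close> also covers a null vector \<open>v\<close>, at the
        cost of a harmless constant.\<close>
      define t where "t = - r / (ip v v + 1)"
      have "m \<le> J (comb 1 (w n) t v)" using m_le W_comb w v by blast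
      also have "\<dots> = J (w n) + 2 * t * r + t\<^sup>2 * ip v v"
        unfolding J_def r_def by (simp add: ip_comb_self[OF wV vV] lin[OF w(1) v] algebra_simps)
      also have "t\<^sup>2 * ip v v \<le> t\<^sup>2 * (ip v v + 1)" by (simp add: algebra_simps)
      also have "\<dots> = - t * r" using q by (simp add: t_def power2_eq_square)
      finally have "- t * r \<le> 1 / (real n + 1)" using w(2)[of n] by linarith
      moreover have "- t * r = r\<^sup>2 / (ip v v + 1)" by (simp add: t_def power2_eq_square)
      ultimately show ?thesis using q unfolding r_def
        by (simp add: divide_le_eq mult.commute)
    qed
    moreover have "(\<lambda>n. (ip v v + 1) * (1 / (real n + 1))) \<longlonglongrightarrow> 0"
      using tendsto_mult_right_zero[OF LIMSEQ_inverse_real_of_nat, of "ip v v + 1"]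
      by (simp add: inverse_eq_divide add.commute)
    ultimately have "(\<lambda>n. (ip (w n) v - l v)\<^sup>2) \<longlonglongrightarrow> 0"
      by (rule_tac Lim_null_comparison[where g="\<lambda>n. (ip v v + 1) * (1 / (real n + 1))"]) auto
    then have "(\<lambda>n. ip (w n) v) \<longlonglongrightarrow> l v"
      by (simp add: tendsto_power2_zero_iff LIM_zero_cancel[of "\<lambda>n. ip (w n) v"])
    moreover have "(\<lambda>n. ip (w n) v) \<longlonglongrightarrow> ip h v" by (rule tendsto_ip[OF wV h(1) vV h(2)])
    ultimately show ?thesis using LIMSEQ_unique by blast
  qed
  with that h w show ?thesis by blast
qed

end

lemma hilbert_on_UNIV:
  "hilbert_on (UNIV :: 'a::{real_inner, banach} set) (\<lambda>a x b y. a *\<^sub>R x + b *\<^sub>R y) inner"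
proof (unfold_locales, goal_cases)
  case (5 f)
  have "Cauchy f"
  proof (rule CauchyI)
    fix e :: real assume e: "e > 0"
    obtain M where M: "\<And>m n. m \<ge> M \<Longrightarrow> n \<ge> M \<Longrightarrow> inner (f m - f n) (f m - f n) < e\<^sup>2"
      using 5(2)[of "e\<^sup>2"] e by auto
    show "\<exists>M. \<forall>m\<ge>M. \<forall>n\<ge>M. norm (f m - f n) < e"
      using M e by (intro exI[of _ M]) (auto simp: dot_square_norm intro: power2_less_imp_less)
  qed
  then obtain g where "f \<longlonglongrightarrow> g" using Cauchy_convergent convergentD by blast
  then have "(\<lambda>n. (norm (f n - g))\<^sup>2) \<longlonglongrightarrow> 0"
    using tendsto_norm_zero[OF LIM_zero] by (simp add: tendsto_power2_zero_iff)
  then show ?case by (intro bexI[of _ g]) (auto simp: dot_square_norm)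
qed (auto simp: inner_commute inner_left_distrib inner_right_distrib)

lemma Riesz_representation:
  fixes \<phi> :: "'a::{real_inner, banach} \<Rightarrow> real"
  assumes "bounded_linear \<phi>"
  obtains g where "\<And>x. \<phi> x = inner g x"
proof -
  interpret bounded_linear \<phi> by fact
  interpret hilbert_on "UNIV :: 'a set" "\<lambda>a x b y. a *\<^sub>R x + b *\<^sub>R y" inner
    by (rule hilbert_on_UNIV)
  obtain K where K: "\<And>x. norm (\<phi> x) \<le> norm x * K" using bounded by blast
  have "(\<phi> x)\<^sup>2 \<le> K\<^sup>2 * inner x x" for x
    using power_mono[OF K[of x] norm_ge_zero, of 2] by (simp add: dot_square_norm power_mult_distrib mult.commute)
  then show ?thesis
    using Riesz_subspace[of UNIV \<phi> "K\<^sup>2" thesis] that by (auto simp: add scaleR) metis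
qed

text \<open>For \<open>y\<close> outside the closure, \<open>Riesz_subspace\<close> applied to
  \<open>inner y\<close> on \<open>S\<close> yields the orthogonal projection \<open>h\<close> as a
  limit of points of \<open>S\<close>; hence \<open>y - h\<close> is nonzero and orthogonal to
  \<open>S\<close>.\<close>

lemma orthogonal_complement_nonzero:
  fixes S :: "'a::{real_inner, banach} set"
  assumes "subspace S" "closure S \<noteq> UNIV"
  obtains z where "z \<noteq> 0" "\<And>x. x \<in> S \<Longrightarrow> inner z x = 0"
proof -
  interpret hilbert_on "UNIV :: 'a set" "\<lambda>a x b y. a *\<^sub>R x + b *\<^sub>R y" inner
    by (rule hilbert_on_UNIV)
  obtain y where y: "y \<notin> closure S" using assms by blast
  obtain h w where hw: "\<And>n::nat. w n \<in> S"
    "(\<lambda>n. inner (1 *\<^sub>R w n + (-1) *\<^sub>R h) (1 *\<^sub>R w n + (-1) *\<^sub>R h)) \<longlonglongrightarrow> 0"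
    "\<And>v. v \<in> S \<Longrightarrow> inner h v = inner y v"
  proof (rule Riesz_subspace[of S "inner y" "inner y y"])
    show "S \<noteq> {}" using assms(1) subspace_0 by auto
    show "a *\<^sub>R f + b *\<^sub>R g \<in> S" if "f \<in> S" "g \<in> S" for a f b g
      using assms(1) that by (simp add: subspace_add subspace_scale)
    show "(inner y v)\<^sup>2 \<le> inner y y * inner v v" for v
      by (rule Cauchy_Schwarz_ineq)
  qed (auto simp: inner_right_distrib)
  have "(\<lambda>n. w n - h) \<longlonglongrightarrow> 0"
    using hw(2) by (simp add: dot_square_norm tendsto_power2_zero_iff tendsto_norm_zero_iff)
  then have "w \<longlonglongrightarrow> h" by (simp add: LIM_zero_cancel)
  then have "h \<in> closure S" using hw(1) closure_sequential by blast
  then have "y - h \<noteq> 0" using y by auto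
  then show ?thesis using that[of "y - h"] hw(3) by (simp add: inner_diff_left)
qed

text \<open>Zorn gives a maximal orthonormal set; a nonzero vector orthogonal to its span could be
  normalised and added. Existence is what gives meaning to the choice in
  \<open>some_onb\<close>.\<close>

lemma onb_exists: "\<exists>B :: 'a::{real_inner, banach} set. onb B"
proof -
  define \<A> where "\<A> = {B :: 'a set. pairwise orthogonal B \<and> (\<forall>e\<in>B. norm e = 1)}"
  have "\<exists>M\<in>\<A>. \<forall>X\<in>\<A>. M \<subseteq> X \<longrightarrow> X = M"
  proof (rule subset_Zorn)
    fix \<C> assume chain: "subset.chain \<A> \<C>"
    have "pairwise orthogonal (\<Union>\<C>)"
    proof (rule pairwise_chain_Union)
      show "chain\<^sub>\<subseteq> \<C>" using chain unfolding subset.chain_def chain_subset_def by blast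
    qed (use chain in \<open>auto simp: \<A>_def subset.chain_def\<close>)
    then have "\<Union>\<C> \<in> \<A>" using chain by (auto simp: \<A>_def subset.chain_def)
    then show "\<exists>U\<in>\<A>. \<forall>X\<in>\<C>. X \<subseteq> U" by blast
  qed
  then obtain B where B: "B \<in> \<A>" and max: "\<And>X. X \<in> \<A> \<Longrightarrow> B \<subseteq> X \<Longrightarrow> X = B" by blast
  have "closure (span B) = UNIV"
  proof (rule ccontr)
    assume "closure (span B) \<noteq> UNIV"
    then obtain z where z: "z \<noteq> 0" "\<And>x. x \<in> span B \<Longrightarrow> inner z x = 0"
      using orthogonal_complement_nonzero subspace_span by metis
    define e where "e = z /\<^sub>R norm z"
    have e: "norm e = 1" "\<And>x. x \<in> B \<Longrightarrow> inner e x = 0"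
      using z by (auto simp: e_def span_base)
    have "insert e B \<in> \<A>"
      using B e by (auto simp: \<A>_def pairwise_insert orthogonal_def inner_commute)
    then have "e \<in> B" using max by blast
    then show False using e by force
  qed
  then show ?thesis using B by (auto simp: \<A>_def onb_def)
qed

lemma onb_some_onb: "onb (some_onb :: 'a::{real_inner, banach} set)"
  unfolding some_onb_def using onb_exists by (rule someI_ex)

section \<open>Expansions in an orthonormal basis\<close>

context
  fixes B :: "'a::{real_inner, banach} set"
  assumes onb: "onb B"
begin

lemma onb_inner: "e \<in> B \<Longrightarrow> e' \<in> B \<Longrightarrow> inner e e' = (if e = e' then 1 else 0)"
  using onb by (auto simp: onb_def pairwise_def orthogonal_def dot_square_norm)

lemma inner_onb_sum:
  assumes "finite F" "F \<subseteq> B" "e \<in> B"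
  shows "inner (\<Sum>e\<in>F. c e *\<^sub>R e) e = (if e \<in> F then c e else 0)"
proof -
  have "inner (\<Sum>e\<in>F. c e *\<^sub>R e) e = (\<Sum>e'\<in>F. c e' * (if e' = e then 1 else 0))"
    unfolding inner_sum_left using assms by (intro sum.cong refl) (auto simp: onb_inner)
  then show ?thesis using assms(1) by (simp add: sum.delta if_distrib cong: if_cong)
qed

text \<open>Completing squares coefficient by coefficient. With \<open>c e = inner x e\<close> the
  last sum vanishes, so Fourier coefficients give the best approximation; with \<open>x = 0\<close>
  the identity is Pythagoras.\<close>

lemma norm_diff_onb_sum:
  assumes F: "finite F" "F \<subseteq> B"
  shows "(norm (x - (\<Sum>e\<in>F. c e *\<^sub>R e)))\<^sup>2 = (norm x)\<^sup>2 - (\<Sum>e\<in>F. (inner x e)\<^sup>2) + (\<Sum>e\<in>F. (c e - inner x e)\<^sup>2)"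
proof -
  let ?s = "\<Sum>e\<in>F. c e *\<^sub>R e"
  have "inner ?s ?s = (\<Sum>e\<in>F. c e * inner ?s e)"
    using inner_sum_right[of ?s "\<lambda>e. c e *\<^sub>R e" F] by simp
  also have "\<dots> = (\<Sum>e\<in>F. (c e)\<^sup>2)"
    using F by (intro sum.cong refl) (auto simp: inner_onb_sum[OF F] subset_iff power2_eq_square)
  finally have 1: "inner ?s ?s = (\<Sum>e\<in>F. (c e)\<^sup>2)" .
  have 2: "inner x ?s = (\<Sum>e\<in>F. c e * inner x e)" by (simp add: inner_sum_right)
  have 3: "(\<Sum>e\<in>F. (c e - inner x e)\<^sup>2) = (\<Sum>e\<in>F. (c e)\<^sup>2) - 2 * (\<Sum>e\<in>F. c e * inner x e) + (\<Sum>e\<in>F. (inner x e)\<^sup>2)"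
    unfolding power2_diff sum.distrib sum_subtractf by (simp add: sum_distrib_left mult.assoc)
  show ?thesis
    unfolding power2_norm_eq_inner inner_diff_left inner_diff_right inner_commute[of ?s x] 1 2 3 by simp
qed

text \<open>A point of the dense span within \<open>\<epsilon>\<close> uses only finitely many basis
  vectors. Fourier coefficients approximate at least as well, and a larger finite set does no worse,
  which is convergence along the filter of finite subsets.\<close>

lemma onb_expansion: "((\<lambda>e. inner x e *\<^sub>R e) has_sum x) B"
  unfolding has_sum_def tendsto_iff eventually_finite_subsets_at_top
proof (intro allI impI)
  fix \<epsilon> :: real assume \<epsilon>: "\<epsilon> > 0"
  have "x \<in> closure (span B)" using onb by (simp add: onb_def)
  then obtain y where y: "y \<in> span B" "dist y x < \<epsilon>" using \<epsilon> closure_approachable by blast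
  obtain F c where F: "finite F" "F \<subseteq> B" "y = (\<Sum>e\<in>F. c e *\<^sub>R e)"
    using y(1) unfolding span_explicit by blast
  have "dist (\<Sum>e\<in>G. inner x e *\<^sub>R e) x < \<epsilon>" if G: "finite G" "F \<subseteq> G" "G \<subseteq> B" for G
  proof -
    have "(norm (x - (\<Sum>e\<in>G. inner x e *\<^sub>R e)))\<^sup>2 = (norm x)\<^sup>2 - (\<Sum>e\<in>G. (inner x e)\<^sup>2)"
      using norm_diff_onb_sum[OF G(1,3), of x "inner x"] by simp
    also have "\<dots> \<le> (norm x)\<^sup>2 - (\<Sum>e\<in>F. (inner x e)\<^sup>2)"
      using G by (simp add: sum_mono2)
    also have "\<dots> \<le> (norm (x - y))\<^sup>2"
      using norm_diff_onb_sum[OF F(1,2), of x c] F(3) by (simp add: sum_nonneg)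
    finally have "norm (x - (\<Sum>e\<in>G. inner x e *\<^sub>R e)) \<le> norm (x - y)"
      by (rule power2_le_imp_le) simp
    then show ?thesis using y(2) by (simp add: dist_norm norm_minus_commute)
  qed
  then show "\<exists>F. finite F \<and> F \<subseteq> B \<and> (\<forall>G. finite G \<and> F \<subseteq> G \<and> G \<subseteq> B \<longrightarrow> dist (\<Sum>e\<in>G. inner x e *\<^sub>R e) x < \<epsilon>)"
    using F by blast
qed

lemma Parseval: "((\<lambda>e. inner x e * inner y e) has_sum inner x y) B"
  using has_sum_bounded_linear[OF bounded_linear_inner_right[of y] onb_expansion[of x]]
  by (simp add: inner_commute[of x y])

lemma Parseval_norm: "((\<lambda>e. (inner x e)\<^sup>2) has_sum (norm x)\<^sup>2) B"
  using Parseval[of x x] by (simp add: power2_eq_square dot_square_norm)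

end

text \<open>Distinct basis vectors are at distance \<open>sqrt 2\<close>, so points of a countable
  dense set chosen within \<open>1/2\<close> of them are distinct.\<close>

lemma countable_onb:
  fixes B :: "'a::{real_inner, banach, second_countable_topology} set"
  assumes "onb B"
  shows "countable B"
proof -
  obtain D :: "'a set" where D: "countable D" "\<And>X. open X \<Longrightarrow> X \<noteq> {} \<Longrightarrow> \<exists>d\<in>D. d \<in> X"
    using countable_dense_exists by blast
  have "\<exists>d\<in>D. d \<in> ball e (1/2)" for e :: 'a by (rule D(2)) auto
  then obtain d where d: "\<And>e :: 'a. d e \<in> D" "\<And>e. dist e (d e) < 1/2" by (metis mem_ball)
  have "inj_on d B"
  proof (rule inj_onI, rule ccontr)
    fix e e' assume e: "e \<in> B" "e' \<in> B" "d e = d e'" "e \<noteq> e'"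
    have "(norm (e - e'))\<^sup>2 = 2"
      using e onb_inner[OF assms] by (simp add: power2_norm_eq_inner inner_diff_left inner_diff_right)
    moreover have "norm (e - e') < 1"
      using d(2)[of e] d(2)[of e'] e(3) dist_triangle2[of e e' "d e"] by (simp add: dist_norm)
    then have "(norm (e - e'))\<^sup>2 < 1" by (simp add: power_less_one_iff)
    ultimately show False by simp
  qed
  then show ?thesis using D(1) d(1) by (meson countable_image_inj_on countable_subset image_subsetI)
qed

section \<open>Gaussian measures and traces\<close>

text \<open>Turns a limit along all finite subsets of a countable basis into a limit of an
  increasing sequence, the form that monotone convergence and measurability of limits
  require.\<close>

lemma countable_finite_exhaustion:
  assumes "countable B"
  obtains F :: "nat \<Rightarrow> 'b set" where "\<And>n. finite (F n)" "\<And>n. F n \<subseteq> B" "incseq F"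
    "filterlim F (finite_subsets_at_top B) sequentially"
proof -
  define F where "F n = {x \<in> B. to_nat_on B x < n}" for n
  have fin: "finite (F n)" for n
  proof (rule inj_on_finite[where B="{..<n}"])
    show "inj_on (to_nat_on B) (F n)"
      using inj_on_to_nat_on[OF assms] by (rule inj_on_subset) (auto simp: F_def)
  qed (auto simp: F_def)
  have inc: "incseq F" by (auto simp: F_def incseq_def)
  have "filterlim F (finite_subsets_at_top B) sequentially"
    unfolding filterlim_finite_subsets_at_top
  proof (intro allI impI)
    fix X assume X: "finite X \<and> X \<subseteq> B"
    then obtain m where m: "\<And>x. x \<in> X \<Longrightarrow> to_nat_on B x < m"
      using finite_nat_set_iff_bounded[of "to_nat_on B ` X"] by auto
    show "\<forall>\<^sub>F n in sequentially. finite (F n) \<and> X \<subseteq> F n \<and> F n \<subseteq> B"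
      using eventually_ge_at_top[of m]
      by eventually_elim (use X m fin in \<open>force simp: F_def\<close>)
  qed
  with fin inc show ?thesis by (intro that[of F]) (auto simp: F_def)
qed

lemma has_sum_sequence:
  "(f has_sum S) B \<Longrightarrow> filterlim F (finite_subsets_at_top B) sequentially \<Longrightarrow> (\<lambda>n. sum f (F n)) \<longlonglongrightarrow> S"
  unfolding has_sum_def by (rule filterlim_compose)

section \<open>Measurability and integral inequalities\<close>

lemma borel_measurable_weak:
  fixes f :: "'b \<Rightarrow> 'a::{real_inner, banach, second_countable_topology}"
  assumes "\<And>v. (\<lambda>x. inner (f x) v) \<in> borel_measurable M"
  shows "f \<in> borel_measurable M"
proof -
  obtain F where F: "\<And>n. finite (F n)" "\<And>n. F n \<subseteq> (some_onb :: 'a set)"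
    "filterlim F (finite_subsets_at_top some_onb) sequentially"
    using countable_finite_exhaustion[OF countable_onb[OF onb_some_onb]] by metis
  show ?thesis
  proof (rule borel_measurable_LIMSEQ_metric)
    show "(\<lambda>x. \<Sum>e\<in>F n. inner (f x) e *\<^sub>R e) \<in> borel_measurable M" for n
      using assms by (intro borel_measurable_sum borel_measurable_scaleR) auto
    show "(\<lambda>n. \<Sum>e\<in>F n. inner (f x) e *\<^sub>R e) \<longlonglongrightarrow> f x" for x
      by (rule has_sum_sequence[OF onb_expansion[OF onb_some_onb] F(3)])
  qed
qed

text \<open>A non-integrable \<open>f\<close> has Bochner integral \<open>0\<close> by convention,
  and \<open>g\<close> has a nonnegative integral because it dominates a norm; so the bound holds in
  that case as well.\<close>

lemma norm_integral_le:
  fixes f :: "'b \<Rightarrow> 'c::{banach, second_countable_topology}"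
  assumes "integrable M g" "\<And>x. norm (f x) \<le> g x"
  shows "norm (\<integral>x. f x \<partial>M) \<le> (\<integral>x. g x \<partial>M)"
proof (cases "integrable M f")
  case True
  have "norm (\<integral>x. f x \<partial>M) \<le> (\<integral>x. norm (f x) \<partial>M)" by (rule integral_norm_bound)
  also have "\<dots> \<le> (\<integral>x. g x \<partial>M)" using True assms by (intro integral_mono) auto
  finally show ?thesis .
next
  case False
  have "0 \<le> (\<integral>x. g x \<partial>M)"
    using assms(2) norm_ge_zero order_trans by (intro integral_nonneg_AE AE_I2) blast
  with False show ?thesis by (simp add: not_integrable_integral_eq)
qed

lemma integrable_mult_power2:
  fixes f g :: "'b \<Rightarrow> real"
  assumes [measurable]: "f \<in> borel_measurable M" "g \<in> borel_measurable M"
    and "integrable M (\<lambda>x. (f x)\<^sup>2)" "integrable M (\<lambda>x. (g x)\<^sup>2)"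
  shows "integrable M (\<lambda>x. f x * g x)"
proof (rule Bochner_Integration.integrable_bound)
  show "integrable M (\<lambda>x. (f x)\<^sup>2 + (g x)\<^sup>2)" using assms by simp
  show "AE x in M. norm (f x * g x) \<le> norm ((f x)\<^sup>2 + (g x)\<^sup>2)"
  proof (intro AE_I2)
    fix x
    have "2 * (\<bar>f x\<bar> * \<bar>g x\<bar>) \<le> (f x)\<^sup>2 + (g x)\<^sup>2"
      using sum_squares_bound[of "\<bar>f x\<bar>" "\<bar>g x\<bar>"] by (simp add: mult.assoc)
    moreover have "0 \<le> \<bar>f x\<bar> * \<bar>g x\<bar>" by simp
    ultimately have "\<bar>f x\<bar> * \<bar>g x\<bar> \<le> (f x)\<^sup>2 + (g x)\<^sup>2" by linarith
    then show "norm (f x * g x) \<le> norm ((f x)\<^sup>2 + (g x)\<^sup>2)" by (simp add: abs_mult)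
  qed
qed simp

lemma pre_hilbert_L2:
  "pre_hilbert_on {f \<in> borel_measurable M. integrable M (\<lambda>x. (f x)\<^sup>2)}
     (\<lambda>a f b g x. a * f x + b * g x) (\<lambda>f g. \<integral>x. f x * g x \<partial>M :: real)"
proof (unfold_locales, goal_cases)
  case (1 f g a b)
  then have "integrable M (\<lambda>x. a\<^sup>2 * (f x)\<^sup>2 + b\<^sup>2 * (g x)\<^sup>2 + (2 * a * b) * (f x * g x))"
    by (intro Bochner_Integration.integrable_add integrable_mult_right integrable_mult_power2) auto
  moreover have "(a * f x + b * g x)\<^sup>2 = a\<^sup>2 * (f x)\<^sup>2 + b\<^sup>2 * (g x)\<^sup>2 + (2 * a * b) * (f x * g x)" for x
    by (simp add: power2_eq_square algebra_simps)
  ultimately show ?case using 1 by (auto intro!: borel_measurable_add borel_measurable_times)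
next
  case (3 f g h a b)
  then show ?case
    using integrable_mult_power2[of f M h] integrable_mult_power2[of g M h]
    by (simp add: distrib_right mult.assoc)
qed (auto simp: mult.commute)

lemma Cauchy_Schwarz_integral:
  fixes f g :: "'b \<Rightarrow> real"
  assumes "f \<in> borel_measurable M" "g \<in> borel_measurable M"
    and "integrable M (\<lambda>x. (f x)\<^sup>2)" "integrable M (\<lambda>x. (g x)\<^sup>2)"
  shows "(\<integral>x. f x * g x \<partial>M)\<^sup>2 \<le> (\<integral>x. (f x)\<^sup>2 \<partial>M) * (\<integral>x. (g x)\<^sup>2 \<partial>M)"
  using pre_hilbert_on.Cauchy_Schwarz[OF pre_hilbert_L2, of f M g] assms by (simp add: power2_eq_square)

section \<open>Second moments of a Gaussian measure and traces\<close>

locale gaussian_space =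
  fixes C :: "'a::{real_inner, banach, second_countable_topology} \<Rightarrow>\<^sub>L 'a" and N :: "'a measure"
  assumes C_L1: "C \<in> L1_plus" and N_gauss: "centred_gaussian C N"
begin

sublocale N: prob_space N
  using N_gauss by (simp add: centred_gaussian_def)

lemma sets_N [measurable_cong]: "sets N = sets borel"
  using N_gauss by (simp add: centred_gaussian_def)

lemma C_sym: "inner (blinfun_apply C x) y = inner x (blinfun_apply C y)"
  using C_L1 by (simp add: L1_plus_def sym_pos_op_def)

lemma C_pos: "0 \<le> inner (blinfun_apply C x) x"
  using C_L1 unfolding L1_plus_def sym_pos_op_def by blast

text \<open>The covariance clause of \<open>centred_gaussian\<close> is an equation between Bochner
  integrals and does not assert integrability. That comes from the one-dimensional law, a point mass
  for \<open>\<sigma> = 0\<close> and a normal density otherwise.\<close>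

lemma integrable_N_inner_sq: "integrable N (\<lambda>x. (inner s x)\<^sup>2)"
proof -
  have [measurable]: "(\<lambda>x. inner s x) \<in> borel_measurable N" by measurable
  obtain \<sigma> where \<sigma>: "\<sigma> \<ge> 0" and D: "distr N borel (\<lambda>x. inner s x) =
      (if \<sigma> = 0 then return borel 0 else density lborel (\<lambda>t. ennreal (normal_density 0 \<sigma> t)))"
    using N_gauss unfolding centred_gaussian_def by blast
  have "integrable (distr N borel (\<lambda>x. inner s x)) (\<lambda>t. t\<^sup>2)"
  proof (cases "\<sigma> = 0")
    case True
    interpret prob_space "return borel (0::real)" by (rule prob_space_return) simp
    have "integrable (return borel (0::real)) (\<lambda>t. t\<^sup>2)"
      by (rule integrable_const_bound[where B=0]) (auto simp: AE_return)
    then show ?thesis using True D by simp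
  next
    case False
    then show ?thesis
      using D \<sigma> integrable_normal_moment[of \<sigma> 0 2]
      by (simp add: integrable_density)
  qed
  then show ?thesis by (simp add: integrable_distr_eq)
qed

lemma integrable_N_inner: "integrable N (\<lambda>x. inner s x * inner t x)"
  by (intro integrable_mult_power2 integrable_N_inner_sq) measurable

lemma integral_N_inner: "(\<integral>x. inner s x * inner t x \<partial>N) = inner (blinfun_apply C s) t"
  using N_gauss by (simp add: centred_gaussian_def)

lemma integral_N_inner_sq: "(\<integral>x. (inner s x)\<^sup>2 \<partial>N) = inner (blinfun_apply C s) s"
  using integral_N_inner[of s s] by (simp add: power2_eq_square)

text \<open>Partial Parseval sums of \<open>(norm z)\<^sup>2\<close> increase, and their integrals
  are partial sums of the trace of \<open>C\<close>, which is finite since \<open>C\<close> is trace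
  class; monotone convergence gives both claims. In particular the trace does not depend on the
  basis.\<close>

lemma N_norm_sq:
  shows integrable_N_norm_sq: "integrable N (\<lambda>z. (norm z)\<^sup>2)"
    and has_sum_N_norm_sq: "onb B \<Longrightarrow> ((\<lambda>e. inner (blinfun_apply C e) e) has_sum (\<integral>z. (norm z)\<^sup>2 \<partial>N)) B"
proof -
  have *: "integrable N (\<lambda>z. (norm z)\<^sup>2) \<and> ((\<lambda>e. inner (blinfun_apply C e) e) has_sum (\<integral>z. (norm z)\<^sup>2 \<partial>N)) B"
    if B: "onb B" for B
  proof -
    obtain F where F: "\<And>n. finite (F n)" "\<And>n. F n \<subseteq> B" "incseq F"
      "filterlim F (finite_subsets_at_top B) sequentially"
      using countable_finite_exhaustion[OF countable_onb[OF B]] by metis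
    define \<tau> where "\<tau> = (\<Sum>\<^sub>\<infinity>e\<in>B. inner (blinfun_apply C e) e)"
    have \<tau>: "((\<lambda>e. inner (blinfun_apply C e) e) has_sum \<tau>) B"
      using C_L1 B unfolding \<tau>_def L1_plus_def by (intro has_sum_infsum) auto
    have eq: "(\<integral>z. (\<Sum>e\<in>F n. (inner e z)\<^sup>2) \<partial>N) = (\<Sum>e\<in>F n. inner (blinfun_apply C e) e)" for n
      by (simp add: integrable_N_inner_sq integral_N_inner_sq)
    have "has_bochner_integral N (\<lambda>z. (norm z)\<^sup>2) \<tau>"
    proof (rule has_bochner_integral_monotone_convergence[where f="\<lambda>n z. \<Sum>e\<in>F n. (inner e z)\<^sup>2"])
      show "integrable N (\<lambda>z. \<Sum>e\<in>F n. (inner e z)\<^sup>2)" for n by (simp add: integrable_N_inner_sq)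
      show "AE z in N. mono (\<lambda>n. \<Sum>e\<in>F n. (inner e z)\<^sup>2)"
        using F(1,3) by (intro AE_I2 monoI sum_mono2) (auto dest: monoD)
      show "AE z in N. (\<lambda>n. \<Sum>e\<in>F n. (inner e z)\<^sup>2) \<longlonglongrightarrow> (norm z)\<^sup>2"
        using has_sum_sequence[OF Parseval_norm[OF B] F(4)] by (simp add: inner_commute)
      show "(\<lambda>n. \<integral>z. (\<Sum>e\<in>F n. (inner e z)\<^sup>2) \<partial>N) \<longlonglongrightarrow> \<tau>"
        unfolding eq by (rule has_sum_sequence[OF \<tau> F(4)])
    qed measurable
    with \<tau> show ?thesis by (simp add: has_bochner_integral_iff)
  qed
  show "integrable N (\<lambda>z. (norm z)\<^sup>2)" using * onb_some_onb by blast
  show "onb B \<Longrightarrow> ((\<lambda>e. inner (blinfun_apply C e) e) has_sum (\<integral>z. (norm z)\<^sup>2 \<partial>N)) B" using * by blast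
qed

lemma integrable_N_quadratic:
  assumes "bounded_linear T"
  shows "integrable N (\<lambda>z. inner (T z) z)"
proof -
  obtain K where K: "\<And>x. norm (T x) \<le> norm x * K" using bounded_linear.bounded[OF assms] by blast
  have [measurable]: "T \<in> borel_measurable borel"
    using assms by (intro borel_measurable_continuous_onI linear_continuous_on)
  show ?thesis
  proof (rule Bochner_Integration.integrable_bound)
    show "integrable N (\<lambda>z. K * (norm z)\<^sup>2)" by (intro integrable_mult_right integrable_N_norm_sq)
    show "AE z in N. norm (inner (T z) z) \<le> norm (K * (norm z)\<^sup>2)"
    proof (intro AE_I2)
      fix z
      have "norm (inner (T z) z) \<le> norm (T z) * norm z" by (simp add: Cauchy_Schwarz_ineq2)
      also have "\<dots> \<le> norm z * K * norm z" using K by (intro mult_right_mono) auto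
      also have "\<dots> \<le> norm (K * (norm z)\<^sup>2)" by (simp add: power2_eq_square mult_ac)
      finally show "norm (inner (T z) z) \<le> norm (K * (norm z)\<^sup>2)" .
    qed
  qed measurable
qed

text \<open>Using \<open>C\<close> as the covariance of \<open>N\<close> replaces a factorisation of \<open>C\<close> through its square root.\<close>

lemma has_sum_trace:
  assumes B: "onb B" and T: "bounded_linear T"
  shows "((\<lambda>e. inner (blinfun_apply C (T e)) e) has_sum (\<integral>z. inner (T z) z \<partial>N)) B"
proof -
  interpret T: bounded_linear T by fact
  obtain K where K: "K > 0" "\<And>x. norm (T x) \<le> norm x * K" using T.pos_bounded by blast
  have [measurable]: "T \<in> borel_measurable borel"
    using T by (intro borel_measurable_continuous_onI linear_continuous_on)
  define \<tau> where "\<tau> = (\<integral>z. (norm z)\<^sup>2 \<partial>N)"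
  \<comment> \<open>\<open>R F\<close> is the tail of the trace of \<open>C\<close>; below it turns
    out to be the mean of \<open>(norm (p z))\<^sup>2\<close>, with \<open>p\<close> the projection
    off the span of \<open>F\<close>.\<close>
  define R where "R F = \<tau> - (\<Sum>e\<in>F. inner (blinfun_apply C e) e)" for F
  have "(R \<longlongrightarrow> 0) (finite_subsets_at_top B)"
    using tendsto_diff[OF tendsto_const has_sum_N_norm_sq[OF B, unfolded has_sum_def], of \<tau>] unfolding R_def \<tau>_def by simp
  then have lim: "((\<lambda>F. K * (sqrt (R F) * sqrt \<tau>)) \<longlongrightarrow> 0) (finite_subsets_at_top B)"
    using tendsto_mult[OF tendsto_const[of K] tendsto_mult[OF tendsto_real_sqrt tendsto_const[of "sqrt \<tau>"]]] by fastforce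
  have "((\<lambda>F. (\<Sum>e\<in>F. inner (blinfun_apply C (T e)) e) - (\<integral>z. inner (T z) z \<partial>N)) \<longlongrightarrow> 0) (finite_subsets_at_top B)"
  proof (rule Lim_null_comparison[OF _ lim])
    show "\<forall>\<^sub>F F in finite_subsets_at_top B. norm ((\<Sum>e\<in>F. inner (blinfun_apply C (T e)) e) - (\<integral>z. inner (T z) z \<partial>N))
        \<le> K * (sqrt (R F) * sqrt \<tau>)"
    proof (rule eventually_finite_subsets_at_top_weakI)
      fix F assume F: "finite F" "F \<subseteq> B"
      define p where "p z = z - (\<Sum>e\<in>F. inner e z *\<^sub>R e)" for z
      have [measurable]: "p \<in> borel_measurable borel" unfolding p_def by measurable
      have psq: "(norm (p z))\<^sup>2 = (norm z)\<^sup>2 - (\<Sum>e\<in>F. (inner e z)\<^sup>2)" for z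
        using norm_diff_onb_sum[OF B F, of z "\<lambda>e. inner e z"] by (simp add: p_def inner_commute[of z])
      have p_int: "integrable N (\<lambda>z. (norm (p z))\<^sup>2)"
        unfolding psq by (simp add: integrable_N_norm_sq integrable_N_inner_sq)
      have p_eq: "(\<integral>z. (norm (p z))\<^sup>2 \<partial>N) = R F"
        unfolding psq by (simp add: integrable_N_norm_sq integrable_N_inner_sq integral_N_inner_sq R_def \<tau>_def)
      have summand: "inner (blinfun_apply C (T e)) e = (\<integral>z. inner e z * inner (T e) z \<partial>N)" for e
        unfolding integral_N_inner by (metis C_sym inner_commute)
      \<comment> \<open>A partial sum of the trace is the full quadratic integral with
        \<open>T z\<close> replaced by \<open>T (z - p z)\<close>, so the error involves only
        \<open>T (p z)\<close>.\<close>
      have "(\<Sum>e\<in>F. inner (blinfun_apply C (T e)) e) = (\<integral>z. (\<Sum>e\<in>F. inner e z * inner (T e) z) \<partial>N)"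
        unfolding summand by (subst Bochner_Integration.integral_sum) (auto intro: integrable_N_inner)
      also have "\<dots> = (\<integral>z. inner (T (z - p z)) z \<partial>N)"
        by (simp add: p_def T.sum T.scaleR inner_sum_left)
      finally have sum_eq: "(\<Sum>e\<in>F. inner (blinfun_apply C (T e)) e) = (\<integral>z. inner (T (z - p z)) z \<partial>N)" .
      have pz_int: "integrable N (\<lambda>z. norm (p z) * norm z)"
        by (intro integrable_mult_power2 p_int integrable_N_norm_sq) measurable
      have bound: "norm (inner (T (p z)) z) \<le> K * (norm (p z) * norm z)" for z
      proof -
        have "norm (inner (T (p z)) z) \<le> norm (T (p z)) * norm z" by (simp add: Cauchy_Schwarz_ineq2)
        also have "\<dots> \<le> norm (p z) * K * norm z" using K by (intro mult_right_mono) auto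
        finally show ?thesis by (simp add: mult_ac)
      qed
      have Tp_int: "integrable N (\<lambda>z. inner (T (p z)) z)"
        by (rule Bochner_Integration.integrable_bound[OF integrable_mult_right[OF pz_int, of K]])
           (use bound K in \<open>auto intro!: AE_I2 simp: abs_mult\<close>)
      have "(\<integral>z. inner (T (z - p z)) z \<partial>N) = (\<integral>z. inner (T z) z \<partial>N) - (\<integral>z. inner (T (p z)) z \<partial>N)"
        unfolding T.diff inner_diff_left
        by (intro Bochner_Integration.integral_diff integrable_N_quadratic[OF T] Tp_int)
      then have "norm ((\<Sum>e\<in>F. inner (blinfun_apply C (T e)) e) - (\<integral>z. inner (T z) z \<partial>N)) = norm (\<integral>z. inner (T (p z)) z \<partial>N)"
        using sum_eq by simp
      also have "\<dots> \<le> (\<integral>z. K * (norm (p z) * norm z) \<partial>N)"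
        using bound by (intro norm_integral_le integrable_mult_right pz_int)
      also have "\<dots> = K * (\<integral>z. norm (p z) * norm z \<partial>N)" by simp
      also have "\<dots> \<le> K * (sqrt (R F) * sqrt \<tau>)"
      proof (rule mult_left_mono)
        have "(\<integral>z. norm (p z) * norm z \<partial>N)\<^sup>2 \<le> R F * \<tau>"
          unfolding p_eq[symmetric] \<tau>_def
          by (rule Cauchy_Schwarz_integral) (use p_int integrable_N_norm_sq in auto)
        then show "(\<integral>z. norm (p z) * norm z \<partial>N) \<le> sqrt (R F) * sqrt \<tau>"
          by (metis real_le_rsqrt real_sqrt_mult)
      qed (use K in simp)
      finally show "norm ((\<Sum>e\<in>F. inner (blinfun_apply C (T e)) e) - (\<integral>z. inner (T z) z \<partial>N)) \<le> K * (sqrt (R F) * sqrt \<tau>)" .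
    qed
  qed
  then show ?thesis unfolding has_sum_def by (simp add: LIM_zero_cancel)
qed

lemma op_trace_C: "bounded_linear T \<Longrightarrow> op_trace (\<lambda>h. blinfun_apply C (T h)) = (\<integral>z. inner (T z) z \<partial>N)"
  unfolding op_trace_def by (intro infsumI has_sum_trace onb_some_onb)

end

section \<open>Derivatives and gradients\<close>

text \<open>Restricts a Frechet derivative to the steps \<open>1 / (n + 1)\<close>, so that bounds
  on increments, measurability of limits and sequential limit theorems for integrals can be used on
  derivatives.\<close>

lemma has_derivative_difference_quotient:
  assumes "(f has_derivative f') (at x)"
  shows "(\<lambda>n. real (Suc n) *\<^sub>R (f (x + inverse (real (Suc n)) *\<^sub>R u) - f x)) \<longlonglongrightarrow> f' u"
proof -
  interpret bounded_linear f' using assms by (rule has_derivative_bounded_linear)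
  show ?thesis
  proof (cases "u = 0")
    case False
    define h where "h n = inverse (real (Suc n)) *\<^sub>R u" for n
    have h: "norm (h n) = norm u / real (Suc n)" "h n \<noteq> 0" "real (Suc n) *\<^sub>R h n = u" for n
      using False by (simp_all add: h_def divide_inverse mult.commute)
    have "h \<longlonglongrightarrow> 0"
      unfolding h_def using tendsto_scaleR[OF LIMSEQ_inverse_real_of_nat tendsto_const[of u]] by simp
    then have "filterlim h (at 0) sequentially" using h by (simp add: filterlim_at)
    from filterlim_compose[OF assms[unfolded has_derivative_at, THEN conjunct2] this]
    have "(\<lambda>n. norm (f (x + h n) - f x - f' (h n)) / norm (h n) * norm u) \<longlonglongrightarrow> 0"
      by (rule tendsto_mult_left_zero)
    moreover have "norm (f (x + h n) - f x - f' (h n)) / norm (h n) * norm u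
        = norm (real (Suc n) *\<^sub>R (f (x + h n) - f x) - f' u)" for n
    proof -
      have "real (Suc n) *\<^sub>R (f (x + h n) - f x) - f' u = real (Suc n) *\<^sub>R (f (x + h n) - f x - f' (h n))"
        using h(3)[of n] by (metis scaleR scaleR_right_diff_distrib)
      then show ?thesis using False by (simp add: h(1))
    qed
    ultimately show ?thesis
      unfolding h_def[symmetric] by (simp add: tendsto_norm_zero_iff LIM_zero_cancel)
  qed (simp add: zero)
qed

text \<open>The constant \<open>c m n\<close> will come from a distance in an RKHS norm and is the
  same for all \<open>x\<close>; this uniformity is what allows the derivatives to pass to the
  limit.\<close>

lemma has_derivative_uniform_Cauchy:
  fixes f :: "nat \<Rightarrow> 'a::real_normed_vector \<Rightarrow> 'b::banach"
  assumes der: "\<And>n x. (f n has_derivative f' n x) (at x)"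
    and close: "\<And>m n x h. norm (f' m x h - f' n x h) \<le> c m n * norm h"
    and Cauchy: "\<And>e. e > 0 \<Longrightarrow> \<exists>N. \<forall>m\<ge>N. \<forall>n\<ge>N. c m n \<le> (e::real)"
    and lim: "\<And>x. (\<lambda>n. f n x) \<longlonglongrightarrow> g x"
  shows "g differentiable (at x)"
proof -
  have "\<exists>l. (\<lambda>n. f' n x h) \<longlonglongrightarrow> l" for x h
  proof -
    have "Cauchy (\<lambda>n. f' n x h)"
    proof (rule CauchyI)
      fix e :: real assume e: "e > 0"
      then obtain N where N: "\<And>m n. m \<ge> N \<Longrightarrow> n \<ge> N \<Longrightarrow> c m n \<le> e / (norm h + 1)"
        using Cauchy[of "e / (norm h + 1)"] by (auto simp: add_nonneg_pos)
      have "norm (f' m x h - f' n x h) < e" if "m \<ge> N" "n \<ge> N" for m n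
      proof -
        have "norm (f' m x h - f' n x h) \<le> e / (norm h + 1) * norm h"
          using close[of m x h n] N[OF that] by (meson mult_right_mono norm_ge_zero order_trans)
        also have "\<dots> = e * (norm h / (norm h + 1))" by simp
        also have "\<dots> < e * 1"
          using e by (intro mult_strict_left_mono) (simp_all add: divide_less_eq_1 add_nonneg_pos)
        also have "\<dots> = e" by simp
        finally show ?thesis .
      qed
      then show "\<exists>M. \<forall>m\<ge>M. \<forall>n\<ge>M. norm (f' m x h - f' n x h) < e" by blast
    qed
    then show ?thesis using Cauchy_convergent convergentD by blast
  qed
  then obtain g' where g': "\<And>x h. (\<lambda>n. f' n x h) \<longlonglongrightarrow> g' x h" by metis
  have "\<exists>G. \<forall>x\<in>UNIV. (\<lambda>n. f n x) \<longlonglongrightarrow> G x \<and> (G has_derivative g' x) (at x within UNIV)"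
  proof (rule has_derivative_sequence[where f'=f' and ?x0.0=x])
    fix e :: real assume "e > 0"
    then obtain N where N: "\<And>m n. m \<ge> N \<Longrightarrow> n \<ge> N \<Longrightarrow> c m n \<le> e" using Cauchy by blast
    have "norm (f' n x h - g' x h) \<le> e * norm h" if n: "n \<ge> N" for n x h
    proof (rule tendsto_upperbound)
      show "(\<lambda>m. norm (f' n x h - f' m x h)) \<longlonglongrightarrow> norm (f' n x h - g' x h)"
        by (intro tendsto_intros g')
      show "\<forall>\<^sub>F m in sequentially. norm (f' n x h - f' m x h) \<le> e * norm h"
        using eventually_ge_at_top[of N]
      proof eventually_elim
        case (elim m)
        then show ?case
          using close[of n x h m] N[OF n elim] by (meson mult_right_mono norm_ge_zero order_trans)
      qed
    qed simp
    then show "\<forall>\<^sub>F n in sequentially. \<forall>x\<in>UNIV. \<forall>h. norm (f' n x h - g' x h) \<le> e * norm h"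
      unfolding eventually_sequentially by blast
  qed (use der lim in auto)
  then obtain G where G: "\<And>x. (\<lambda>n. f n x) \<longlonglongrightarrow> G x" "\<And>x. (G has_derivative g' x) (at x)" by auto
  have "G = g" using G(1) lim LIMSEQ_unique by blast
  then show ?thesis using G(2) differentiable_def by blast
qed

lemma grad_eqI: "GDERIV f x :> g \<Longrightarrow> grad f x = g"
  unfolding grad_def
proof (rule the_equality)
  fix g' assume a: "GDERIV f x :> g" "GDERIV f x :> g'"
  then have "(\<lambda>h. inner h g') = (\<lambda>h. inner h g)"
    unfolding gderiv_def by (metis has_derivative_unique)
  then have "inner (g' - g) g' = inner (g' - g) g" by metis
  then have "inner (g' - g) (g' - g) = 0" by (simp add: inner_diff_right)
  then show "g' = g" by simp
qed

lemma has_derivative_grad: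
  fixes f :: "'a::{real_inner, banach} \<Rightarrow> real"
  assumes "f differentiable (at x)"
  shows "(f has_derivative (\<lambda>h. inner h (grad f x))) (at x)"
proof -
  obtain f' where f': "(f has_derivative f') (at x)" using assms differentiable_def by blast
  obtain g where "\<And>h. f' h = inner g h" using Riesz_representation[OF has_derivative_bounded_linear[OF f']] by blast
  then have "GDERIV f x :> g" using f' unfolding gderiv_def by (metis (no_types, lifting) ext inner_commute)
  then show ?thesis using grad_eqI gderiv_def by metis
qed

lemma grad_linear:
  fixes f :: "'a::{real_inner, banach} \<Rightarrow> real"
  assumes "f differentiable (at x)" "g differentiable (at x)"
  shows "grad (\<lambda>y. a * f y + b * g y) x = a *\<^sub>R grad f x + b *\<^sub>R grad g x"
  using has_derivative_grad[OF assms(1)] has_derivative_grad[OF assms(2)]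
  by (intro grad_eqI) (auto simp: gderiv_def inner_add_right intro!: derivative_eq_intros)

text \<open>The gradient of a kernel section is \<open>riesz\<close> of \<open>D1 k\<close>. Being
  bounded and linear, \<open>riesz\<close> carries differentiability of \<open>D1 k\<close> over to
  that gradient.\<close>

definition riesz :: "('a::{real_inner, banach} \<Rightarrow>\<^sub>L real) \<Rightarrow> 'a" where
  "riesz \<phi> = (SOME g. \<forall>x. blinfun_apply \<phi> x = inner g x)"

lemma inner_riesz: "inner (riesz \<phi>) x = blinfun_apply \<phi> x"
proof -
  have "\<exists>g. \<forall>x. blinfun_apply \<phi> x = inner g x"
    by (rule Riesz_representation[OF blinfun.bounded_linear_right[of \<phi>]]) blast
  from someI_ex[OF this] have "blinfun_apply \<phi> x = inner (riesz \<phi>) x" unfolding riesz_def by blast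
  then show ?thesis by (rule sym)
qed

lemma bounded_linear_riesz: "bounded_linear (riesz :: ('a::{real_inner, banach} \<Rightarrow>\<^sub>L real) \<Rightarrow> 'a)"
proof (rule bounded_linear_intro[where K=1])
  have eqI: "g = g'" if "\<And>x. inner g x = inner g' x" for g g' :: 'a
    using that by (metis inner_eq_zero_iff inner_diff_left eq_iff_diff_eq_0)
  show "riesz (\<phi> + \<psi>) = riesz \<phi> + riesz \<psi>" for \<phi> \<psi> :: "'a \<Rightarrow>\<^sub>L real"
    by (rule eqI) (simp add: inner_add_left inner_riesz blinfun.add_left)
  show "riesz (r *\<^sub>R \<phi>) = r *\<^sub>R riesz \<phi>" for r and \<phi> :: "'a \<Rightarrow>\<^sub>L real"
    by (rule eqI) (simp add: inner_riesz blinfun.scaleR_left)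
  show "norm (riesz \<phi>) \<le> norm \<phi> * 1" for \<phi> :: "'a \<Rightarrow>\<^sub>L real"
  proof -
    have "norm (riesz \<phi>) * norm (riesz \<phi>) \<le> norm \<phi> * norm (riesz \<phi>)"
      using norm_blinfun[of \<phi> "riesz \<phi>"] inner_riesz[of \<phi> "riesz \<phi>"]
      by (simp add: dot_square_norm power2_eq_square)
    then show ?thesis by (cases "riesz \<phi> = 0") auto
  qed
qed

lemma norm_le_inner_bound:
  fixes z :: "'a::real_inner"
  assumes "\<And>u. inner u z \<le> c * norm u" "0 \<le> c"
  shows "norm z \<le> c"
proof (cases "z = 0")
  case False
  have "norm z * norm z \<le> c * norm z" using assms(1)[of z] by (simp add: dot_square_norm power2_eq_square)
  then show ?thesis using False by simp
qed (use assms in simp)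

text \<open>The mean value inequality twice: first for \<open>f'\<close>, which bounds
  \<open>f' (y + v) - f' y\<close>, then for the map \<open>y \<mapsto> f (y + v) - f y\<close>, of
  which that is the derivative.\<close>

lemma second_difference_bound:
  fixes f :: "'a::real_normed_vector \<Rightarrow> 'b::real_normed_vector"
  assumes f': "\<And>x. (f has_derivative blinfun_apply (f' x)) (at x)"
    and f'': "\<And>x. (f' has_derivative blinfun_apply (f'' x)) (at x)"
    and M: "\<And>x. norm (f'' x) \<le> M"
  shows "norm (f (x + u + v) - f (x + u) - f (x + v) + f x) \<le> M * norm u * norm v"
proof -
  have 1: "norm (f' (y + v) - f' y) \<le> M * norm v" for y
    using differentiable_bound[of UNIV f' "\<lambda>x. blinfun_apply (f'' x)" M "y + v" y] f'' M
    by (simp add: norm_blinfun.rep_eq)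
  have "norm ((f ((x + u) + v) - f (x + u)) - (f (x + v) - f x)) \<le> (M * norm v) * norm ((x + u) - x)"
  proof (rule differentiable_bound[of UNIV "\<lambda>y. f (y + v) - f y" "\<lambda>y. blinfun_apply (f' (y + v) - f' y)"])
    fix y
    have "((\<lambda>y. f (y + v)) has_derivative blinfun_apply (f' (y + v))) (at y)"
      using has_derivative_compose[of "\<lambda>y. y + v" "\<lambda>h. h" y UNIV f "blinfun_apply (f' (y + v))"] f'
      by (simp add: has_derivative_add_const)
    then show "((\<lambda>y. f (y + v) - f y) has_derivative blinfun_apply (f' (y + v) - f' y)) (at y within UNIV)"
      using f'[of y] by (auto simp: blinfun.diff_left intro!: derivative_eq_intros)
    show "onorm (blinfun_apply (f' (y + v) - f' y)) \<le> M * norm v"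
      using 1 by (simp add: norm_blinfun.rep_eq)
  qed auto
  then show ?thesis by (simp add: algebra_simps)
qed

section \<open>Smoothness of functions in a reproducing kernel Hilbert space\<close>

lemma has_derivative_D1:
  "differentiable1 F \<Longrightarrow> ((\<lambda>u. F u y) has_derivative blinfun_apply (D1 F x y)) (at x)"
  unfolding differentiable1_def D1_def
  by (metis bounded_linear_Blinfun_apply frechet_derivative_works has_derivative_bounded_linear)

lemma has_derivative_D2:
  "differentiable2 F \<Longrightarrow> ((\<lambda>v. F x v) has_derivative blinfun_apply (D2 F x y)) (at y)"
  unfolding differentiable2_def D2_def
  by (metis bounded_linear_Blinfun_apply frechet_derivative_works has_derivative_bounded_linear)

lemma cont_bddE:
  assumes "cont_bdd F"
  obtains M where "0 \<le> M" "\<And>x y. norm (F x y) \<le> M"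
proof -
  obtain M where "\<And>z. z \<in> range (\<lambda>(x, y). F x y) \<Longrightarrow> norm z \<le> M"
    using assms unfolding cont_bdd_def bounded_iff by blast
  then have "norm (F x y) \<le> M" for x y by (metis case_prod_conv rangeI)
  moreover have "0 \<le> M" using calculation norm_ge_zero order_trans by blast
  ultimately show ?thesis using that by blast
qed

text \<open>Mean value inequality in the first argument for \<open>D2 k\<close>, then in the second
  for \<open>k a - k b\<close>; \<open>M\<close> bounds the mixed derivative
  \<open>D1 (D2 k)\<close>. For \<open>y = a\<close> and \<open>y' = b\<close> the left side is the
  squared norm of a difference of two sections.\<close>

lemma Cb_1_1_increment:
  fixes k :: "'a::real_normed_vector \<Rightarrow> 'a \<Rightarrow> real"
  assumes "k \<in> Cb_1_1"
  obtains M where "0 \<le> M" "\<And>a b y y'. \<bar>k a y - k b y - k a y' + k b y'\<bar> \<le> M * norm (a - b) * norm (y - y')"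
proof -
  have k: "differentiable2 k" "differentiable1 (D2 k)" "cont_bdd (D1 (D2 k))"
    using assms by (auto simp: Cb_1_1_def Cb1_fst_def)
  obtain M where M: "0 \<le> M" "\<And>x y. norm (D1 (D2 k) x y) \<le> M" using cont_bddE[OF k(3)] by blast
  have 1: "norm (D2 k a y - D2 k b y) \<le> M * norm (a - b)" for a b y
    using differentiable_bound[of UNIV "\<lambda>x. D2 k x y" "\<lambda>x. blinfun_apply (D1 (D2 k) x y)" M a b]
      has_derivative_D1[OF k(2)] M by (simp add: norm_blinfun.rep_eq)
  have "norm ((k a y - k b y) - (k a y' - k b y')) \<le> M * norm (a - b) * norm (y - y')" for a b y y'
  proof (rule differentiable_bound[of UNIV _ "\<lambda>y. blinfun_apply (D2 k a y - D2 k b y)"])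
    show "((\<lambda>y. k a y - k b y) has_derivative blinfun_apply (D2 k a z - D2 k b z)) (at z within UNIV)" for z
      using has_derivative_D2[OF k(1)] by (auto simp: blinfun.diff_left intro!: derivative_eq_intros)
    show "onorm (blinfun_apply (D2 k a z - D2 k b z)) \<le> M * norm (a - b)" for z
      using 1 by (simp add: norm_blinfun.rep_eq)
  qed auto
  then have "\<bar>k a y - k b y - k a y' + k b y'\<bar> \<le> M * norm (a - b) * norm (y - y')" for a b y y'
    by (simp add: algebra_simps)
  with M that show ?thesis by blast
qed

text \<open>Discrete counterpart of the second derivative of \<open>f\<close> at \<open>x\<close> in
  directions \<open>u\<close> and \<open>v\<close>; it is meaningful before any differentiability is
  known.\<close>

definition second_difference :: "('a::plus \<Rightarrow> 'b::ab_group_add) \<Rightarrow> 'a \<Rightarrow> 'a \<Rightarrow> 'a \<Rightarrow> 'b" where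
  "second_difference f x u v = f (x + u + v) - f (x + u) - f (x + v) + f x"

text \<open>\<open>second_difference_bound\<close> in the first argument for
  \<open>D2 (D2 k)\<close>, then in the second argument for the alternating combination of four
  functions of \<open>y\<close>, whose second derivative the first step has just bounded.\<close>

lemma Cb_2_2_increment:
  fixes k :: "'a::real_normed_vector \<Rightarrow> 'a \<Rightarrow> real"
  assumes "k \<in> Cb_2_2"
  obtains M where "0 \<le> M"
    "\<And>x y u v. \<bar>second_difference (\<lambda>z. second_difference (\<lambda>w. k w z) x u v) y u v\<bar> \<le> M * (norm u * norm v)\<^sup>2"
proof -
  let ?K = "D2 (D2 k)"
  have k: "differentiable2 k" "differentiable2 (D2 k)" "differentiable1 ?K" "differentiable1 (D1 ?K)"
    "cont_bdd (D1 (D1 ?K))"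
    using assms by (auto simp: Cb_2_2_def Cb2_fst_def)
  obtain M where M: "0 \<le> M" "\<And>x y. norm (D1 (D1 ?K) x y) \<le> M" using cont_bddE[OF k(5)] by blast
  have 1: "norm (?K (x + u + v) z - ?K (x + u) z - ?K (x + v) z + ?K x z) \<le> M * norm u * norm v" for x u v z
    by (rule second_difference_bound[where f="\<lambda>x. ?K x z", OF has_derivative_D1[OF k(3)] has_derivative_D1[OF k(4)] M(2)])
  have "norm ((\<lambda>y. k (x + u + v) y - k (x + u) y - k (x + v) y + k x y) (y + u + v)
    - (\<lambda>y. k (x + u + v) y - k (x + u) y - k (x + v) y + k x y) (y + u)
    - (\<lambda>y. k (x + u + v) y - k (x + u) y - k (x + v) y + k x y) (y + v)
    + (\<lambda>y. k (x + u + v) y - k (x + u) y - k (x + v) y + k x y) y) \<le> (M * norm u * norm v) * norm u * norm v" for x y u v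
  proof (rule second_difference_bound)
    show "((\<lambda>y. k (x + u + v) y - k (x + u) y - k (x + v) y + k x y) has_derivative
        blinfun_apply (D2 k (x + u + v) z - D2 k (x + u) z - D2 k (x + v) z + D2 k x z)) (at z)" for z
      by (auto simp: blinfun.diff_left blinfun.add_left intro!: derivative_eq_intros has_derivative_D2[OF k(1)])
    show "((\<lambda>z. D2 k (x + u + v) z - D2 k (x + u) z - D2 k (x + v) z + D2 k x z) has_derivative
        blinfun_apply (?K (x + u + v) z - ?K (x + u) z - ?K (x + v) z + ?K x z)) (at z)" for z
      by (auto simp: blinfun.diff_left blinfun.add_left intro!: derivative_eq_intros has_derivative_D2[OF k(2)])
    show "norm (?K (x + u + v) z - ?K (x + u) z - ?K (x + v) z + ?K x z) \<le> M * norm u * norm v" for z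
      by (rule 1)
  qed
  then show ?thesis using M(1) by (intro that[of M]) (simp_all add: second_difference_def power2_eq_square mult_ac)
qed

lemma Cb_2_2_subset: "Cb_2_2 \<subseteq> Cb_1_1"
  by (auto simp: Cb_2_2_def Cb_1_1_def Cb2_fst_def Cb1_fst_def)

lemma norm_scaled_step: "real (Suc n) * (c * norm (inverse (real (Suc n)) *\<^sub>R u)) = c * norm u"
proof -
  have "real (Suc n) * (c * norm (inverse (real (Suc n)) *\<^sub>R u)) = (real (Suc n) * inverse (real (Suc n))) * (c * norm u)"
    by (simp only: norm_scaleR abs_inverse abs_of_nat mult_ac)
  then show ?thesis by simp
qed

lemma tendsto_abs_le:
  fixes a :: real
  assumes "X \<longlonglongrightarrow> a" "\<And>n. \<bar>X n\<bar> \<le> b"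
  shows "\<bar>a\<bar> \<le> b"
  using tendsto_upperbound[OF tendsto_rabs[OF assms(1)]] assms(2) by simp

section \<open>Consequences of the reproducing property\<close>

locale rkhs_space =
  fixes k :: "'a::{real_inner, banach} \<Rightarrow> 'a \<Rightarrow> real" and H :: "('a \<Rightarrow> real) set"
    and ip :: "('a \<Rightarrow> real) \<Rightarrow> ('a \<Rightarrow> real) \<Rightarrow> real"
  assumes rkhs: "rkhs k H ip"
begin

abbreviation nrm :: "('a \<Rightarrow> real) \<Rightarrow> real" where "nrm \<equiv> rkhs_norm ip"

sublocale hilbert_on H "\<lambda>a f b g x. a * f x + b * g x" ip
proof (unfold_locales, goal_cases)
  case (5 w)
  have sq: "(rkhs_norm ip f)\<^sup>2 = ip f f" if "f \<in> H" for f
    using rkhs that unfolding rkhs_def rkhs_norm_def by simp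
  have d: "(\<lambda>x. f x - g x) \<in> H" if "f \<in> H" "g \<in> H" for f g
  proof -
    have "(\<lambda>x. 1 * f x + (-1) * g x) \<in> H" using rkhs that unfolding rkhs_def by blast
    then show ?thesis by simp
  qed
  have "\<forall>\<epsilon>>0. \<exists>M. \<forall>m\<ge>M. \<forall>n\<ge>M. rkhs_norm ip (\<lambda>x. w m x - w n x) < \<epsilon>"
  proof (intro allI impI)
    fix \<epsilon> :: real assume \<epsilon>: "\<epsilon> > 0"
    then obtain M where M: "\<forall>m\<ge>M. \<forall>n\<ge>M. ip (\<lambda>x. w m x - w n x) (\<lambda>x. w m x - w n x) < \<epsilon>\<^sup>2"
      using 5(2)[of "\<epsilon>\<^sup>2"] by auto
    then show "\<exists>M. \<forall>m\<ge>M. \<forall>n\<ge>M. rkhs_norm ip (\<lambda>x. w m x - w n x) < \<epsilon>"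
      using \<epsilon> unfolding rkhs_norm_def by (intro exI[of _ M]) (simp add: real_less_lsqrt real_sqrt_less_iff[of _ "\<epsilon>\<^sup>2"])
  qed
  then obtain g where g: "g \<in> H" "(\<lambda>n. rkhs_norm ip (\<lambda>x. w n x - g x)) \<longlonglongrightarrow> 0"
    using rkhs 5(1) unfolding rkhs_def by blast
  have "(\<lambda>n. (rkhs_norm ip (\<lambda>x. w n x - g x))\<^sup>2) \<longlonglongrightarrow> 0"
    using g(2) by (simp add: tendsto_power2_zero_iff)
  then show ?case using g(1) 5(1) by (intro bexI[of _ g]) (simp_all add: sq d)
qed (use rkhs in \<open>unfold rkhs_def, blast+\<close>)

lemma section_in: "(\<lambda>y. k y x) \<in> H"
  using rkhs unfolding rkhs_def by blast

lemma reproducing: "f \<in> H \<Longrightarrow> ip f (\<lambda>y. k y x) = f x"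
  using rkhs unfolding rkhs_def by metis

lemma zero_in: "(\<lambda>x. 0) \<in> H"
  using rkhs unfolding rkhs_def by blast

lemma diff_in: "f \<in> H \<Longrightarrow> g \<in> H \<Longrightarrow> (\<lambda>x. f x - g x) \<in> H"
  using comb_in[of f g 1 "-1"] by simp

lemma nrm_power2: "f \<in> H \<Longrightarrow> (nrm f)\<^sup>2 = ip f f"
  by (simp add: rkhs_norm_def ip_nonneg)

lemma nrm_nonneg: "f \<in> H \<Longrightarrow> 0 \<le> nrm f"
  by (simp add: rkhs_norm_def ip_nonneg)

lemma ip_le_nrm: "f \<in> H \<Longrightarrow> g \<in> H \<Longrightarrow> \<bar>ip f g\<bar> \<le> nrm f * nrm g"
  unfolding rkhs_norm_def by (rule Cauchy_Schwarz_sqrt)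

lemma abs_le_nrm: "f \<in> H \<Longrightarrow> \<bar>f x\<bar> \<le> nrm f * sqrt (k x x)"
  using ip_le_nrm[OF _ section_in] by (simp add: reproducing rkhs_norm_def section_in)

lemma nrm_scale: "f \<in> H \<Longrightarrow> nrm (\<lambda>x. c * f x) = \<bar>c\<bar> * nrm f"
  using ip_comb_self[of f f c 0] by (simp add: rkhs_norm_def real_sqrt_mult)

lemma nrm_diff_triangle:
  assumes "f \<in> H" "g \<in> H" "h \<in> H"
  shows "nrm (\<lambda>x. f x - g x) \<le> nrm (\<lambda>x. f x - h x) + nrm (\<lambda>x. g x - h x)"
proof (rule power2_le_imp_le)
  let ?a = "\<lambda>x. f x - h x" and ?b = "\<lambda>x. g x - h x"
  have ab: "?a \<in> H" "?b \<in> H" using assms by (auto intro: diff_in)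
  have "ip (\<lambda>x. f x - g x) (\<lambda>x. f x - g x) = ip ?a ?a - 2 * ip ?a ?b + ip ?b ?b"
    using ip_comb_self[OF ab, of 1 "-1"] by simp
  also have "\<dots> \<le> (nrm ?a + nrm ?b)\<^sup>2"
    using ip_le_nrm[OF ab] by (simp add: power2_sum nrm_power2 ab abs_le_iff)
  finally show "(nrm (\<lambda>x. f x - g x))\<^sup>2 \<le> (nrm ?a + nrm ?b)\<^sup>2"
    by (simp add: nrm_power2 diff_in assms)
  show "0 \<le> nrm ?a + nrm ?b" using ab nrm_nonneg by simp
qed

text \<open>The increment is \<open>ip f d\<close> for the difference \<open>d\<close> of two
  sections; applying the same formula to \<open>d\<close> itself shows that \<open>ip d d\<close> is
  the mixed increment of \<open>k\<close> under the root.\<close>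

lemma increment_le:
  assumes "f \<in> H"
  shows "\<bar>f a - f b\<bar> \<le> nrm f * sqrt (k a a - k b a - k a b + k b b)"
proof -
  let ?d = "\<lambda>y. 1 * k y a + (-1) * k y b"
  have d: "?d \<in> H" by (intro comb_in section_in)
  have ipd: "ip g ?d = g a - g b" if "g \<in> H" for g
    using ip_comb_right[OF section_in section_in that, of 1 a "-1" b] by (simp add: reproducing that)
  have dd: "ip ?d ?d = k a a - k b a - k a b + k b b" using ipd[OF d] by (simp add: algebra_simps)
  show ?thesis
    using ip_le_nrm[OF assms d] unfolding rkhs_norm_def ipd[OF assms] dd .
qed

text \<open>As for first increments, with the alternating combination of four sections as
  \<open>d\<close>.\<close>

lemma second_difference_le:
  assumes "f \<in> H"
  shows "\<bar>second_difference f x u v\<bar>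
    \<le> nrm f * sqrt (second_difference (\<lambda>z. second_difference (\<lambda>w. k w z) x u v) x u v)"
proof -
  let ?d1 = "\<lambda>y. 1 * k y (x + u + v) + (-1) * k y (x + u)" and ?d2 = "\<lambda>y. 1 * k y (x + v) + (-1) * k y x"
  let ?d = "\<lambda>y. 1 * ?d1 y + (-1) * ?d2 y"
  have d12: "?d1 \<in> H" "?d2 \<in> H" by (intro comb_in section_in)+
  have d: "?d \<in> H" by (intro comb_in section_in)
  have ipd: "ip g ?d = second_difference g x u v" if "g \<in> H" for g
    using ip_comb_right[OF d12 that, of 1 "-1"]
      ip_comb_right[OF section_in section_in that, of 1 "x + u + v" "-1" "x + u"]
      ip_comb_right[OF section_in section_in that, of 1 "x + v" "-1" x]
    by (simp add: reproducing that second_difference_def)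
  have dd: "ip ?d ?d = second_difference (\<lambda>z. second_difference (\<lambda>w. k w z) x u v) x u v"
    using ipd[OF d] by (simp add: second_difference_def algebra_simps)
  show ?thesis
    using ip_le_nrm[OF assms d] unfolding rkhs_norm_def ipd[OF assms] dd .
qed

text \<open>\<open>Riesz_subspace\<close> on \<open>W\<close> for the functional \<open>ip f\<close>
  returns a limit \<open>h\<close> of elements of \<open>W\<close> that pairs with every section as
  \<open>f\<close> does; by the reproducing property \<open>h = f\<close>.\<close>

lemma sections_dense:
  assumes "f \<in> H" and W: "W \<subseteq> H" "\<And>x. (\<lambda>y. k y x) \<in> W"
    and W_comb: "\<And>a f b g. f \<in> W \<Longrightarrow> g \<in> W \<Longrightarrow> (\<lambda>x. a * f x + b * g x) \<in> W"
  obtains w where "\<And>n::nat. w n \<in> W" "(\<lambda>n. nrm (\<lambda>x. w n x - f x)) \<longlonglongrightarrow> 0"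
proof -
  obtain h w where hw: "h \<in> H" "\<And>n::nat. w n \<in> W"
    "(\<lambda>n. ip (\<lambda>x. 1 * w n x + (-1) * h x) (\<lambda>x. 1 * w n x + (-1) * h x)) \<longlonglongrightarrow> 0"
    "\<And>v. v \<in> W \<Longrightarrow> ip h v = ip f v"
  proof (rule Riesz_subspace[of W "ip f" "ip f f"])
    show "W \<noteq> {}" using W(2) by auto
    show "ip f (\<lambda>x. a * g x + b * g' x) = a * ip f g + b * ip f g'" if "g \<in> W" "g' \<in> W" for a g b g'
      using ip_comb_right assms(1) W(1) that by blast
    show "(ip f v)\<^sup>2 \<le> ip f f * ip v v" if "v \<in> W" for v
      using Cauchy_Schwarz assms(1) W(1) that by blast
  qed (use assms ip_nonneg in auto)
  have "h x = f x" for x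
    using hw(4)[OF W(2), of x] reproducing[OF hw(1)] reproducing[OF assms(1)] by simp
  then have "h = f" by auto
  then have "(\<lambda>n. sqrt (ip (\<lambda>x. w n x - f x) (\<lambda>x. w n x - f x))) \<longlonglongrightarrow> 0"
    using tendsto_real_sqrt[OF hw(3)] by simp
  then show ?thesis using that[of w] hw(2) by (simp add: rkhs_norm_def)
qed

lemma nrm_Cauchy:
  assumes "\<And>n::nat. w n \<in> H" "f \<in> H" "(\<lambda>n. nrm (\<lambda>x. w n x - f x)) \<longlonglongrightarrow> 0" "e > 0" "0 \<le> c"
  shows "\<exists>N. \<forall>m\<ge>N. \<forall>n\<ge>N. c * nrm (\<lambda>x. w m x - w n x) \<le> e"
proof -
  \<comment> \<open>The \<open>+ 1\<close> admits \<open>c = 0\<close>.\<close>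
  define \<delta> where "\<delta> = e / (c + 1) / 2"
  have \<delta>: "\<delta> > 0" using assms(4,5) by (simp add: \<delta>_def)
  obtain N where N: "\<And>n. n \<ge> N \<Longrightarrow> \<bar>nrm (\<lambda>x. w n x - f x)\<bar> < \<delta>"
    using LIMSEQ_D[OF assms(3) \<delta>] by auto
  have "c * nrm (\<lambda>x. w m x - w n x) \<le> e" if "m \<ge> N" "n \<ge> N" for m n
  proof -
    have "nrm (\<lambda>x. w m x - w n x) \<le> 2 * \<delta>"
      using nrm_diff_triangle[OF assms(1)[of m] assms(1)[of n] assms(2)] N[OF that(1)] N[OF that(2)] by linarith
    then have "c * nrm (\<lambda>x. w m x - w n x) \<le> c * (2 * \<delta>)" using assms(5) by (rule mult_left_mono)
    also have "\<dots> \<le> e" using assms(4,5) by (simp add: \<delta>_def field_simps)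
    finally show ?thesis .
  qed
  then show ?thesis by blast
qed

lemma pointwise_limit:
  assumes "\<And>n::nat. w n \<in> H" "f \<in> H" "(\<lambda>n. nrm (\<lambda>x. w n x - f x)) \<longlonglongrightarrow> 0"
  shows "(\<lambda>n. w n x) \<longlonglongrightarrow> f x"
proof -
  have "(\<lambda>n. w n x - f x) \<longlonglongrightarrow> 0"
  proof (rule Lim_null_comparison)
    show "\<forall>\<^sub>F n in sequentially. norm (w n x - f x) \<le> nrm (\<lambda>x. w n x - f x) * sqrt (k x x)"
      using abs_le_nrm[OF diff_in[OF assms(1,2)]] by simp
    show "(\<lambda>n. nrm (\<lambda>x. w n x - f x) * sqrt (k x x)) \<longlonglongrightarrow> 0"
      using assms(3) by (rule tendsto_mult_left_zero)
  qed
  then show ?thesis by (simp add: LIM_zero_cancel)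
qed

end

section \<open>First-order smoothness of the elements of the RKHS\<close>

locale rkhs_C1 = rkhs_space +
  assumes k_C1: "k \<in> Cb_1_1"
begin

lemma ex_lipschitz: "\<exists>c\<ge>0. \<forall>f\<in>H. \<forall>a b. \<bar>f a - f b\<bar> \<le> c * nrm f * norm (a - b)"
proof -
  obtain M where M: "0 \<le> M" "\<And>a b y y'. \<bar>k a y - k b y - k a y' + k b y'\<bar> \<le> M * norm (a - b) * norm (y - y')"
    using Cb_1_1_increment[OF k_C1] by blast
  show ?thesis
  proof (intro exI[of _ "sqrt M"] conjI ballI allI)
    fix f a b assume f: "f \<in> H"
    have "k a a - k b a - k a b + k b b \<le> M * (norm (a - b))\<^sup>2"
      using M(2)[of a a b b] by (simp add: power2_eq_square mult.assoc)
    then have "sqrt (k a a - k b a - k a b + k b b) \<le> sqrt M * norm (a - b)"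
      by (metis real_sqrt_le_iff real_sqrt_mult real_sqrt_abs abs_norm_cancel)
    then have "nrm f * sqrt (k a a - k b a - k a b + k b b) \<le> nrm f * (sqrt M * norm (a - b))"
      using nrm_nonneg[OF f] by (rule mult_left_mono)
    then show "\<bar>f a - f b\<bar> \<le> sqrt M * nrm f * norm (a - b)"
      using increment_le[OF f, of a b] by (simp add: mult_ac)
  qed (use M in simp)
qed

text \<open>Fixed once for all functions of \<open>H\<close>: the later first-order bounds are
  linear in \<open>nrm f\<close> with this constant, which is what makes the Stein functionals
  bounded on \<open>H\<close>.\<close>

definition lip :: real where
  "lip = (SOME c. 0 \<le> c \<and> (\<forall>f\<in>H. \<forall>a b. \<bar>f a - f b\<bar> \<le> c * nrm f * norm (a - b)))"

lemma lip_nonneg: "0 \<le> lip" and lipschitz: "f \<in> H \<Longrightarrow> \<bar>f a - f b\<bar> \<le> lip * nrm f * norm (a - b)"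
  using someI_ex[OF ex_lipschitz] unfolding lip_def by blast+

lemma derivative_le:
  assumes "f \<in> H" "(f has_derivative f') (at x)"
  shows "\<bar>f' u\<bar> \<le> lip * nrm f * norm u"
proof (rule tendsto_abs_le[OF has_derivative_difference_quotient[OF assms(2)]])
  fix n
  have "\<bar>real (Suc n) *\<^sub>R (f (x + inverse (real (Suc n)) *\<^sub>R u) - f x)\<bar>
      \<le> real (Suc n) * (lip * nrm f * norm (inverse (real (Suc n)) *\<^sub>R u))"
    using lipschitz[OF assms(1), of "x + inverse (real (Suc n)) *\<^sub>R u" x]
    by (simp add: abs_mult del: of_nat_Suc)
  then show "\<bar>real (Suc n) *\<^sub>R (f (x + inverse (real (Suc n)) *\<^sub>R u) - f x)\<bar> \<le> lip * nrm f * norm u"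
    unfolding norm_scaled_step .
qed

text \<open>The differentiable elements of \<open>H\<close> form a subspace containing the sections,
  hence a dense one. \<open>derivative_le\<close> applied to differences of \<open>w m\<close> and
  \<open>w n\<close> makes the derivatives uniformly Cauchy, so the limit \<open>f\<close> is
  differentiable.\<close>

lemma differentiable:
  assumes f: "f \<in> H"
  shows "f differentiable (at x)"
proof -
  let ?W = "{f \<in> H. \<forall>x. f differentiable (at x)}"
  obtain w where w: "\<And>n::nat. w n \<in> ?W" "(\<lambda>n. nrm (\<lambda>x. w n x - f x)) \<longlonglongrightarrow> 0"
  proof (rule sections_dense[OF f, of ?W])
    show "(\<lambda>y. k y x) \<in> ?W" for x
      using k_C1 section_in by (simp add: Cb_1_1_def Cb1_fst_def differentiable1_def)
    show "(\<lambda>x. a * f x + b * g x) \<in> ?W" if "f \<in> ?W" "g \<in> ?W" for a f b g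
      using that comb_in by (auto intro!: differentiable_add differentiable_mult)
  qed auto
  have wH: "w n \<in> H" for n using w(1) by auto
  have der: "(w n has_derivative frechet_derivative (w n) (at x)) (at x)" for n x
    using w(1)[of n] by (simp add: frechet_derivative_works)
  show ?thesis
  proof (rule has_derivative_uniform_Cauchy[OF der])
    show "norm (frechet_derivative (w m) (at x) h - frechet_derivative (w n) (at x) h)
        \<le> lip * nrm (\<lambda>x. w m x - w n x) * norm h" for m n x h
      using derivative_le[OF diff_in[OF wH wH] has_derivative_diff[OF der der]] by simp
    show "\<exists>N. \<forall>m\<ge>N. \<forall>n\<ge>N. lip * nrm (\<lambda>x. w m x - w n x) \<le> e" if "e > 0" for e
      using nrm_Cauchy[OF wH f w(2) that lip_nonneg] .
    show "(\<lambda>n. w n x) \<longlonglongrightarrow> f x" for x by (rule pointwise_limit[OF wH f w(2)])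
  qed
qed

lemma has_derivative_grad_H: "f \<in> H \<Longrightarrow> (f has_derivative (\<lambda>h. inner h (grad f x))) (at x)"
  by (intro has_derivative_grad differentiable)

lemma grad_comb: "f \<in> H \<Longrightarrow> g \<in> H \<Longrightarrow> grad (\<lambda>y. a * f y + b * g y) x = a *\<^sub>R grad f x + b *\<^sub>R grad g x"
  by (intro grad_linear differentiable)

lemma inner_grad_le: "f \<in> H \<Longrightarrow> \<bar>inner u (grad f x)\<bar> \<le> lip * nrm f * norm u"
  using derivative_le has_derivative_grad_H by blast

lemma norm_grad_le: "f \<in> H \<Longrightarrow> norm (grad f x) \<le> lip * nrm f"
  using inner_grad_le by (intro norm_le_inner_bound mult_nonneg_nonneg lip_nonneg nrm_nonneg) (auto simp: abs_le_iff)

lemma continuous_H: "f \<in> H \<Longrightarrow> continuous_on UNIV f"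
  by (intro continuous_at_imp_continuous_on ballI differentiable_imp_continuous_within differentiable)

end

section \<open>Second-order smoothness of the elements of the RKHS\<close>

locale rkhs_C2 = rkhs_space +
  assumes k_C2: "k \<in> Cb_2_2"
begin

sublocale rkhs_C1
  using k_C2 Cb_2_2_subset by unfold_locales blast

lemma ex_lipschitz2: "\<exists>c\<ge>0. \<forall>f\<in>H. \<forall>x u v. \<bar>second_difference f x u v\<bar> \<le> c * nrm f * norm u * norm v"
proof -
  obtain M where M: "0 \<le> M"
    "\<And>x y u v. \<bar>second_difference (\<lambda>z. second_difference (\<lambda>w. k w z) x u v) y u v\<bar> \<le> M * (norm u * norm v)\<^sup>2"
    using Cb_2_2_increment[OF k_C2] by blast
  show ?thesis
  proof (intro exI[of _ "sqrt M"] conjI ballI allI)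
    fix f x u v assume f: "f \<in> H"
    have "\<bar>second_difference f x u v\<bar> \<le> nrm f * sqrt (M * (norm u * norm v)\<^sup>2)"
      by (rule order_trans[OF second_difference_le[OF f]])
         (rule mult_left_mono[OF real_sqrt_le_mono[OF abs_le_D1[OF M(2)]] nrm_nonneg[OF f]])
    also have "sqrt (M * (norm u * norm v)\<^sup>2) = sqrt M * (norm u * norm v)"
      by (simp add: real_sqrt_mult)
    finally show "\<bar>second_difference f x u v\<bar> \<le> sqrt M * nrm f * norm u * norm v"
      by (simp add: mult_ac)
  qed (use M in simp)
qed

definition lip2 :: real where
  "lip2 = (SOME c. 0 \<le> c \<and> (\<forall>f\<in>H. \<forall>x u v. \<bar>second_difference f x u v\<bar> \<le> c * nrm f * norm u * norm v))"

lemma lip2_nonneg: "0 \<le> lip2"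
  and lipschitz2: "f \<in> H \<Longrightarrow> \<bar>second_difference f x u v\<bar> \<le> lip2 * nrm f * norm u * norm v"
  using someI_ex[OF ex_lipschitz2] unfolding lip2_def by blast+

text \<open>Second differences, divided by a shrinking step in direction \<open>u\<close>, tend to
  increments of the derivative along \<open>u\<close>; so the gradient is Lipschitz before it is
  known to be differentiable.\<close>

lemma grad_lipschitz:
  assumes f: "f \<in> H"
  shows "norm (grad f (x + v) - grad f x) \<le> lip2 * nrm f * norm v"
proof (rule norm_le_inner_bound)
  fix u :: 'a
  let ?h = "\<lambda>n. inverse (real (Suc n)) *\<^sub>R u"
  have "\<bar>inner u (grad f (x + v)) - inner u (grad f x)\<bar> \<le> lip2 * nrm f * norm v * norm u"
  proof (rule tendsto_abs_le[OF tendsto_diff[OF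
        has_derivative_difference_quotient[OF has_derivative_grad_H[OF f]]
        has_derivative_difference_quotient[OF has_derivative_grad_H[OF f]]]])
    fix n
    have "\<bar>f (x + ?h n + v) - f (x + ?h n) - f (x + v) + f x\<bar> \<le> lip2 * nrm f * norm (?h n) * norm v"
      using lipschitz2[OF f, of x "?h n" v] by (simp only: second_difference_def)
    then have "\<bar>f (x + ?h n + v) - f (x + ?h n) - f (x + v) + f x\<bar> \<le> (lip2 * nrm f * norm v) * norm (?h n)"
      by (simp only: mult_ac)
    then have "real (Suc n) * \<bar>f (x + ?h n + v) - f (x + ?h n) - f (x + v) + f x\<bar>
        \<le> real (Suc n) * ((lip2 * nrm f * norm v) * norm (?h n))"
      by (rule mult_left_mono) simp
    also have "\<dots> = lip2 * nrm f * norm v * norm u" by (rule norm_scaled_step)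
    finally have "\<bar>real (Suc n) * (f (x + ?h n + v) - f (x + ?h n) - f (x + v) + f x)\<bar> \<le> lip2 * nrm f * norm v * norm u"
      by (simp only: abs_mult abs_of_nat)
    then show "\<bar>real (Suc n) *\<^sub>R (f (x + v + ?h n) - f (x + v)) - real (Suc n) *\<^sub>R (f (x + ?h n) - f x)\<bar>
        \<le> lip2 * nrm f * norm v * norm u"
      by (simp add: algebra_simps del: of_nat_Suc)
  qed
  then show "inner u (grad f (x + v) - grad f x) \<le> lip2 * nrm f * norm v * norm u"
    by (simp add: inner_diff_right abs_le_iff)
qed (intro mult_nonneg_nonneg lip2_nonneg nrm_nonneg f norm_ge_zero)

lemma grad_derivative_le:
  assumes "f \<in> H" "(grad f has_derivative G) (at x)"
  shows "norm (G v) \<le> lip2 * nrm f * norm v"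
proof (rule tendsto_upperbound[OF tendsto_norm[OF has_derivative_difference_quotient[OF assms(2)]]])
  show "\<forall>\<^sub>F n in sequentially.
      norm (real (Suc n) *\<^sub>R (grad f (x + inverse (real (Suc n)) *\<^sub>R v) - grad f x)) \<le> lip2 * nrm f * norm v"
  proof (intro always_eventually allI)
    fix n
    have "norm (real (Suc n) *\<^sub>R (grad f (x + inverse (real (Suc n)) *\<^sub>R v) - grad f x))
        \<le> real (Suc n) * (lip2 * nrm f * norm (inverse (real (Suc n)) *\<^sub>R v))"
      using grad_lipschitz[OF assms(1), of x "inverse (real (Suc n)) *\<^sub>R v"]
      by (simp only: norm_scaleR abs_of_nat mult_left_mono of_nat_0_le_iff)
    then show "norm (real (Suc n) *\<^sub>R (grad f (x + inverse (real (Suc n)) *\<^sub>R v) - grad f x)) \<le> lip2 * nrm f * norm v"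
      unfolding norm_scaled_step .
  qed
qed simp

lemma grad_section: "grad (\<lambda>y. k y z) = (\<lambda>x. riesz (D1 k x z))"
proof
  fix x
  have "((\<lambda>y. k y z) has_derivative blinfun_apply (D1 k x z)) (at x)"
    using k_C2 by (intro has_derivative_D1) (simp add: Cb_2_2_def Cb2_fst_def)
  then show "grad (\<lambda>y. k y z) x = riesz (D1 k x z)"
    by (intro grad_eqI) (simp add: gderiv_def inner_commute[of _ "riesz _"] inner_riesz)
qed

text \<open>The density argument of \<open>differentiable\<close> one order higher, on the subspace
  of functions with differentiable gradient; \<open>norm_grad_le\<close> provides the pointwise
  convergence of the gradients.\<close>

lemma differentiable_grad:
  assumes f: "f \<in> H"
  shows "grad f differentiable (at x)"
proof -
  let ?W = "{f \<in> H. \<forall>x. grad f differentiable (at x)}"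
  obtain w where w: "\<And>n::nat. w n \<in> ?W" "(\<lambda>n. nrm (\<lambda>x. w n x - f x)) \<longlonglongrightarrow> 0"
  proof (rule sections_dense[OF f, of ?W])
    show "(\<lambda>y. k y z) \<in> ?W" for z
    proof -
      have "((\<lambda>x. riesz (D1 k x z)) has_derivative (\<lambda>h. riesz (blinfun_apply (D1 (D1 k) x z) h))) (at x)" for x
        using k_C2 by (intro bounded_linear.has_derivative[OF bounded_linear_riesz] has_derivative_D1)
          (simp add: Cb_2_2_def Cb2_fst_def)
      then show ?thesis by (auto simp: section_in grad_section differentiable_def)
    qed
    show "(\<lambda>x. a * f x + b * g x) \<in> ?W" if fg: "f \<in> ?W" "g \<in> ?W" for a f b g
    proof -
      have "grad (\<lambda>x. a * f x + b * g x) = (\<lambda>x. a *\<^sub>R grad f x + b *\<^sub>R grad g x)"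
        using fg by (intro ext grad_comb) auto
      then show ?thesis using fg comb_in by (auto intro!: differentiable_add differentiable_scaleR)
    qed
  qed auto
  have wH: "w n \<in> H" for n using w(1) by auto
  have grad_diff: "grad (\<lambda>x. f x - g x) = (\<lambda>x. grad f x - grad g x)" if "f \<in> H" "g \<in> H" for f g
    using grad_comb[OF that, of 1 "-1"] by (auto intro!: ext)
  have der: "(grad (w n) has_derivative frechet_derivative (grad (w n)) (at x)) (at x)" for n x
    using w(1)[of n] by (simp add: frechet_derivative_works)
  show ?thesis
  proof (rule has_derivative_uniform_Cauchy[OF der])
    show "norm (frechet_derivative (grad (w m)) (at x) h - frechet_derivative (grad (w n)) (at x) h)
        \<le> lip2 * nrm (\<lambda>x. w m x - w n x) * norm h" for m n x h
    proof (rule grad_derivative_le[OF diff_in[OF wH wH]])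
      show "(grad (\<lambda>x. w m x - w n x) has_derivative
          (\<lambda>h. frechet_derivative (grad (w m)) (at x) h - frechet_derivative (grad (w n)) (at x) h)) (at x)"
        unfolding grad_diff[OF wH wH] by (rule has_derivative_diff[OF der der])
    qed
    show "\<exists>N. \<forall>m\<ge>N. \<forall>n\<ge>N. lip2 * nrm (\<lambda>x. w m x - w n x) \<le> e" if "e > 0" for e
      using nrm_Cauchy[OF wH f w(2) that lip2_nonneg] .
    show "(\<lambda>n. grad (w n) x) \<longlonglongrightarrow> grad f x" for x
    proof -
      have "(\<lambda>n. grad (w n) x - grad f x) \<longlonglongrightarrow> 0"
      proof (rule Lim_null_comparison)
        show "\<forall>\<^sub>F n in sequentially. norm (grad (w n) x - grad f x) \<le> lip * nrm (\<lambda>x. w n x - f x)"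
          using norm_grad_le[OF diff_in[OF wH f]] grad_diff[OF wH f] by simp
        show "(\<lambda>n. lip * nrm (\<lambda>x. w n x - f x)) \<longlonglongrightarrow> 0"
          using w(2) by (rule tendsto_mult_right_zero)
      qed
      then show ?thesis by (simp add: LIM_zero_cancel)
    qed
  qed
qed

lemma has_derivative_hess: "f \<in> H \<Longrightarrow> (grad f has_derivative hess f x) (at x)"
  unfolding hess_def using differentiable_grad by (simp add: frechet_derivative_works)

lemma norm_hess_le: "f \<in> H \<Longrightarrow> norm (hess f x u) \<le> lip2 * nrm f * norm u"
  using grad_derivative_le has_derivative_hess by blast

lemma hess_comb:
  assumes "f \<in> H" "g \<in> H"
  shows "hess (\<lambda>y. a * f y + b * g y) x u = a *\<^sub>R hess f x u + b *\<^sub>R hess g x u"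
proof -
  have "grad (\<lambda>y. a * f y + b * g y) = (\<lambda>x. a *\<^sub>R grad f x + b *\<^sub>R grad g x)"
    using grad_comb[OF assms] by auto
  then have "(grad (\<lambda>y. a * f y + b * g y) has_derivative (\<lambda>u. a *\<^sub>R hess f x u + b *\<^sub>R hess g x u)) (at x)"
    by (auto intro!: derivative_eq_intros has_derivative_hess assms)
  then have "hess (\<lambda>y. a * f y + b * g y) x = (\<lambda>u. a *\<^sub>R hess f x u + b *\<^sub>R hess g x u)"
    using has_derivative_hess[OF comb_in[OF assms]] has_derivative_unique by blast
  then show ?thesis by simp
qed

end

section \<open>Plane waves and integration\<close>

lemma wave_eq_cis: "wave s x = cis (inner s x)"
  by (simp add: wave_def cis_conv_exp)

lemma norm_wave [simp]: "cmod (wave s x) = 1"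
  by (simp add: wave_eq_cis)

lemma wave_add: "wave s (x + y) = wave s x * wave s y"
  by (simp add: wave_eq_cis inner_add_right cis_mult)

lemma wave_diff: "wave s (x - y) = cnj (wave s y) * wave s x"
  by (simp add: wave_eq_cis inner_diff_right cis_mult cis_cnj)

lemma wave_commute: "wave s x = wave x s"
  by (simp add: wave_def inner_commute)

lemma wave_0 [simp]: "wave s 0 = 1"
  by (simp add: wave_def)

lemma norm_wave_minus_1_le: "cmod (wave s u - 1) \<le> \<bar>inner s u\<bar>"
  using iexp_approx1[of "inner s u" 0] by (simp add: wave_def)

lemma borel_measurable_wave [measurable (raw)]:
  fixes f g :: "'b \<Rightarrow> 'a::{real_inner, second_countable_topology}"
  assumes [measurable]: "f \<in> borel_measurable M" "g \<in> borel_measurable M"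
  shows "(\<lambda>z. wave (f z) (g z)) \<in> borel_measurable M"
proof -
  have "continuous_on UNIV cis" by (intro continuous_intros)
  then have [measurable]: "cis \<in> borel_measurable borel" by (rule borel_measurable_continuous_onI)
  show ?thesis unfolding wave_eq_cis by measurable
qed

lemma has_derivative_wave: "(wave s has_derivative (\<lambda>u. \<i> * complex_of_real (inner s u) * wave s x)) (at x)"
proof -
  have "((\<lambda>y. \<i> * complex_of_real (inner s y)) has_derivative (\<lambda>u. \<i> * complex_of_real (inner s u))) (at x)"
    by (auto intro!: derivative_eq_intros)
  from has_derivative_compose[OF this has_field_derivative_imp_has_derivative[OF DERIV_exp]]
  show ?thesis unfolding wave_def by (simp add: mult_ac)
qed

lemma wave_difference_quotient:
  "(\<lambda>n. real (Suc n) *\<^sub>R (wave s (x + inverse (real (Suc n)) *\<^sub>R u) - wave s x))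
    \<longlonglongrightarrow> \<i> * complex_of_real (inner s u) * wave s x"
  by (rule has_derivative_difference_quotient[OF has_derivative_wave])

text \<open>Uniform in \<open>n\<close>, so that \<open>\<bar>inner s u\<bar>\<close> can dominate
  in \<open>synth_quotient\<close>.\<close>

lemma norm_wave_difference_quotient_le:
  "cmod (real (Suc n) *\<^sub>R (wave s (x + inverse (real (Suc n)) *\<^sub>R u) - wave s x)) \<le> \<bar>inner s u\<bar>"
proof -
  let ?h = "inverse (real (Suc n)) *\<^sub>R u"
  have "wave s (x + ?h) - wave s x = wave s x * (wave s ?h - 1)"
    by (simp add: wave_add right_diff_distrib)
  then have "cmod (real (Suc n) *\<^sub>R (wave s (x + ?h) - wave s x)) = real (Suc n) * cmod (wave s ?h - 1)"
    by (simp only: norm_scaleR norm_mult norm_wave abs_of_nat mult_1)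
  also have "\<dots> \<le> real (Suc n) * \<bar>inner s ?h\<bar>"
    by (intro mult_left_mono norm_wave_minus_1_le) simp
  also have "\<dots> = \<bar>inner s u\<bar>"
    by (simp add: abs_mult del: of_nat_Suc)
  finally show ?thesis .
qed

text \<open>Integrability of the limit is a conclusion here, as needed for moments of
  \<open>\<mu>\<close>: there the \<open>f n\<close> are powers of difference quotients of waves,
  whose integrals the kernel bounds.\<close>

lemma Fatou_bound:
  fixes f :: "nat \<Rightarrow> 'b \<Rightarrow> real"
  assumes int: "\<And>n. integrable M (f n)" and nonneg: "\<And>n x. 0 \<le> f n x"
    and le: "\<And>n. (\<integral>x. f n x \<partial>M) \<le> c" and lim: "\<And>x. (\<lambda>n. f n x) \<longlonglongrightarrow> g x"
  shows "integrable M g" "(\<integral>x. g x \<partial>M) \<le> c"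
proof -
  have "0 \<le> (\<integral>x. f 0 x \<partial>M)" using nonneg by (intro integral_nonneg_AE AE_I2)
  then have c: "0 \<le> c" using le[of 0] by linarith
  have g0: "0 \<le> g x" for x using LIMSEQ_le_const[OF lim] nonneg by blast
  have [measurable]: "f n \<in> borel_measurable M" for n using int by auto
  have [measurable]: "g \<in> borel_measurable M" by (rule borel_measurable_LIMSEQ_real[OF lim]) auto
  have "(\<integral>\<^sup>+x. ennreal (g x) \<partial>M) = (\<integral>\<^sup>+x. liminf (\<lambda>n. ennreal (f n x)) \<partial>M)"
    using lim_imp_Liminf[OF _ tendsto_ennrealI[OF lim]] by (intro nn_integral_cong) simp
  also have "\<dots> \<le> liminf (\<lambda>n. \<integral>\<^sup>+x. ennreal (f n x) \<partial>M)"
    by (rule nn_integral_liminf) measurable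
  also have "\<dots> \<le> liminf (\<lambda>n. ennreal c)"
    by (intro Liminf_mono always_eventually allI)
       (simp add: nn_integral_eq_integral int nonneg le ennreal_leI)
  also have "\<dots> = ennreal c" by (simp add: Liminf_const)
  finally have le: "(\<integral>\<^sup>+x. ennreal (g x) \<partial>M) \<le> ennreal c" .
  show int: "integrable M g"
    using le g0 by (intro integrableI_bounded) (auto simp: top_unique less_top[symmetric] le_less_trans)
  show "(\<integral>x. g x \<partial>M) \<le> c"
    using le c by (simp add: nn_integral_eq_integral int g0)
qed

lemma integrable_finite_bounded:
  fixes f :: "'b \<Rightarrow> 'c::{banach, second_countable_topology}"
  assumes "finite_measure M" "f \<in> borel_measurable M" "\<And>x. norm (f x) \<le> c"
  shows "integrable M f"
  using finite_measure.integrable_const_bound[OF assms(1)] assms(2,3) by blast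

lemma sigma_finite_pair_Fubini:
  fixes f :: "'b \<Rightarrow> 'c \<Rightarrow> 'd::{banach, second_countable_topology}"
  assumes "sigma_finite_measure M1" "sigma_finite_measure M2"
    and [measurable]: "case_prod f \<in> borel_measurable (M1 \<Otimes>\<^sub>M M2)"
    and int: "\<And>x. integrable M2 (f x)" and le: "\<And>x. (\<integral>y. norm (f x y) \<partial>M2) \<le> b x" and b: "integrable M1 b"
  shows "(\<integral>x. (\<integral>y. f x y \<partial>M2) \<partial>M1) = (\<integral>y. (\<integral>x. f x y \<partial>M1) \<partial>M2)"
    and "integrable M2 (\<lambda>y. \<integral>x. f x y \<partial>M1)"
proof -
  interpret M1: sigma_finite_measure M1 by fact
  interpret M2: sigma_finite_measure M2 by fact
  interpret P: pair_sigma_finite M1 M2 ..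
  have I: "integrable (M1 \<Otimes>\<^sub>M M2) (case_prod f)"
  proof (rule P.Fubini_integrable)
    show "integrable M1 (\<lambda>x. \<integral>y. norm (case_prod f (x, y)) \<partial>M2)"
    proof (rule Bochner_Integration.integrable_bound[OF b])
      show "AE x in M1. norm (\<integral>y. norm (case_prod f (x, y)) \<partial>M2) \<le> norm (b x)"
        using le by (intro AE_I2) (simp, smt (verit) integral_nonneg_AE AE_I2 norm_ge_zero)
    qed measurable
  qed (use int in auto)
  show "(\<integral>x. (\<integral>y. f x y \<partial>M2) \<partial>M1) = (\<integral>y. (\<integral>x. f x y \<partial>M1) \<partial>M2)"
    using P.Fubini_integral[OF I] by simp
  show "integrable M2 (\<lambda>y. \<integral>x. f x y \<partial>M1)"
    using P.integrable_snd[OF I] by simp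
qed

text \<open>Cauchy--Schwarz with weight \<open>\<rho>\<close>: \<open>(\<integral> a)\<^sup>2 \<le> (\<integral> \<rho>) (\<integral> a\<^sup>2 / \<rho>)\<close>, where \<open>a = 0\<close>
  wherever \<open>\<rho>\<close> vanishes.\<close>

lemma integrable_power2_integral:
  fixes a :: "'b \<Rightarrow> 'c \<Rightarrow> real"
  assumes M1: "sigma_finite_measure M1" and M2: "sigma_finite_measure M2"
    and am[measurable]: "case_prod a \<in> borel_measurable (M1 \<Otimes>\<^sub>M M2)"
    and a0: "\<And>s z. 0 \<le> a s z" and \<rho>: "integrable M2 \<rho>" "\<And>z. 0 \<le> \<rho> z" "\<And>s z. \<rho> z = 0 \<Longrightarrow> a s z = 0"
    and int: "\<And>z. integrable M1 (\<lambda>s. (a s z)\<^sup>2)" and le: "\<And>z. (\<integral>s. (a s z)\<^sup>2 \<partial>M1) \<le> c * (\<rho> z)\<^sup>2"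
    and c: "0 \<le> c"
  shows "integrable M1 (\<lambda>s. (\<integral>z. a s z \<partial>M2)\<^sup>2)"
proof -
  interpret M1: sigma_finite_measure M1 by fact
  interpret M2: sigma_finite_measure M2 by fact
  interpret P: pair_sigma_finite M1 M2 ..
  have [measurable]: "\<rho> \<in> borel_measurable M2" using \<rho>(1) by auto
  have [measurable]: "(\<lambda>s. \<integral>z. a s z \<partial>M2) \<in> borel_measurable M1"
    using M2.borel_measurable_lebesgue_integral[OF am] by simp
  have as[measurable]: "a s \<in> borel_measurable M2" if "s \<in> space M1" for s
    using measurable_compose[OF measurable_Pair1'[OF that] am] by simp
  have 1: "ennreal ((\<integral>z. a s z \<partial>M2)\<^sup>2) \<le> (\<integral>\<^sup>+z. ennreal (\<rho> z) \<partial>M2) * (\<integral>\<^sup>+z. ennreal ((a s z)\<^sup>2 / \<rho> z) \<partial>M2)"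
    if s: "s \<in> space M1" for s
  proof -
    have [measurable]: "a s \<in> borel_measurable M2" using s by measurable
    have "ennreal (\<integral>z. a s z \<partial>M2) \<le> (\<integral>\<^sup>+z. ennreal (a s z) \<partial>M2)"
      by (cases "integrable M2 (a s)") (simp_all add: nn_integral_eq_integral a0 not_integrable_integral_eq)
    also have "\<dots> = (\<integral>\<^sup>+z. ennreal (sqrt (\<rho> z)) * ennreal (a s z / sqrt (\<rho> z)) \<partial>M2)"
      using \<rho>(2,3) a0 by (intro nn_integral_cong) (auto simp: ennreal_mult[symmetric])
    finally have "ennreal (\<integral>z. a s z \<partial>M2) ^ 2 \<le> (\<integral>\<^sup>+z. ennreal (sqrt (\<rho> z)) * ennreal (a s z / sqrt (\<rho> z)) \<partial>M2) ^ 2"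
      by (rule power_mono) simp
    also have "\<dots> \<le> (\<integral>\<^sup>+z. ennreal (sqrt (\<rho> z)) ^ 2 \<partial>M2) * (\<integral>\<^sup>+z. ennreal (a s z / sqrt (\<rho> z)) ^ 2 \<partial>M2)"
      by (rule Cauchy_Schwarz_nn_integral) measurable
    also have "\<dots> = (\<integral>\<^sup>+z. ennreal (\<rho> z) \<partial>M2) * (\<integral>\<^sup>+z. ennreal ((a s z)\<^sup>2 / \<rho> z) \<partial>M2)"
      using \<rho>(2) a0 by (simp add: ennreal_power power_divide)
    finally show ?thesis
      using a0 by (simp add: ennreal_power integral_nonneg_AE)
  qed
  have "(\<integral>\<^sup>+s. ennreal ((\<integral>z. a s z \<partial>M2)\<^sup>2) \<partial>M1)
      \<le> (\<integral>\<^sup>+s. (\<integral>\<^sup>+z. ennreal (\<rho> z) \<partial>M2) * (\<integral>\<^sup>+z. ennreal ((a s z)\<^sup>2 / \<rho> z) \<partial>M2) \<partial>M1)"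
    using 1 by (rule nn_integral_mono)
  also have "\<dots> = (\<integral>\<^sup>+z. ennreal (\<rho> z) \<partial>M2) * (\<integral>\<^sup>+s. (\<integral>\<^sup>+z. ennreal ((a s z)\<^sup>2 / \<rho> z) \<partial>M2) \<partial>M1)"
    by (rule nn_integral_cmult) measurable
  also have "(\<integral>\<^sup>+s. (\<integral>\<^sup>+z. ennreal ((a s z)\<^sup>2 / \<rho> z) \<partial>M2) \<partial>M1) = (\<integral>\<^sup>+z. (\<integral>\<^sup>+s. ennreal ((a s z)\<^sup>2 / \<rho> z) \<partial>M1) \<partial>M2)"
    by (rule P.Fubini'[symmetric]) measurable
  \<comment> \<open>After the exchange of integrals the weight turns the quadratic bound
    \<open>c * (\<rho> z)\<^sup>2\<close> into \<open>c * \<rho> z\<close>, so integrability of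
    \<open>\<rho>\<close> itself suffices. Where \<open>\<rho>\<close> vanishes, division by zero
    yields \<open>0\<close> on both sides.\<close>
  also have "\<dots> \<le> (\<integral>\<^sup>+z. ennreal (c * \<rho> z) \<partial>M2)"
  proof (rule nn_integral_mono)
    fix z
    have "(\<integral>\<^sup>+s. ennreal ((a s z)\<^sup>2 / \<rho> z) \<partial>M1) = ennreal ((\<integral>s. (a s z)\<^sup>2 \<partial>M1) / \<rho> z)"
      using int[of z] \<rho>(2) by (subst nn_integral_eq_integral) auto
    also have "\<dots> \<le> ennreal (c * (\<rho> z)\<^sup>2 / \<rho> z)"
      using le \<rho>(2) by (intro ennreal_leI divide_right_mono)
    finally show "(\<integral>\<^sup>+s. ennreal ((a s z)\<^sup>2 / \<rho> z) \<partial>M1) \<le> ennreal (c * \<rho> z)"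
      by (cases "\<rho> z = 0") (simp_all add: power2_eq_square)
  qed
  also have "\<dots> = ennreal (c * (\<integral>z. \<rho> z \<partial>M2))"
    using \<rho> c by (subst nn_integral_eq_integral) auto
  also have "(\<integral>\<^sup>+z. ennreal (\<rho> z) \<partial>M2) = ennreal (\<integral>z. \<rho> z \<partial>M2)"
    using \<rho> by (subst nn_integral_eq_integral) auto
  finally have "(\<integral>\<^sup>+s. ennreal ((\<integral>z. a s z \<partial>M2)\<^sup>2) \<partial>M1) < \<infinity>"
    by (auto simp: mult_left_mono ennreal_mult_less_top le_less_trans)
  then show ?thesis by (intro integrableI_bounded) auto
qed

section \<open>Fourier kernels\<close>

lemma second_difference_integral:
  fixes f :: "'b \<Rightarrow> 'a::plus \<Rightarrow> 'c::{banach, second_countable_topology}"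
  assumes "\<And>x. integrable M (\<lambda>s. f s x)"
  shows "integrable M (\<lambda>s. second_difference (f s) x u v)"
    and "(\<integral>s. second_difference (f s) x u v \<partial>M) = second_difference (\<lambda>x. \<integral>s. f s x \<partial>M) x u v"
  using assms by (simp_all add: second_difference_def)

lemma borel_measurable_cnj [measurable (raw)]:
  "f \<in> borel_measurable M \<Longrightarrow> (\<lambda>x. cnj (f x)) \<in> borel_measurable M"
  by (rule borel_measurable_continuous_on[of cnj]) (auto intro: continuous_intros)

locale fourier_kernel = rkhs_space k H ip + \<mu>: finite_measure \<mu>
  for k :: "'a::{real_inner, banach, second_countable_topology} \<Rightarrow> 'a \<Rightarrow> real" and H ip
    and \<mu> :: "'a measure" +
  assumes sets_\<mu> [measurable_cong]: "sets \<mu> = sets borel"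
    and k_fourier: "complex_of_real (k x y) = fourier \<mu> (x - y)"
begin

definition L2 :: "('a \<Rightarrow> complex) set" where
  "L2 = {g \<in> borel_measurable \<mu>. integrable \<mu> (\<lambda>s. (cmod (g s))\<^sup>2)}"

text \<open>The adjoint of the feature map for the real inner product \<open>Re (cnj a * b)\<close>
  integrated over \<open>\<mu>\<close>; taking real parts gives a real function for every
  \<open>g\<close>, Hermitian or not.\<close>

definition synth :: "('a \<Rightarrow> complex) \<Rightarrow> 'a \<Rightarrow> real" where
  "synth g x = (\<integral>s. Re (cnj (g s) * wave s x) \<partial>\<mu>)"

lemma L2_measurable [measurable_dest]: "g \<in> L2 \<Longrightarrow> g \<in> borel_measurable \<mu>"
  by (simp add: L2_def)

lemma integrable_L2: "g \<in> L2 \<Longrightarrow> integrable \<mu> (\<lambda>s. (cmod (g s))\<^sup>2)"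
  by (simp add: L2_def)

lemma L2_mult_power2:
  assumes g: "g \<in> L2" and [measurable]: "f \<in> borel_measurable \<mu>" and f: "integrable \<mu> (\<lambda>s. (f s)\<^sup>2)"
  shows integrable_L2_mult: "integrable \<mu> (\<lambda>s. cmod (g s) * \<bar>f s\<bar>)"
    and integral_L2_mult_le: "(\<integral>s. cmod (g s) * \<bar>f s\<bar> \<partial>\<mu>) \<le> sqrt (\<integral>s. (cmod (g s))\<^sup>2 \<partial>\<mu>) * sqrt (\<integral>s. (f s)\<^sup>2 \<partial>\<mu>)"
proof -
  have [measurable]: "g \<in> borel_measurable \<mu>" using g by measurable
  show "integrable \<mu> (\<lambda>s. cmod (g s) * \<bar>f s\<bar>)"
    by (rule integrable_mult_power2) (use integrable_L2[OF g] f in auto)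
  have "(\<integral>s. cmod (g s) * \<bar>f s\<bar> \<partial>\<mu>)\<^sup>2 \<le> (\<integral>s. (cmod (g s))\<^sup>2 \<partial>\<mu>) * (\<integral>s. \<bar>f s\<bar>\<^sup>2 \<partial>\<mu>)"
    by (rule Cauchy_Schwarz_integral) (use integrable_L2[OF g] f in auto)
  then show "(\<integral>s. cmod (g s) * \<bar>f s\<bar> \<partial>\<mu>) \<le> sqrt (\<integral>s. (cmod (g s))\<^sup>2 \<partial>\<mu>) * sqrt (\<integral>s. (f s)\<^sup>2 \<partial>\<mu>)"
    by (simp add: real_le_rsqrt real_sqrt_mult[symmetric])
qed

lemma integrable_norm_L2: "g \<in> L2 \<Longrightarrow> integrable \<mu> (\<lambda>s. cmod (g s))"
  using integrable_L2_mult[of g "\<lambda>_. 1"] by simp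

lemma wave_L2: "(\<lambda>s. wave s y) \<in> L2"
  by (simp add: L2_def)

lemma integrable_kernel: "integrable \<mu> (\<lambda>s. Re (cnj (wave s y) * wave s x))"
proof (rule integrable_finite_bounded[OF \<mu>.finite_measure_axioms, where c=1])
  show "norm (Re (cnj (wave s y) * wave s x)) \<le> 1" for s
    using abs_Re_le_cmod[of "cnj (wave s y) * wave s x"] by (simp add: norm_mult)
qed measurable

lemma kernel_eq: "k x y = (\<integral>s. Re (cnj (wave s y) * wave s x) \<partial>\<mu>)"
proof -
  have "integrable \<mu> (\<lambda>s. cnj (wave s y) * wave s x)"
    by (rule integrable_finite_bounded[OF \<mu>.finite_measure_axioms, where c=1]) (auto simp: norm_mult)
  then have "Re (\<integral>s. cnj (wave s y) * wave s x \<partial>\<mu>) = (\<integral>s. Re (cnj (wave s y) * wave s x) \<partial>\<mu>)"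
    by (rule integral_Re[symmetric])
  moreover have "k x y = Re (\<integral>s. cnj (wave s y) * wave s x \<partial>\<mu>)"
    using k_fourier[of x y] by (simp add: fourier_def wave_commute[of "x - y"] wave_diff complex_eq_iff)
  ultimately show ?thesis by simp
qed

lemma section_synth: "(\<lambda>x. k x y) = synth (\<lambda>s. wave s y)"
  by (simp add: fun_eq_iff kernel_eq synth_def)

text \<open>Expanding the square gives four kernel values. This is how smoothness of
  \<open>k\<close> reaches the measure \<open>\<mu>\<close>: kernel increments bound integrals of
  increments of waves.\<close>

lemma integral_wave_difference:
  "(\<integral>s. (cmod (wave s a - wave s b))\<^sup>2 \<partial>\<mu>) = k a a - k b a - k a b + k b b"
proof -
  have "(cmod (wave s a - wave s b))\<^sup>2 = Re (cnj (wave s a) * wave s a) - Re (cnj (wave s a) * wave s b)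
      - Re (cnj (wave s b) * wave s a) + Re (cnj (wave s b) * wave s b)" for s
    unfolding cmod_power2 by (simp add: power2_eq_square algebra_simps)
  then show ?thesis by (simp only: kernel_eq Bochner_Integration.integral_add Bochner_Integration.integral_diff
        integrable_kernel Bochner_Integration.integrable_diff)
qed

lemma integral_wave_second_difference:
  "(\<integral>s. (cmod (second_difference (wave s) x u v))\<^sup>2 \<partial>\<mu>)
    = second_difference (\<lambda>z. second_difference (\<lambda>w. k w z) x u v) x u v"
proof -
  have "(cmod (second_difference (wave s) x u v))\<^sup>2
      = second_difference (\<lambda>z. second_difference (\<lambda>w. Re (cnj (wave s z) * wave s w)) x u v) x u v" for s
    unfolding cmod_power2 second_difference_def by (simp add: power2_eq_square algebra_simps)
  then have "(\<integral>s. (cmod (second_difference (wave s) x u v))\<^sup>2 \<partial>\<mu>)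
      = (\<integral>s. second_difference (\<lambda>z. second_difference (\<lambda>w. Re (cnj (wave s z) * wave s w)) x u v) x u v \<partial>\<mu>)"
    by simp
  also have "\<dots> = second_difference (\<lambda>z. \<integral>s. second_difference (\<lambda>w. Re (cnj (wave s z) * wave s w)) x u v \<partial>\<mu>) x u v"
    by (intro second_difference_integral integrable_kernel)
  also have "\<dots> = second_difference (\<lambda>z. second_difference (\<lambda>w. k w z) x u v) x u v"
    by (simp only: second_difference_integral(2)[OF integrable_kernel] kernel_eq)
  finally show ?thesis .
qed

lemma integrable_norm_wave_diff_power: "integrable \<mu> (\<lambda>s. (cmod (c *\<^sub>R (wave s a - wave s b))) ^ m)"
proof (rule integrable_finite_bounded[OF \<mu>.finite_measure_axioms])
  have *: "cmod (c *\<^sub>R (wave s a - wave s b)) \<le> \<bar>c\<bar> * 2" for s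
    using norm_triangle_ineq4[of "wave s a" "wave s b"] by (simp add: mult_left_mono)
  show "norm ((cmod (c *\<^sub>R (wave s a - wave s b))) ^ m) \<le> (\<bar>c\<bar> * 2) ^ m" for s
    using power_mono[OF *[of s] norm_ge_zero, of m] by (simp add: power_abs del: norm_scaleR)
qed measurable

lemma tendsto_norm_wave_quotient_power:
  "(\<lambda>n. (cmod (real (Suc n) *\<^sub>R (wave s (0 + inverse (real (Suc n)) *\<^sub>R u) - wave s 0))) ^ m) \<longlonglongrightarrow> \<bar>inner s u\<bar> ^ m"
  using tendsto_power[OF tendsto_norm[OF wave_difference_quotient[of s 0 u]], of m] by (simp add: norm_mult)

text \<open>The hypothesis \<open>form\<close> asks for \<open>synth g \<in> H\<close> since
  membership is known where it is used: for sections, where \<open>g\<close> is a wave, and for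
  \<open>h\<close>, once it has been identified as \<open>synth \<theta>\<close>. Square
  integrability of \<open>\<theta>\<close> is what makes \<open>g = \<theta>\<close>
  admissible.\<close>

lemma representer:
  assumes lin: "\<And>f g a b. f \<in> H \<Longrightarrow> g \<in> H \<Longrightarrow> L (\<lambda>x. a * f x + b * g x) = a * L f + b * L g"
    and bdd: "\<And>f. f \<in> H \<Longrightarrow> \<bar>L f\<bar> \<le> c * nrm f"
    and \<theta>: "\<theta> \<in> L2"
    and form: "\<And>g. g \<in> L2 \<Longrightarrow> synth g \<in> H \<Longrightarrow> L (synth g) = (\<integral>s. Re (cnj (g s) * \<theta> s) \<partial>\<mu>)"
  obtains h where "h \<in> H" "\<And>f. f \<in> H \<Longrightarrow> L f = ip h f" "ip h h = (\<integral>s. (cmod (\<theta> s))\<^sup>2 \<partial>\<mu>)"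
proof -
  obtain h where h: "h \<in> H" "\<And>f. f \<in> H \<Longrightarrow> ip h f = L f"
  proof (rule Riesz_subspace[of H L "c\<^sup>2"])
    show "(L f)\<^sup>2 \<le> c\<^sup>2 * ip f f" if "f \<in> H" for f
      using power_mono[OF bdd[OF that] abs_ge_zero, of 2] by (simp add: power_mult_distrib nrm_power2 that)
  qed (use zero_in comb_in lin in auto)
  have "h y = synth \<theta> y" for y
  proof -
    have "h y = L (\<lambda>x. k x y)" using h section_in reproducing by metis
    also have "\<dots> = (\<integral>s. Re (cnj (wave s y) * \<theta> s) \<partial>\<mu>)"
      unfolding section_synth by (rule form[OF wave_L2]) (use section_in[of y] in \<open>simp add: section_synth\<close>)
    \<comment> \<open>\<open>Re (cnj a * b)\<close> is symmetric in \<open>a\<close> and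
      \<open>b\<close>, so the wave and \<open>\<theta>\<close> may exchange roles.\<close>
    also have "\<dots> = synth \<theta> y" unfolding synth_def by (simp add: mult.commute)
    finally show ?thesis .
  qed
  then have h_eq: "h = synth \<theta>" by auto
  have "ip h h = (\<integral>s. Re (cnj (\<theta> s) * \<theta> s) \<partial>\<mu>)"
    using h(2)[OF h(1)] form[OF \<theta>] h(1) unfolding h_eq by simp
  also have "\<dots> = (\<integral>s. (cmod (\<theta> s))\<^sup>2 \<partial>\<mu>)"
    unfolding cmod_power2 by (simp add: power2_eq_square)
  finally show ?thesis using that h by metis
qed

text \<open>Differentiation under the integral by dominated convergence. The weight \<open>q\<close>
  is general because it is \<open>cnj (g s)\<close> for the gradient and that times
  \<open>\<i> * inner s u\<close> for the Hessian.\<close>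

lemma synth_quotient:
  assumes [measurable]: "q \<in> borel_measurable \<mu>" and q: "integrable \<mu> (\<lambda>s. cmod (q s))"
    and qu: "integrable \<mu> (\<lambda>s. cmod (q s) * \<bar>inner s u\<bar>)"
  shows "(\<lambda>n. real (Suc n) *\<^sub>R ((\<integral>s. Re (q s * wave s (x + inverse (real (Suc n)) *\<^sub>R u)) \<partial>\<mu>) - (\<integral>s. Re (q s * wave s x) \<partial>\<mu>)))
    \<longlonglongrightarrow> (\<integral>s. Re (q s * (\<i> * complex_of_real (inner s u) * wave s x)) \<partial>\<mu>)"
proof -
  let ?w = "\<lambda>n s. real (Suc n) *\<^sub>R (wave s (x + inverse (real (Suc n)) *\<^sub>R u) - wave s x)"
  have int: "integrable \<mu> (\<lambda>s. Re (q s * wave s y))" for y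
  proof (rule Bochner_Integration.integrable_bound[OF q])
    show "AE s in \<mu>. norm (Re (q s * wave s y)) \<le> norm (cmod (q s))"
      using abs_Re_le_cmod[of "q s * wave s y" for s] by (intro AE_I2) (metis abs_norm_cancel mult.right_neutral norm_mult norm_wave real_norm_def)
  qed measurable
  have "(\<lambda>n. \<integral>s. Re (q s * ?w n s) \<partial>\<mu>) \<longlonglongrightarrow> (\<integral>s. Re (q s * (\<i> * complex_of_real (inner s u) * wave s x)) \<partial>\<mu>)"
  proof (rule integral_dominated_convergence[OF _ _ qu])
    show "AE s in \<mu>. (\<lambda>n. Re (q s * ?w n s)) \<longlonglongrightarrow> Re (q s * (\<i> * complex_of_real (inner s u) * wave s x))"
      by (intro AE_I2 tendsto_Re tendsto_mult tendsto_const wave_difference_quotient)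
    show "AE s in \<mu>. norm (Re (q s * ?w n s)) \<le> cmod (q s) * \<bar>inner s u\<bar>" for n
    proof (intro AE_I2)
      fix s
      have "norm (Re (q s * ?w n s)) \<le> cmod (q s * ?w n s)" unfolding real_norm_def by (rule abs_Re_le_cmod)
      also have "\<dots> \<le> cmod (q s) * \<bar>inner s u\<bar>"
        unfolding norm_mult by (intro mult_left_mono norm_wave_difference_quotient_le norm_ge_zero)
      finally show "norm (Re (q s * ?w n s)) \<le> cmod (q s) * \<bar>inner s u\<bar>" .
    qed
  qed measurable
  moreover have "(\<integral>s. Re (q s * ?w n s) \<partial>\<mu>)
      = real (Suc n) *\<^sub>R ((\<integral>s. Re (q s * wave s (x + inverse (real (Suc n)) *\<^sub>R u)) \<partial>\<mu>) - (\<integral>s. Re (q s * wave s x) \<partial>\<mu>))" for n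
  proof -
    have "Re (q s * ?w n s) = real (Suc n) * (Re (q s * wave s (x + inverse (real (Suc n)) *\<^sub>R u)) - Re (q s * wave s x))" for s
      by (simp add: algebra_simps del: of_nat_Suc)
    then show ?thesis
      by (simp only: integral_mult_right_zero Bochner_Integration.integral_diff[OF int int] real_scaleR_def)
  qed
  ultimately show ?thesis by simp
qed

end

section \<open>Second directional moments of the spectral measure\<close>

locale fourier_kernel_C1 = fourier_kernel + rkhs_C1
begin

text \<open>The squared difference quotient of \<open>wave s\<close> at \<open>0\<close> integrates
  to \<open>(n + 1)\<^sup>2\<close> times a kernel increment with both steps
  \<open>u / (n + 1)\<close>. The factors cancel, and Fatou gives the moment with the constant of
  the kernel bound.\<close>

lemma ex_moment2: "\<exists>M\<ge>0. \<forall>u. integrable \<mu> (\<lambda>s. (inner s u)\<^sup>2) \<and> (\<integral>s. (inner s u)\<^sup>2 \<partial>\<mu>) \<le> M * (norm u)\<^sup>2"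
proof -
  obtain M where M: "0 \<le> M" "\<And>a b y y'. \<bar>k a y - k b y - k a y' + k b y'\<bar> \<le> M * norm (a - b) * norm (y - y')"
    using Cb_1_1_increment[OF k_C1] by blast
  show ?thesis
  proof (intro exI[of _ M] conjI allI)
    fix u :: 'a
    let ?h = "\<lambda>n. inverse (real (Suc n)) *\<^sub>R u"
    have le: "(\<integral>s. (cmod (real (Suc n) *\<^sub>R (wave s (0 + ?h n) - wave s 0))) ^ 2 \<partial>\<mu>) \<le> M * (norm u)\<^sup>2" for n
    proof -
      have "(\<integral>s. (cmod (real (Suc n) *\<^sub>R (wave s (0 + ?h n) - wave s 0))) ^ 2 \<partial>\<mu>)
          = (real (Suc n))\<^sup>2 * (\<integral>s. (cmod (wave s (?h n) - wave s 0)) ^ 2 \<partial>\<mu>)"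
        by (simp only: norm_scaleR power_mult_distrib power2_abs integral_mult_right_zero add_0)
      also have "\<dots> \<le> (real (Suc n))\<^sup>2 * (M * norm (?h n) * norm (?h n))"
        using abs_le_D1[OF M(2)[of "?h n" "?h n" 0 0]] unfolding integral_wave_difference diff_zero
        by (rule mult_left_mono) simp
      also have "\<dots> = M * (real (Suc n) * (1 * norm (?h n)))\<^sup>2" by (simp only: power2_eq_square mult_ac mult_1)
      also have "\<dots> = M * (norm u)\<^sup>2" unfolding norm_scaled_step by simp
      finally show ?thesis .
    qed
    note F = Fatou_bound[OF integrable_norm_wave_diff_power _ le tendsto_norm_wave_quotient_power]
    show "integrable \<mu> (\<lambda>s. (inner s u)\<^sup>2)" "(\<integral>s. (inner s u)\<^sup>2 \<partial>\<mu>) \<le> M * (norm u)\<^sup>2"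
      using F by simp_all
  qed (use M in simp)
qed

definition m2 :: real where
  "m2 = (SOME M. 0 \<le> M \<and> (\<forall>u. integrable \<mu> (\<lambda>s. (inner s u)\<^sup>2) \<and> (\<integral>s. (inner s u)\<^sup>2 \<partial>\<mu>) \<le> M * (norm u)\<^sup>2))"

lemma m2_nonneg: "0 \<le> m2"
  and integrable_inner_power2: "integrable \<mu> (\<lambda>s. (inner s u)\<^sup>2)"
  and moment2_le: "(\<integral>s. (inner s u)\<^sup>2 \<partial>\<mu>) \<le> m2 * (norm u)\<^sup>2"
  using someI_ex[OF ex_moment2] unfolding m2_def by blast+

lemma integrable_L2_inner: "g \<in> L2 \<Longrightarrow> integrable \<mu> (\<lambda>s. cmod (g s) * \<bar>inner s u\<bar>)"
  by (intro integrable_L2_mult integrable_inner_power2) auto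

lemma integral_L2_inner_le:
  "g \<in> L2 \<Longrightarrow> (\<integral>s. cmod (g s) * \<bar>inner s u\<bar> \<partial>\<mu>) \<le> sqrt (\<integral>s. (cmod (g s))\<^sup>2 \<partial>\<mu>) * sqrt m2 * norm u"
proof -
  assume g: "g \<in> L2"
  have "sqrt (\<integral>s. (inner s u)\<^sup>2 \<partial>\<mu>) \<le> sqrt m2 * norm u"
    using real_sqrt_le_mono[OF moment2_le[of u]] by (simp add: real_sqrt_mult)
  then have "sqrt (\<integral>s. (cmod (g s))\<^sup>2 \<partial>\<mu>) * sqrt (\<integral>s. (inner s u)\<^sup>2 \<partial>\<mu>)
      \<le> sqrt (\<integral>s. (cmod (g s))\<^sup>2 \<partial>\<mu>) * (sqrt m2 * norm u)"
    by (intro mult_left_mono) auto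
  moreover have "(\<integral>s. cmod (g s) * \<bar>inner s u\<bar> \<partial>\<mu>)
      \<le> sqrt (\<integral>s. (cmod (g s))\<^sup>2 \<partial>\<mu>) * sqrt (\<integral>s. (inner s u)\<^sup>2 \<partial>\<mu>)"
    by (intro integral_L2_mult_le g integrable_inner_power2) auto
  ultimately show ?thesis by (simp add: mult.assoc)
qed

lemma inner_grad_synth:
  assumes g: "g \<in> L2" and H: "synth g \<in> H"
  shows "inner u (grad (synth g) x) = (\<integral>s. Re (cnj (g s) * (\<i> * complex_of_real (inner s u) * wave s x)) \<partial>\<mu>)"
proof (rule LIMSEQ_unique[OF has_derivative_difference_quotient[OF has_derivative_grad_H[OF H]]])
  have [measurable]: "g \<in> borel_measurable \<mu>" using g by measurable
  show "(\<lambda>n. real (Suc n) *\<^sub>R (synth g (x + inverse (real (Suc n)) *\<^sub>R u) - synth g x))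
      \<longlonglongrightarrow> (\<integral>s. Re (cnj (g s) * (\<i> * complex_of_real (inner s u) * wave s x)) \<partial>\<mu>)"
    unfolding synth_def
    by (rule synth_quotient) (use integrable_norm_L2[OF g] integrable_L2_inner[OF g] in auto)
qed

end

section \<open>Fourth directional moments of the spectral measure\<close>

locale fourier_kernel_C2 = fourier_kernel + rkhs_C2
begin

sublocale fourier_kernel_C1 by unfold_locales

text \<open>For equal steps \<open>h\<close> the second difference of a wave at \<open>0\<close> is
  \<open>(wave s h - 1)\<^sup>2\<close>, so fourth powers of first differences are squared norms of
  second differences, which the kernel controls.\<close>

lemma ex_moment4: "\<exists>M\<ge>0. \<forall>u. integrable \<mu> (\<lambda>s. (inner s u)^4) \<and> (\<integral>s. (inner s u)^4 \<partial>\<mu>) \<le> M * (norm u)^4"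
proof -
  obtain M where M: "0 \<le> M"
    "\<And>x y u v. \<bar>second_difference (\<lambda>z. second_difference (\<lambda>w. k w z) x u v) y u v\<bar> \<le> M * (norm u * norm v)\<^sup>2"
    using Cb_2_2_increment[OF k_C2] by blast
  show ?thesis
  proof (intro exI[of _ M] conjI allI)
    fix u :: 'a
    let ?h = "\<lambda>n. inverse (real (Suc n)) *\<^sub>R u"
    have le: "(\<integral>s. (cmod (real (Suc n) *\<^sub>R (wave s (0 + ?h n) - wave s 0))) ^ 4 \<partial>\<mu>) \<le> M * (norm u)^4" for n
    proof -
      have "(cmod (wave s (?h n) - wave s 0)) ^ 4 = (cmod (second_difference (wave s) 0 (?h n) (?h n)))\<^sup>2" for s
      proof -
        have "second_difference (wave s) 0 (?h n) (?h n) = (wave s (?h n) - wave s 0)\<^sup>2"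
          unfolding second_difference_def wave_add by (simp add: power2_eq_square algebra_simps del: of_nat_Suc)
        then show ?thesis by (simp add: norm_power del: of_nat_Suc)
      qed
      then have "(\<integral>s. (cmod (real (Suc n) *\<^sub>R (wave s (0 + ?h n) - wave s 0))) ^ 4 \<partial>\<mu>)
          = (real (Suc n))^4 * (\<integral>s. (cmod (second_difference (wave s) 0 (?h n) (?h n)))\<^sup>2 \<partial>\<mu>)"
        by (simp only: norm_scaleR power_mult_distrib abs_of_nat integral_mult_right_zero add_0)
      also have "\<dots> \<le> (real (Suc n))^4 * (M * (norm (?h n) * norm (?h n))\<^sup>2)"
        using M(2)[of 0 "?h n" "?h n" 0] unfolding integral_wave_second_difference
        by (intro mult_left_mono) (simp_all add: abs_le_iff del: of_nat_Suc)
      also have "\<dots> = M * (real (Suc n) * (1 * norm (?h n)))^4"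
        by (simp only: power2_eq_square power4_eq_xxxx mult_ac mult_1)
      also have "\<dots> = M * (norm u)^4" unfolding norm_scaled_step by simp
      finally show ?thesis .
    qed
    note F = Fatou_bound[OF integrable_norm_wave_diff_power _ le tendsto_norm_wave_quotient_power]
    show "integrable \<mu> (\<lambda>s. (inner s u)^4)" "(\<integral>s. (inner s u)^4 \<partial>\<mu>) \<le> M * (norm u)^4"
      using F by simp_all
  qed (use M in simp)
qed

definition m4 :: real where
  "m4 = (SOME M. 0 \<le> M \<and> (\<forall>u. integrable \<mu> (\<lambda>s. (inner s u)^4) \<and> (\<integral>s. (inner s u)^4 \<partial>\<mu>) \<le> M * (norm u)^4))"

lemma m4_nonneg: "0 \<le> m4"
  and integrable_inner_power4: "integrable \<mu> (\<lambda>s. (inner s u)^4)"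
  and moment4_le: "(\<integral>s. (inner s u)^4 \<partial>\<mu>) \<le> m4 * (norm u)^4"
  using someI_ex[OF ex_moment4] unfolding m4_def by blast+

lemma integrable_L2_inner_power2: "g \<in> L2 \<Longrightarrow> integrable \<mu> (\<lambda>s. cmod (g s) * (inner s u)\<^sup>2)"
  using integrable_L2_mult[of g "\<lambda>s. (inner s u)\<^sup>2"] integrable_inner_power4[of u]
  by (simp add: power_mult[symmetric])

lemma integral_L2_inner_power2_le:
  assumes g: "g \<in> L2"
  shows "(\<integral>s. cmod (g s) * (inner s u)\<^sup>2 \<partial>\<mu>) \<le> sqrt (\<integral>s. (cmod (g s))\<^sup>2 \<partial>\<mu>) * sqrt m4 * (norm u)\<^sup>2"
proof -
  have "(\<integral>s. ((inner s u)\<^sup>2)\<^sup>2 \<partial>\<mu>) \<le> m4 * ((norm u)\<^sup>2)\<^sup>2"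
    using moment4_le[of u] by (simp add: power_mult[symmetric])
  from real_sqrt_le_mono[OF this]
  have "sqrt (\<integral>s. ((inner s u)\<^sup>2)\<^sup>2 \<partial>\<mu>) \<le> sqrt m4 * (norm u)\<^sup>2"
    by (simp only: real_sqrt_mult real_sqrt_abs abs_power2)
  then have "sqrt (\<integral>s. (cmod (g s))\<^sup>2 \<partial>\<mu>) * sqrt (\<integral>s. ((inner s u)\<^sup>2)\<^sup>2 \<partial>\<mu>)
      \<le> sqrt (\<integral>s. (cmod (g s))\<^sup>2 \<partial>\<mu>) * (sqrt m4 * (norm u)\<^sup>2)"
    by (intro mult_left_mono) auto
  moreover have "(\<integral>s. cmod (g s) * \<bar>(inner s u)\<^sup>2\<bar> \<partial>\<mu>)
      \<le> sqrt (\<integral>s. (cmod (g s))\<^sup>2 \<partial>\<mu>) * sqrt (\<integral>s. ((inner s u)\<^sup>2)\<^sup>2 \<partial>\<mu>)"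
    using integrable_inner_power4[of u]
    by (intro integral_L2_mult_le g) (auto simp: power_mult[symmetric])
  ultimately show ?thesis by (simp add: mult.assoc)
qed

text \<open>Equal directions on both sides are enough, because \<open>op_trace_C\<close> expresses
  the trace as an integral of this quadratic form.\<close>

lemma inner_hess_synth:
  assumes g: "g \<in> L2" and H: "synth g \<in> H"
  shows "inner u (hess (synth g) x u) = (\<integral>s. - ((inner s u)\<^sup>2 * Re (cnj (g s) * wave s x)) \<partial>\<mu>)"
proof -
  have [measurable]: "g \<in> borel_measurable \<mu>" using g by measurable
  have "((\<lambda>y. inner u (grad (synth g) y)) has_derivative (\<lambda>v. inner u (hess (synth g) x v))) (at x)"
    by (intro bounded_linear.has_derivative[OF bounded_linear_inner_right] has_derivative_hess H)
  note quotient = has_derivative_difference_quotient[OF this, of u]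
  have eq: "inner u (grad (synth g) y) = (\<integral>s. Re (cnj (g s) * (\<i> * complex_of_real (inner s u)) * wave s y) \<partial>\<mu>)" for y
    by (simp only: inner_grad_synth[OF g H] mult.assoc)
  have "(\<lambda>n. real (Suc n) *\<^sub>R (inner u (grad (synth g) (x + inverse (real (Suc n)) *\<^sub>R u)) - inner u (grad (synth g) x)))
    \<longlonglongrightarrow> (\<integral>s. Re (cnj (g s) * (\<i> * complex_of_real (inner s u)) * (\<i> * complex_of_real (inner s u) * wave s x)) \<partial>\<mu>)"
    unfolding eq
  proof (rule synth_quotient)
    show "integrable \<mu> (\<lambda>s. cmod (cnj (g s) * (\<i> * complex_of_real (inner s u))))"
      using integrable_L2_inner[OF g] by (simp add: norm_mult)
    have "cmod (cnj (g s) * (\<i> * complex_of_real (inner s u))) * \<bar>inner s u\<bar> = cmod (g s) * (inner s u)\<^sup>2" for s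
      by (simp add: norm_mult power2_eq_square mult.assoc)
    then show "integrable \<mu> (\<lambda>s. cmod (cnj (g s) * (\<i> * complex_of_real (inner s u))) * \<bar>inner s u\<bar>)"
      using integrable_L2_inner_power2[OF g] by simp
  qed measurable
  with quotient have "inner u (hess (synth g) x u)
    = (\<integral>s. Re (cnj (g s) * (\<i> * complex_of_real (inner s u)) * (\<i> * complex_of_real (inner s u) * wave s x)) \<partial>\<mu>)"
    by (rule LIMSEQ_unique)
  also have "\<dots> = (\<integral>s. - ((inner s u)\<^sup>2 * Re (cnj (g s) * wave s x)) \<partial>\<mu>)"
    by (intro Bochner_Integration.integral_cong refl) (simp add: power2_eq_square algebra_simps)
  finally show ?thesis .
qed

end

section \<open>The scalar discrepancy\<close>

lemma borel_measurable_grad: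
  fixes f :: "'a::{real_inner, banach, second_countable_topology} \<Rightarrow> real"
  assumes "\<And>x. f differentiable (at x)"
  shows "grad f \<in> borel_measurable borel"
proof (rule borel_measurable_weak)
  fix v
  have "continuous_on UNIV f"
    using assms by (intro continuous_at_imp_continuous_on ballI differentiable_imp_continuous_within)
  then have [measurable]: "f \<in> borel_measurable borel" by (rule borel_measurable_continuous_onI)
  show "(\<lambda>x. inner (grad f x) v) \<in> borel_measurable borel"
  proof (rule borel_measurable_LIMSEQ_real)
    show "(\<lambda>n. real (Suc n) *\<^sub>R (f (x + inverse (real (Suc n)) *\<^sub>R v) - f x)) \<longlonglongrightarrow> inner (grad f x) v" for x
      using has_derivative_difference_quotient[OF has_derivative_grad[OF assms], of x v] by (simp add: inner_commute)
  qed measurable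
qed

lemma norm_Re_le: "norm (Re z) \<le> cmod z"
  by (simp add: abs_Re_le_cmod)

lemma ennreal_SUP_power2_le:
  fixes R :: ennreal
  assumes "\<And>x. x \<in> X \<Longrightarrow> (f x)\<^sup>2 \<le> R"
  shows "(SUP x\<in>X. f x)\<^sup>2 \<le> R"
proof (cases R)
  case (real r)
  have "f x \<le> ennreal (sqrt r)" if "x \<in> X" for x
  proof (cases "f x")
    case (real a)
    have "ennreal (a\<^sup>2) \<le> ennreal r" using assms[OF that] real \<open>R = ennreal r\<close> by (simp add: ennreal_power)
    then have "a\<^sup>2 \<le> r" using \<open>0 \<le> r\<close> by simp
    then show ?thesis using real by (simp add: ennreal_leI real_le_rsqrt)
  next
    case top
    then show ?thesis using assms[OF that] real by (simp add: top_unique)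
  qed
  then have "(SUP x\<in>X. f x) \<le> ennreal (sqrt r)" by (rule SUP_least)
  then have "(SUP x\<in>X. f x)\<^sup>2 \<le> (ennreal (sqrt r))\<^sup>2" by (rule power_mono) simp
  then show ?thesis using real by (simp add: ennreal_power)
qed simp

lemma grad_cos_inner: "grad (\<lambda>x. cos (inner s x)) = (\<lambda>x. (- sin (inner s x)) *\<^sub>R s)"
  by (intro ext grad_eqI) (auto simp: gderiv_def inner_commute intro!: derivative_eq_intros)

lemma grad_sin_inner: "grad (\<lambda>x. sin (inner s x)) = (\<lambda>x. cos (inner s x) *\<^sub>R s)"
  by (intro ext grad_eqI) (auto simp: gderiv_def inner_commute intro!: derivative_eq_intros)

lemma hess_cos_inner: "hess (\<lambda>x. cos (inner s x)) x = (\<lambda>h. (- cos (inner s x) * inner s h) *\<^sub>R s)"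
  unfolding hess_def grad_cos_inner
  by (rule frechet_derivative_at[symmetric]) (auto intro!: derivative_eq_intros)

lemma hess_sin_inner: "hess (\<lambda>x. sin (inner s x)) x = (\<lambda>h. (- sin (inner s x) * inner s h) *\<^sub>R s)"
  unfolding hess_def grad_sin_inner
  by (rule frechet_derivative_at[symmetric]) (auto intro!: derivative_eq_intros)

lemma Re_wave: "Re (wave s x) = cos (inner s x)" and Im_wave: "Im (wave s x) = sin (inner s x)"
  by (simp_all add: wave_eq_cis)

section \<open>The Stein operator on plane waves\<close>

locale stein_setting = gaussian_space C N + Q: prob_space Q
  for C :: "'a::{real_inner, banach, second_countable_topology} \<Rightarrow>\<^sub>L 'a" and N and Q :: "'a measure" +
  fixes U :: "'a \<Rightarrow> real"
  assumes sets_Q [measurable_cong]: "sets Q = sets borel"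
    and U_differentiable: "U differentiable (at x)"
    and Q_moment: "integrable Q (\<lambda>x. (norm x)\<^sup>2)"
    and Q_grad: "integrable Q (\<lambda>x. norm (blinfun_apply C (grad U x)))"
begin

text \<open>The first-order coefficient common to all Stein operators. The assumptions on
  \<open>Q\<close> give it a first moment, not a second.\<close>

definition Y :: "'a \<Rightarrow> 'a" where "Y x = x + blinfun_apply C (grad U x)"

lemma C_measurable [measurable]: "blinfun_apply C \<in> borel_measurable borel"
  by (intro borel_measurable_continuous_onI linear_continuous_on blinfun.bounded_linear_right)

lemma measurable_Y [measurable]: "Y \<in> borel_measurable borel"
proof -
  have [measurable]: "grad U \<in> borel_measurable borel" by (intro borel_measurable_grad U_differentiable)
  show ?thesis unfolding Y_def by measurable
qed

lemma integrable_norm_Y: "integrable Q (\<lambda>x. norm (Y x))"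
proof (rule Bochner_Integration.integrable_bound)
  show "integrable Q (\<lambda>x. (1 + (norm x)\<^sup>2) + norm (blinfun_apply C (grad U x)))"
    using Q_moment Q_grad by simp
  show "AE x in Q. norm (norm (Y x)) \<le> norm ((1 + (norm x)\<^sup>2) + norm (blinfun_apply C (grad U x)))"
  proof (intro AE_I2)
    fix x :: 'a
    have "0 \<le> (norm x - 1)\<^sup>2" by simp
    then have "norm x \<le> 1 + (norm x)\<^sup>2" by (simp add: power2_diff) (smt (verit) norm_ge_zero)
    then show "norm (norm (Y x)) \<le> norm ((1 + (norm x)\<^sup>2) + norm (blinfun_apply C (grad U x)))"
      unfolding Y_def using norm_triangle_ineq[of x "blinfun_apply C (grad U x)"] by simp
  qed
qed measurable

lemma integrable_inner_Y: "integrable Q (\<lambda>x. inner v (Y x))"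
proof (rule Bochner_Integration.integrable_bound[OF integrable_mult_right[OF integrable_norm_Y, of "norm v"]])
  show "AE x in Q. norm (inner v (Y x)) \<le> norm (norm v * norm (Y x))"
    by (intro AE_I2) (simp add: Cauchy_Schwarz_ineq2)
qed measurable

text \<open>The trace of \<open>C\<close> in any orthonormal basis, by
  \<open>has_sum_N_norm_sq\<close>.\<close>

abbreviation trC :: real where "trC \<equiv> \<integral>z. (norm z)\<^sup>2 \<partial>N"

lemma abs_integral_N_quadratic_le:
  assumes "\<And>z. norm (T z) \<le> c * norm z"
  shows "\<bar>\<integral>z. inner (T z) z \<partial>N\<bar> \<le> c * trC"
proof -
  have "norm (\<integral>z. inner (T z) z \<partial>N) \<le> (\<integral>z. c * (norm z)\<^sup>2 \<partial>N)"
  proof (rule norm_integral_le)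
    fix z
    have "norm (inner (T z) z) \<le> norm (T z) * norm z" by (simp add: Cauchy_Schwarz_ineq2)
    also have "\<dots> \<le> (c * norm z) * norm z" using assms by (intro mult_right_mono) auto
    finally show "norm (inner (T z) z) \<le> c * (norm z)\<^sup>2" by (simp add: power2_eq_square mult.assoc)
  qed (simp add: integrable_N_norm_sq)
  then show ?thesis by simp
qed

text \<open>The Hessian of a plane wave is \<open>- wave s x\<close> times the rank-one operator
  \<open>h \<mapsto> inner s h *\<^sub>R s\<close>, so its trace against \<open>C\<close> is a
  multiple of \<open>inner (C s) s\<close>.\<close>

lemma stein_op_complex_wave:
  "stein_op_complex C U (wave s) x
    = - (complex_of_real (inner (blinfun_apply C s) s) + \<i> * complex_of_real (inner s (Y x))) * wave s x"
proof -
  have bl: "bounded_linear (\<lambda>h. (c * inner s h) *\<^sub>R s)" for c :: real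
    by (intro bounded_linear_scaleR_const bounded_linear_const_mult bounded_linear_inner_right)
  have tr: "op_trace (\<lambda>h. blinfun_apply C ((c * inner s h) *\<^sub>R s)) = c * inner (blinfun_apply C s) s" for c
  proof -
    have "op_trace (\<lambda>h. blinfun_apply C ((c * inner s h) *\<^sub>R s)) = (\<integral>z. c * (inner s z * inner s z) \<partial>N)"
      by (subst op_trace_C[OF bl]) (simp add: mult.assoc)
    then show ?thesis by (simp add: integral_N_inner)
  qed
  have 1: "stein_op C U (\<lambda>y. Re (wave s y)) x = - cos (inner s x) * inner (blinfun_apply C s) s + sin (inner s x) * inner s (Y x)"
    unfolding Re_wave stein_op_def grad_cos_inner hess_cos_inner tr Y_def by (simp add: inner_commute)
  have 2: "stein_op C U (\<lambda>y. Im (wave s y)) x = - sin (inner s x) * inner (blinfun_apply C s) s - cos (inner s x) * inner s (Y x)"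
    unfolding Im_wave stein_op_def grad_sin_inner hess_sin_inner tr Y_def by (simp add: inner_commute)
  show ?thesis
    unfolding stein_op_complex_def 1 2 by (simp add: complex_eq_iff Re_wave Im_wave mult.commute)
qed

end

locale stein_kernel = stein_setting C N Q U + fourier_kernel k H ip \<mu>
  for C :: "'a::{real_inner, banach, second_countable_topology} \<Rightarrow>\<^sub>L 'a" and N Q U
    and k :: "'a \<Rightarrow> 'a \<Rightarrow> real" and H ip \<mu>
begin

text \<open>Fubini between \<open>Q\<close> and \<open>\<mu>\<close>, stated for a general symbol
  \<open>A\<close> so that both Stein operators can use it; the bound \<open>b\<close> on the inner
  integrals supplies joint integrability.\<close>

lemma integral_Q_synth:
  assumes g: "g \<in> L2" and A[measurable]: "case_prod A \<in> borel_measurable (\<mu> \<Otimes>\<^sub>M Q)"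
    and AQ: "\<And>s. integrable Q (A s)"
    and A\<mu>: "\<And>x. integrable \<mu> (\<lambda>s. cmod (g s) * cmod (A s x))"
    and b: "\<And>x. (\<integral>s. cmod (g s) * cmod (A s x) \<partial>\<mu>) \<le> b x" "integrable Q b"
  shows "(\<integral>x. (\<integral>s. Re (cnj (g s) * A s x) \<partial>\<mu>) \<partial>Q) = (\<integral>s. Re (cnj (g s) * (\<integral>x. A s x \<partial>Q)) \<partial>\<mu>)"
proof -
  have gm[measurable]: "g \<in> borel_measurable \<mu>" using g by measurable
  have A'[measurable]: "(\<lambda>(x, s). A s x) \<in> borel_measurable (Q \<Otimes>\<^sub>M \<mu>)"
    using measurable_pair_swap[OF A] by (simp add: case_prod_beta)
  have norm_le: "norm (Re (cnj (g s) * A s x)) \<le> cmod (g s) * cmod (A s x)" for s x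
    using norm_Re_le[of "cnj (g s) * A s x"] by (simp add: norm_mult)
  have Ax[measurable]: "(\<lambda>s. A s x) \<in> borel_measurable \<mu>" for x
    using measurable_compose[OF measurable_Pair2'[of x Q \<mu>] A] sets_eq_imp_space_eq[OF sets_Q] by simp
  have "(\<integral>x. (\<integral>s. Re (cnj (g s) * A s x) \<partial>\<mu>) \<partial>Q) = (\<integral>s. (\<integral>x. Re (cnj (g s) * A s x) \<partial>Q) \<partial>\<mu>)"
  proof (rule sigma_finite_pair_Fubini[OF Q.sigma_finite_measure_axioms \<mu>.sigma_finite_measure_axioms _ _ _ b(2)])
    show "integrable \<mu> (\<lambda>s. Re (cnj (g s) * A s x))" for x
      by (rule Bochner_Integration.integrable_bound[OF A\<mu>[of x]]) (use norm_le in \<open>auto intro!: AE_I2\<close>)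
    show "(\<integral>s. norm (Re (cnj (g s) * A s x)) \<partial>\<mu>) \<le> b x" for x
    proof -
      have "norm (\<integral>s. norm (Re (cnj (g s) * A s x)) \<partial>\<mu>) \<le> (\<integral>s. cmod (g s) * cmod (A s x) \<partial>\<mu>)"
        using norm_le by (intro norm_integral_le A\<mu>) simp
      then show ?thesis using b(1)[of x] by simp
    qed
  qed measurable
  also have "\<dots> = (\<integral>s. Re (cnj (g s) * (\<integral>x. A s x \<partial>Q)) \<partial>\<mu>)"
    using AQ by (intro Bochner_Integration.integral_cong refl) (subst integral_Re, auto)
  finally show ?thesis .
qed

end

locale stein_kernel_C2 = stein_kernel + fourier_kernel_C2
begin

lemma stein_op_H:
  "f \<in> H \<Longrightarrow> stein_op C U f x = (\<integral>z. inner (hess f x z) z \<partial>N) - inner (grad f x) (Y x)"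
  unfolding stein_op_def Y_def
  using op_trace_C[OF has_derivative_bounded_linear[OF has_derivative_hess]] by simp

lemma abs_stein_op_le: "f \<in> H \<Longrightarrow> \<bar>stein_op C U f x\<bar> \<le> (lip2 * trC + lip * norm (Y x)) * nrm f"
proof -
  assume f: "f \<in> H"
  have "\<bar>\<integral>z. inner (hess f x z) z \<partial>N\<bar> \<le> (lip2 * nrm f) * trC"
    by (rule abs_integral_N_quadratic_le) (rule norm_hess_le[OF f])
  moreover have "\<bar>inner (grad f x) (Y x)\<bar> \<le> lip * nrm f * norm (Y x)"
    using inner_grad_le[OF f, of "Y x" x] by (simp add: inner_commute)
  ultimately show ?thesis unfolding stein_op_H[OF f] by (simp add: algebra_simps)
qed

lemma integrable_stein_op:
  assumes f: "f \<in> H"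
  shows "integrable Q (stein_op C U f)"
proof -
  have "continuous_on UNIV (grad f)"
    by (intro continuous_at_imp_continuous_on ballI differentiable_imp_continuous_within differentiable_grad f)
  then have [measurable]: "grad f \<in> borel_measurable borel" by (rule borel_measurable_continuous_onI)
  \<comment> \<open>Continuity of the Hessian in \<open>x\<close> has not been established; joint
    measurability in point and direction comes from difference quotients of the continuous
    gradient.\<close>
  have [measurable]: "(\<lambda>p. hess f (fst p) (snd p)) \<in> borel_measurable (Q \<Otimes>\<^sub>M N)"
  proof (rule borel_measurable_LIMSEQ_metric)
    show "(\<lambda>n. real (Suc n) *\<^sub>R (grad f (fst p + inverse (real (Suc n)) *\<^sub>R snd p) - grad f (fst p))) \<longlonglongrightarrow> hess f (fst p) (snd p)" for p
      by (rule has_derivative_difference_quotient[OF has_derivative_hess[OF f]])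
  qed measurable
  have [measurable]: "(\<lambda>x. \<integral>z. inner (hess f x z) z \<partial>N) \<in> borel_measurable Q"
    by (rule N.borel_measurable_lebesgue_integral) (simp add: case_prod_beta)
  show ?thesis
  proof (rule Bochner_Integration.integrable_bound)
    show "integrable Q (\<lambda>x. (lip2 * trC + lip * norm (Y x)) * nrm f)"
      by (simp add: integrable_norm_Y)
    show "AE x in Q. norm (stein_op C U f x) \<le> norm ((lip2 * trC + lip * norm (Y x)) * nrm f)"
      using abs_stein_op_le[OF f] by (intro AE_I2) (smt (verit) real_norm_def)
    show "stein_op C U f \<in> borel_measurable Q" unfolding stein_op_H[OF f, abs_def] by measurable
  qed
qed

lemma stein_op_comb:
  assumes "f \<in> H" "g \<in> H"
  shows "stein_op C U (\<lambda>x. a * f x + b * g x) x = a * stein_op C U f x + b * stein_op C U g x"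
proof -
  have int: "integrable N (\<lambda>z. inner (hess f x z) z)" if "f \<in> H" for f
    by (intro integrable_N_quadratic has_derivative_bounded_linear[OF has_derivative_hess] that)
  show ?thesis
    by (simp add: stein_op_H comb_in assms hess_comb grad_comb inner_add_left int algebra_simps)
qed

definition \<theta> :: "'a \<Rightarrow> complex" where "\<theta> s = (\<integral>x. stein_op_complex C U (wave s) x \<partial>Q)"

lemma stein_wave_measurable [measurable]:
  "(\<lambda>(s, x). stein_op_complex C U (wave s) x) \<in> borel_measurable (\<mu> \<Otimes>\<^sub>M Q)"
  unfolding stein_op_complex_wave by measurable

lemma norm_stein_wave_le:
  "cmod (stein_op_complex C U (wave s) x) \<le> inner (blinfun_apply C s) s + \<bar>inner s (Y x)\<bar>"
proof -
  have "cmod (stein_op_complex C U (wave s) x)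
      = cmod (complex_of_real (inner (blinfun_apply C s) s) + \<i> * complex_of_real (inner s (Y x)))"
    unfolding stein_op_complex_wave norm_mult norm_wave norm_minus_cancel by simp
  also have "\<dots> \<le> inner (blinfun_apply C s) s + \<bar>inner s (Y x)\<bar>"
    by (rule order_trans[OF norm_triangle_ineq]) (simp add: norm_mult C_pos)
  finally show ?thesis .
qed

lemma integrable_stein_wave: "integrable Q (stein_op_complex C U (wave s))"
proof (rule Bochner_Integration.integrable_bound)
  show "integrable Q (\<lambda>x. inner (blinfun_apply C s) s + \<bar>inner s (Y x)\<bar>)"
    using integrable_inner_Y by simp
  show "AE x in Q. norm (stein_op_complex C U (wave s) x) \<le> norm (inner (blinfun_apply C s) s + \<bar>inner s (Y x)\<bar>)"
    using norm_stein_wave_le C_pos by (intro AE_I2) simp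
  show "stein_op_complex C U (wave s) \<in> borel_measurable Q"
    unfolding stein_op_complex_wave[abs_def] by measurable
qed

text \<open>\<open>inner (C s) s\<close> is the \<open>N\<close>-integral of
  \<open>(inner s z)\<^sup>2\<close>. With weight \<open>(norm z)\<^sup>2\<close> the claim reduces
  to fourth directional moments of \<open>\<mu>\<close> and the finite trace of \<open>C\<close>, so
  no moment of \<open>norm s\<close> appears.\<close>

lemma integrable_inner_C_power2: "integrable \<mu> (\<lambda>s. (inner (blinfun_apply C s) s)\<^sup>2)"
proof -
  have "integrable \<mu> (\<lambda>s. (\<integral>z. (inner s z)\<^sup>2 \<partial>N)\<^sup>2)"
  proof (rule integrable_power2_integral[where \<rho>="\<lambda>z. (norm z)\<^sup>2", OF \<mu>.sigma_finite_measure_axioms N.sigma_finite_measure_axioms])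
    show "integrable \<mu> (\<lambda>s. ((inner s z)\<^sup>2)\<^sup>2)" for z
      using integrable_inner_power4[of z] by (simp add: power_mult[symmetric])
    show "(\<integral>s. ((inner s z)\<^sup>2)\<^sup>2 \<partial>\<mu>) \<le> m4 * ((norm z)\<^sup>2)\<^sup>2" for z
      using moment4_le[of z] by (simp add: power_mult[symmetric])
  qed (use integrable_N_norm_sq m4_nonneg in auto)
  then show ?thesis by (simp add: integral_N_inner_sq)
qed

text \<open>The weight \<open>norm (Y x)\<close> costs only the first moment of \<open>Y\<close>
  under \<open>Q\<close>, although the claim is about squares: the integral over \<open>Q\<close>
  stands inside the square.\<close>

lemma integrable_abs_inner_Y_power2: "integrable \<mu> (\<lambda>s. (\<integral>x. \<bar>inner s (Y x)\<bar> \<partial>Q)\<^sup>2)"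
proof (rule integrable_power2_integral[where \<rho>="\<lambda>x. norm (Y x)", OF \<mu>.sigma_finite_measure_axioms Q.sigma_finite_measure_axioms])
  show "integrable \<mu> (\<lambda>s. \<bar>inner s (Y x)\<bar>\<^sup>2)" for x using integrable_inner_power2 by simp
  show "(\<integral>s. \<bar>inner s (Y x)\<bar>\<^sup>2 \<partial>\<mu>) \<le> m2 * (norm (Y x))\<^sup>2" for x using moment2_le by simp
qed (use integrable_norm_Y m2_nonneg in auto)

lemma \<theta>_L2: "\<theta> \<in> L2"
proof -
  have [measurable]: "\<theta> \<in> borel_measurable \<mu>"
    unfolding \<theta>_def by (rule Q.borel_measurable_lebesgue_integral) measurable
  have [measurable]: "(\<lambda>s. \<integral>x. \<bar>inner s (Y x)\<bar> \<partial>Q) \<in> borel_measurable \<mu>"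
    by (rule Q.borel_measurable_lebesgue_integral) measurable
  have "integrable \<mu> (\<lambda>s. (cmod (\<theta> s))\<^sup>2)"
  proof (rule Bochner_Integration.integrable_bound)
    show "integrable \<mu> (\<lambda>s. 2 * (inner (blinfun_apply C s) s)\<^sup>2 + 2 * (\<integral>x. \<bar>inner s (Y x)\<bar> \<partial>Q)\<^sup>2)"
      using integrable_inner_C_power2 integrable_abs_inner_Y_power2 by simp
    show "AE s in \<mu>. norm ((cmod (\<theta> s))\<^sup>2) \<le> norm (2 * (inner (blinfun_apply C s) s)\<^sup>2 + 2 * (\<integral>x. \<bar>inner s (Y x)\<bar> \<partial>Q)\<^sup>2)"
    proof (intro AE_I2)
      fix s
      let ?a = "inner (blinfun_apply C s) s" and ?b = "\<integral>x. \<bar>inner s (Y x)\<bar> \<partial>Q"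
      have "cmod (\<theta> s) \<le> (\<integral>x. ?a + \<bar>inner s (Y x)\<bar> \<partial>Q)"
        unfolding \<theta>_def by (intro norm_integral_le norm_stein_wave_le) (use integrable_inner_Y in simp)
      also have "\<dots> = ?a + ?b" using integrable_inner_Y by (simp add: Q.prob_space)
      finally have "(cmod (\<theta> s))\<^sup>2 \<le> (?a + ?b)\<^sup>2" by (rule power_mono) simp
      also have "\<dots> \<le> 2 * ?a\<^sup>2 + 2 * ?b\<^sup>2"
        using zero_le_power2[of "?a - ?b"] by (simp add: power2_sum power2_diff)
      finally show "norm ((cmod (\<theta> s))\<^sup>2) \<le> norm (2 * ?a\<^sup>2 + 2 * ?b\<^sup>2)" by simp
    qed
  qed measurable
  then show ?thesis by (simp add: L2_def)
qed

lemma integrable_L2_inner_C: "g \<in> L2 \<Longrightarrow> integrable \<mu> (\<lambda>s. cmod (g s) * inner (blinfun_apply C s) s)"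
  using integrable_L2_mult[OF _ _ integrable_inner_C_power2] by (simp add: C_pos)

text \<open>The Hessian part needs Fubini between \<open>N\<close> and \<open>\<mu>\<close>:
  integrating \<open>(inner s z)\<^sup>2\<close> over \<open>N\<close> turns the quadratic form into
  \<open>inner (C s) s\<close>. The fourth directional moments, through \<open>m4\<close>, justify
  the exchange.\<close>

lemma stein_op_synth:
  assumes g: "g \<in> L2" and H: "synth g \<in> H"
  shows "stein_op C U (synth g) x = (\<integral>s. Re (cnj (g s) * stein_op_complex C U (wave s) x) \<partial>\<mu>)"
proof -
  have gm[measurable]: "g \<in> borel_measurable \<mu>" using g by measurable
  have norm_le: "norm (- ((inner s z)\<^sup>2 * Re (cnj (g s) * wave s x))) \<le> cmod (g s) * (inner s z)\<^sup>2" for s z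
    using mult_right_mono[OF norm_Re_le[of "cnj (g s) * wave s x"] zero_le_power2[of "inner s z"]]
    by (simp add: norm_mult abs_mult mult.commute)
  have *: "(\<integral>z. (\<integral>s. - ((inner s z)\<^sup>2 * Re (cnj (g s) * wave s x)) \<partial>\<mu>) \<partial>N)
      = (\<integral>s. (\<integral>z. - ((inner s z)\<^sup>2 * Re (cnj (g s) * wave s x)) \<partial>N) \<partial>\<mu>)"
    "integrable \<mu> (\<lambda>s. \<integral>z. - ((inner s z)\<^sup>2 * Re (cnj (g s) * wave s x)) \<partial>N)"
  proof (rule_tac [!] sigma_finite_pair_Fubini[OF N.sigma_finite_measure_axioms \<mu>.sigma_finite_measure_axioms,
        where b="\<lambda>z. sqrt (\<integral>s. (cmod (g s))\<^sup>2 \<partial>\<mu>) * sqrt m4 * (norm z)\<^sup>2"])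
    show "integrable \<mu> (\<lambda>s. - ((inner s z)\<^sup>2 * Re (cnj (g s) * wave s x)))" for z
      by (rule Bochner_Integration.integrable_bound[OF integrable_L2_inner_power2[OF g, of z]])
         (use norm_le in \<open>auto intro!: AE_I2 simp del: norm_minus_cancel\<close>)
    then show "integrable \<mu> (\<lambda>s. - ((inner s z)\<^sup>2 * Re (cnj (g s) * wave s x)))" for z .
    show "(\<integral>s. norm (- ((inner s z)\<^sup>2 * Re (cnj (g s) * wave s x))) \<partial>\<mu>) \<le> sqrt (\<integral>s. (cmod (g s))\<^sup>2 \<partial>\<mu>) * sqrt m4 * (norm z)\<^sup>2" for z
    proof -
      have "norm (\<integral>s. norm (- ((inner s z)\<^sup>2 * Re (cnj (g s) * wave s x))) \<partial>\<mu>) \<le> (\<integral>s. cmod (g s) * (inner s z)\<^sup>2 \<partial>\<mu>)"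
        using norm_le by (intro norm_integral_le integrable_L2_inner_power2 g) simp
      then show ?thesis using integral_L2_inner_power2_le[OF g, of z] by simp
    qed
    then show "(\<integral>s. norm (- ((inner s z)\<^sup>2 * Re (cnj (g s) * wave s x))) \<partial>\<mu>) \<le> sqrt (\<integral>s. (cmod (g s))\<^sup>2 \<partial>\<mu>) * sqrt m4 * (norm z)\<^sup>2" for z .
  qed (use integrable_N_norm_sq in \<open>measurable, auto\<close>)
  have C_eq: "(\<integral>z. - ((inner s z)\<^sup>2 * Re (cnj (g s) * wave s x)) \<partial>N) = - inner (blinfun_apply C s) s * Re (cnj (g s) * wave s x)" for s
    using integrable_N_inner_sq[of s] by (simp add: integral_N_inner_sq)
  have int1: "integrable \<mu> (\<lambda>s. - inner (blinfun_apply C s) s * Re (cnj (g s) * wave s x))"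
    using *(2) by (simp only: C_eq)
  have int2: "integrable \<mu> (\<lambda>s. Re (cnj (g s) * (\<i> * complex_of_real (inner s (Y x)) * wave s x)))"
  proof (rule Bochner_Integration.integrable_bound[OF integrable_L2_inner[OF g, of "Y x"]])
    show "AE s in \<mu>. norm (Re (cnj (g s) * (\<i> * complex_of_real (inner s (Y x)) * wave s x))) \<le> norm (cmod (g s) * \<bar>inner s (Y x)\<bar>)"
    proof (intro AE_I2)
      fix s
      show "norm (Re (cnj (g s) * (\<i> * complex_of_real (inner s (Y x)) * wave s x))) \<le> norm (cmod (g s) * \<bar>inner s (Y x)\<bar>)"
        using norm_Re_le[of "cnj (g s) * (\<i> * complex_of_real (inner s (Y x)) * wave s x)"]
        by (simp only: norm_mult complex_mod_cnj norm_ii norm_of_real norm_wave mult_1 mult_1_right real_norm_def abs_mult abs_norm_cancel abs_abs)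
    qed
  qed measurable
  have "stein_op C U (synth g) x = (\<integral>s. - inner (blinfun_apply C s) s * Re (cnj (g s) * wave s x) \<partial>\<mu>)
      - (\<integral>s. Re (cnj (g s) * (\<i> * complex_of_real (inner s (Y x)) * wave s x)) \<partial>\<mu>)"
    unfolding stein_op_H[OF H] inner_commute[of "hess _ _ _"] inner_commute[of "grad _ _"]
      inner_hess_synth[OF g H] inner_grad_synth[OF g H] *(1) C_eq ..
  also have "\<dots> = (\<integral>s. - inner (blinfun_apply C s) s * Re (cnj (g s) * wave s x)
      - Re (cnj (g s) * (\<i> * complex_of_real (inner s (Y x)) * wave s x)) \<partial>\<mu>)"
    by (rule Bochner_Integration.integral_diff[OF int1 int2, symmetric])
  also have "\<dots> = (\<integral>s. Re (cnj (g s) * stein_op_complex C U (wave s) x) \<partial>\<mu>)"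
    unfolding stein_op_complex_wave by (intro Bochner_Integration.integral_cong refl) (simp add: algebra_simps)
  finally show ?thesis .
qed

lemma integral_stein_op_synth:
  assumes g: "g \<in> L2" and H: "synth g \<in> H"
  shows "(\<integral>x. stein_op C U (synth g) x \<partial>Q) = (\<integral>s. Re (cnj (g s) * \<theta> s) \<partial>\<mu>)"
  unfolding stein_op_synth[OF g H] \<theta>_def
proof (rule integral_Q_synth[OF g])
  have gm[measurable]: "g \<in> borel_measurable \<mu>" using g by measurable
  let ?B = "\<lambda>s x. cmod (g s) * inner (blinfun_apply C s) s + cmod (g s) * \<bar>inner s (Y x)\<bar>"
  let ?b = "\<lambda>x. (\<integral>s. cmod (g s) * inner (blinfun_apply C s) s \<partial>\<mu>) + sqrt (\<integral>s. (cmod (g s))\<^sup>2 \<partial>\<mu>) * sqrt m2 * norm (Y x)"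
  have le: "cmod (g s) * cmod (stein_op_complex C U (wave s) x) \<le> ?B s x" for s x
    using mult_left_mono[OF norm_stein_wave_le[of s x] norm_ge_zero[of "g s"]] by (simp add: distrib_left)
  have B: "integrable \<mu> (\<lambda>s. ?B s x)" for x
    using integrable_L2_inner_C[OF g] integrable_L2_inner[OF g] by simp
  show "integrable \<mu> (\<lambda>s. cmod (g s) * cmod (stein_op_complex C U (wave s) x))" for x
  proof (rule Bochner_Integration.integrable_bound[OF B[of x]])
    show "AE s in \<mu>. norm (cmod (g s) * cmod (stein_op_complex C U (wave s) x)) \<le> norm (?B s x)"
      using le by (intro AE_I2) (simp add: C_pos)
    show "(\<lambda>s. cmod (g s) * cmod (stein_op_complex C U (wave s) x)) \<in> borel_measurable \<mu>"
      unfolding stein_op_complex_wave by measurable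
  qed
  show "(\<integral>s. cmod (g s) * cmod (stein_op_complex C U (wave s) x) \<partial>\<mu>) \<le> ?b x" for x
  proof -
    have "norm (\<integral>s. cmod (g s) * cmod (stein_op_complex C U (wave s) x) \<partial>\<mu>) \<le> (\<integral>s. ?B s x \<partial>\<mu>)"
      using le by (intro norm_integral_le B) simp
    also have "\<dots> \<le> ?b x"
      using integrable_L2_inner_C[OF g] integrable_L2_inner[OF g] integral_L2_inner_le[OF g, of "Y x"] by simp
    finally show ?thesis by simp
  qed
  show "integrable Q ?b" using integrable_norm_Y by simp
qed (rule stein_wave_measurable integrable_stein_wave)+

text \<open>The supremum of \<open>ip h\<close> over the unit ball is \<open>nrm h\<close>:
  Cauchy--Schwarz from above, the normalised representer from below. Square integrability of
  \<open>\<theta>\<close> lets the Bochner integral be read as the extended one in the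
  claim.\<close>

theorem KSD_power2:
  "(KSD C U H ip Q)\<^sup>2 = (\<integral>\<^sup>+s. ennreal ((cmod (\<theta> s))\<^sup>2) \<partial>\<mu>)"
proof -
  define L where "L f = (\<integral>x. stein_op C U f x \<partial>Q)" for f
  obtain h where h: "h \<in> H" "\<And>f. f \<in> H \<Longrightarrow> L f = ip h f" "ip h h = (\<integral>s. (cmod (\<theta> s))\<^sup>2 \<partial>\<mu>)"
  proof (rule representer[of L "lip2 * trC + lip * (\<integral>x. norm (Y x) \<partial>Q)" \<theta>])
    show "L (\<lambda>x. a * f x + b * g x) = a * L f + b * L g" if "f \<in> H" "g \<in> H" for f g a b
      unfolding L_def stein_op_comb[OF that] using integrable_stein_op that by simp
    show "\<bar>L f\<bar> \<le> (lip2 * trC + lip * (\<integral>x. norm (Y x) \<partial>Q)) * nrm f" if f: "f \<in> H" for f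
    proof -
      have "norm (L f) \<le> (\<integral>x. (lip2 * trC + lip * norm (Y x)) * nrm f \<partial>Q)"
        unfolding L_def using abs_stein_op_le[OF f] by (intro norm_integral_le) (simp_all add: integrable_norm_Y)
      then show ?thesis using integrable_norm_Y by (simp add: Q.prob_space)
    qed
    show "L (synth g) = (\<integral>s. Re (cnj (g s) * \<theta> s) \<partial>\<mu>)" if "g \<in> L2" "synth g \<in> H" for g
      unfolding L_def by (rule integral_stein_op_synth[OF that])
  qed (use \<theta>_L2 in auto)
  have "KSD C U H ip Q = ennreal (nrm h)"
    unfolding KSD_def L_def[symmetric]
  proof (rule antisym)
    show "(SUP f\<in>{f \<in> H. nrm f \<le> 1}. ennreal \<bar>L f\<bar>) \<le> ennreal (nrm h)"
    proof (rule SUP_least)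
      fix f assume "f \<in> {f \<in> H. nrm f \<le> 1}"
      then have f: "f \<in> H" "nrm f \<le> 1" by auto
      have "\<bar>L f\<bar> \<le> nrm h * nrm f" using ip_le_nrm[OF h(1) f(1)] h(2)[OF f(1)] by simp
      also have "\<dots> \<le> nrm h * 1" using f(2) nrm_nonneg[OF h(1)] by (rule mult_left_mono)
      finally show "ennreal \<bar>L f\<bar> \<le> ennreal (nrm h)" by (simp add: ennreal_leI)
    qed
    show "ennreal (nrm h) \<le> (SUP f\<in>{f \<in> H. nrm f \<le> 1}. ennreal \<bar>L f\<bar>)"
    proof (cases "nrm h = 0")
      case False
      then have pos: "nrm h > 0" using nrm_nonneg[OF h(1)] by simp
      let ?f = "\<lambda>x. (1 / nrm h) * h x"
      have f: "?f \<in> H" using comb_in[OF h(1) h(1), of "1 / nrm h" 0] by simp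
      have "nrm h * ip h ?f = nrm h * nrm h"
        using ip_comb_right[OF h(1) h(1) h(1), of "1 / nrm h" 0] nrm_power2[OF h(1)] pos
        by (simp add: power2_eq_square)
      then have "L ?f = nrm h" using h(2)[OF f] pos by simp
      moreover have "nrm ?f = 1" using nrm_scale[OF h(1), of "1 / nrm h"] pos by simp
      ultimately show ?thesis using f pos by (intro SUP_upper2[of ?f]) auto
    qed simp
  qed
  then have "(KSD C U H ip Q)\<^sup>2 = ennreal (\<integral>s. (cmod (\<theta> s))\<^sup>2 \<partial>\<mu>)"
    using h by (simp add: ennreal_power nrm_nonneg nrm_power2)
  also have "\<dots> = (\<integral>\<^sup>+s. ennreal ((cmod (\<theta> s))\<^sup>2) \<partial>\<mu>)"
    by (rule nn_integral_eq_integral[symmetric]) (use \<theta>_L2 in \<open>auto simp: L2_def\<close>)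
  finally show ?thesis .
qed

end

section \<open>The vector-valued discrepancy\<close>

locale stein_kernel_C1 = stein_kernel + fourier_kernel_C1
begin

text \<open>The component along \<open>v\<close> of \<open>Gamma_op_complex C U (wave s) x\<close>
  (see \<open>\<gamma>_eq\<close>): a scalar symbol, so that \<open>representer\<close> applies in
  every direction \<open>v\<close>.\<close>

definition \<gamma> :: "'a \<Rightarrow> 'a \<Rightarrow> 'a \<Rightarrow> complex" where
  "\<gamma> v s x = (\<i> * complex_of_real (inner s (blinfun_apply C v)) - complex_of_real (inner v (Y x))) * wave s x"

lemma inner_Gamma_op: "inner (Gamma_op C U f x) v = inner (grad f x) (blinfun_apply C v) - f x * inner v (Y x)"
  unfolding Gamma_op_def Y_def[symmetric] inner_diff_left C_sym inner_scaleR_left inner_commute[of v] ..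

lemma Gamma_op_complex_wave:
  "Gamma_op_complex C U (wave s) x =
    ((- sin (inner s x)) *\<^sub>R blinfun_apply C s - cos (inner s x) *\<^sub>R Y x,
     cos (inner s x) *\<^sub>R blinfun_apply C s - sin (inner s x) *\<^sub>R Y x)"
  unfolding Gamma_op_complex_def Re_wave Im_wave Gamma_op_def grad_cos_inner grad_sin_inner Y_def
  by (simp add: blinfun.scaleR_right blinfun.minus_right)

lemma \<gamma>_eq: "\<gamma> v s x = Complex (inner (fst (Gamma_op_complex C U (wave s) x)) v) (inner (snd (Gamma_op_complex C U (wave s) x)) v)"
  unfolding Gamma_op_complex_wave \<gamma>_def
  by (simp add: complex_eq_iff Re_wave Im_wave inner_diff_left C_sym inner_commute[of v "Y x"] algebra_simps)

lemma norm_\<gamma>_le: "cmod (\<gamma> v s x) \<le> \<bar>inner s (blinfun_apply C v)\<bar> + norm v * norm (Y x)"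
proof -
  have "cmod (\<gamma> v s x) \<le> \<bar>inner s (blinfun_apply C v)\<bar> + \<bar>inner v (Y x)\<bar>"
    unfolding \<gamma>_def norm_mult norm_wave mult_1_right
    by (rule order_trans[OF norm_triangle_ineq4]) (simp add: norm_mult)
  also have "\<bar>inner v (Y x)\<bar> \<le> norm v * norm (Y x)" by (rule Cauchy_Schwarz_ineq2)
  finally show ?thesis by simp
qed

lemma \<gamma>_measurable [measurable]: "(\<lambda>(s, x). \<gamma> v s x) \<in> borel_measurable (\<mu> \<Otimes>\<^sub>M Q)"
  unfolding \<gamma>_def by measurable

lemma integrable_\<gamma>: "integrable Q (\<gamma> v s)"
proof (rule Bochner_Integration.integrable_bound)
  show "integrable Q (\<lambda>x. \<bar>inner s (blinfun_apply C v)\<bar> + norm v * norm (Y x))"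
    using integrable_norm_Y by simp
  show "AE x in Q. norm (\<gamma> v s x) \<le> norm (\<bar>inner s (blinfun_apply C v)\<bar> + norm v * norm (Y x))"
    using norm_\<gamma>_le by (intro AE_I2) (smt (verit) real_norm_def)
  show "\<gamma> v s \<in> borel_measurable Q" unfolding \<gamma>_def[abs_def] by measurable
qed

definition \<theta> :: "'a \<Rightarrow> 'a \<Rightarrow> complex" where "\<theta> v s = (\<integral>x. \<gamma> v s x \<partial>Q)"

text \<open>For fixed \<open>v\<close> the bound on the symbol depends on \<open>s\<close> only
  through \<open>inner s (C v)\<close>; the rest is constant in \<open>s\<close>, hence square
  integrable because \<open>\<mu>\<close> is finite.\<close>

lemma \<theta>_L2: "\<theta> v \<in> L2"
proof -
  have [measurable]: "\<theta> v \<in> borel_measurable \<mu>"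
    unfolding \<theta>_def[abs_def] by (rule Q.borel_measurable_lebesgue_integral) measurable
  let ?b = "norm v * (\<integral>x. norm (Y x) \<partial>Q)"
  have "integrable \<mu> (\<lambda>s. (cmod (\<theta> v s))\<^sup>2)"
  proof (rule Bochner_Integration.integrable_bound)
    show "integrable \<mu> (\<lambda>s. 2 * (inner s (blinfun_apply C v))\<^sup>2 + 2 * ?b\<^sup>2)"
      using integrable_inner_power2[of "blinfun_apply C v"] by simp
    show "AE s in \<mu>. norm ((cmod (\<theta> v s))\<^sup>2) \<le> norm (2 * (inner s (blinfun_apply C v))\<^sup>2 + 2 * ?b\<^sup>2)"
    proof (intro AE_I2)
      fix s
      let ?a = "inner s (blinfun_apply C v)"
      have "cmod (\<theta> v s) \<le> (\<integral>x. \<bar>?a\<bar> + norm v * norm (Y x) \<partial>Q)"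
        unfolding \<theta>_def by (intro norm_integral_le norm_\<gamma>_le) (use integrable_norm_Y in simp)
      also have "\<dots> = \<bar>?a\<bar> + ?b" using integrable_norm_Y by (simp add: Q.prob_space)
      finally have "(cmod (\<theta> v s))\<^sup>2 \<le> (\<bar>?a\<bar> + ?b)\<^sup>2" by (rule power_mono) simp
      also have "\<dots> \<le> 2 * ?a\<^sup>2 + 2 * ?b\<^sup>2"
        using zero_le_power2[of "\<bar>?a\<bar> - ?b"] by (simp add: power2_sum power2_diff)
      finally show "norm ((cmod (\<theta> v s))\<^sup>2) \<le> norm (2 * ?a\<^sup>2 + 2 * ?b\<^sup>2)" by simp
    qed
  qed measurable
  then show ?thesis by (simp add: L2_def)
qed

text \<open>A Fourier kernel is translation invariant, so pointwise values are bounded by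
  \<open>nrm\<close> with one constant for all \<open>x\<close>.\<close>

lemma kernel_diag: "k x x = k 0 0"
  by (simp add: kernel_eq wave_eq_cis cis_cnj cis_mult)

lemma abs_le_nrm_diag: "f \<in> H \<Longrightarrow> \<bar>f x\<bar> \<le> sqrt (k 0 0) * nrm f"
  using abs_le_nrm[of f x] kernel_diag[of x] by (simp add: mult.commute)

lemma kernel_diag_nonneg: "0 \<le> k 0 0"
  unfolding kernel_eq by simp

text \<open>For a vector \<open>v\<close> of \<open>some_onb\<close> this is the discrepancy
  functional on the field \<open>f x *\<^sub>R v\<close>, by
  \<open>stein_op_v_onb_sum\<close>.\<close>

definition \<Lambda> :: "'a \<Rightarrow> ('a \<Rightarrow> real) \<Rightarrow> real" where "\<Lambda> v f = (\<integral>x. inner (Gamma_op C U f x) v \<partial>Q)"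

lemma abs_inner_Gamma_op_le:
  assumes f: "f \<in> H"
  shows "\<bar>inner (Gamma_op C U f x) v\<bar> \<le> (lip * norm (blinfun_apply C v) + sqrt (k 0 0) * norm v * norm (Y x)) * nrm f"
proof -
  have "\<bar>inner (grad f x) (blinfun_apply C v)\<bar> \<le> lip * nrm f * norm (blinfun_apply C v)"
    using inner_grad_le[OF f, of "blinfun_apply C v" x] by (simp add: inner_commute)
  moreover have "\<bar>f x * inner v (Y x)\<bar> \<le> (sqrt (k 0 0) * nrm f) * (norm v * norm (Y x))"
    unfolding abs_mult
    by (intro mult_mono abs_le_nrm_diag[OF f] Cauchy_Schwarz_ineq2 mult_nonneg_nonneg nrm_nonneg[OF f])
       (simp_all add: kernel_diag_nonneg)
  ultimately show ?thesis unfolding inner_Gamma_op by (simp add: algebra_simps)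
qed

lemma integrable_inner_Gamma_op:
  assumes f: "f \<in> H"
  shows "integrable Q (\<lambda>x. inner (Gamma_op C U f x) v)"
proof (rule Bochner_Integration.integrable_bound)
  have [measurable]: "f \<in> borel_measurable borel" by (intro borel_measurable_continuous_onI continuous_H f)
  have [measurable]: "grad f \<in> borel_measurable borel" by (intro borel_measurable_grad differentiable f)
  show "(\<lambda>x. inner (Gamma_op C U f x) v) \<in> borel_measurable Q" unfolding inner_Gamma_op by measurable
  show "integrable Q (\<lambda>x. (lip * norm (blinfun_apply C v) + sqrt (k 0 0) * norm v * norm (Y x)) * nrm f)"
    using integrable_norm_Y by simp
  show "AE x in Q. norm (inner (Gamma_op C U f x) v)
      \<le> norm ((lip * norm (blinfun_apply C v) + sqrt (k 0 0) * norm v * norm (Y x)) * nrm f)"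
    using abs_inner_Gamma_op_le[OF f] by (intro AE_I2) (smt (verit) real_norm_def)
qed

lemma \<Lambda>_synth:
  assumes g: "g \<in> L2" and H: "synth g \<in> H"
  shows "\<Lambda> v (synth g) = (\<integral>s. Re (cnj (g s) * \<theta> v s) \<partial>\<mu>)"
proof -
  have gm[measurable]: "g \<in> borel_measurable \<mu>" using g by measurable
  let ?Cv = "blinfun_apply C v"
  have int1: "integrable \<mu> (\<lambda>s. Re (cnj (g s) * (\<i> * complex_of_real (inner s ?Cv) * wave s x)))" for x
  proof (rule Bochner_Integration.integrable_bound[OF integrable_L2_inner[OF g, of ?Cv]])
    show "AE s in \<mu>. norm (Re (cnj (g s) * (\<i> * complex_of_real (inner s ?Cv) * wave s x))) \<le> norm (cmod (g s) * \<bar>inner s ?Cv\<bar>)"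
    proof (intro AE_I2)
      fix s
      show "norm (Re (cnj (g s) * (\<i> * complex_of_real (inner s ?Cv) * wave s x))) \<le> norm (cmod (g s) * \<bar>inner s ?Cv\<bar>)"
        using norm_Re_le[of "cnj (g s) * (\<i> * complex_of_real (inner s ?Cv) * wave s x)"]
        by (simp only: norm_mult complex_mod_cnj norm_ii norm_of_real norm_wave mult_1 mult_1_right real_norm_def abs_mult abs_norm_cancel abs_abs)
    qed
  qed measurable
  have int2: "integrable \<mu> (\<lambda>s. Re (cnj (g s) * wave s x))" for x
  proof (rule Bochner_Integration.integrable_bound[OF integrable_norm_L2[OF g]])
    show "AE s in \<mu>. norm (Re (cnj (g s) * wave s x)) \<le> norm (cmod (g s))"
    proof (intro AE_I2)
      fix s
      show "norm (Re (cnj (g s) * wave s x)) \<le> norm (cmod (g s))"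
        using norm_Re_le[of "cnj (g s) * wave s x"]
        by (simp only: norm_mult complex_mod_cnj norm_wave mult_1_right real_norm_def abs_norm_cancel)
    qed
  qed measurable
  have "inner (Gamma_op C U (synth g) x) v = (\<integral>s. Re (cnj (g s) * \<gamma> v s x) \<partial>\<mu>)" for x
  proof -
    have "inner (Gamma_op C U (synth g) x) v = (\<integral>s. Re (cnj (g s) * (\<i> * complex_of_real (inner s ?Cv) * wave s x)) \<partial>\<mu>)
        - (\<integral>s. Re (cnj (g s) * wave s x) * inner v (Y x) \<partial>\<mu>)"
      unfolding inner_Gamma_op inner_commute[of "grad _ _"] inner_grad_synth[OF g H] by (simp add: synth_def)
    also have "\<dots> = (\<integral>s. Re (cnj (g s) * (\<i> * complex_of_real (inner s ?Cv) * wave s x)) - Re (cnj (g s) * wave s x) * inner v (Y x) \<partial>\<mu>)"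
      by (intro Bochner_Integration.integral_diff[symmetric] int1 integrable_mult_left int2)
    also have "\<dots> = (\<integral>s. Re (cnj (g s) * \<gamma> v s x) \<partial>\<mu>)"
      unfolding \<gamma>_def by (intro Bochner_Integration.integral_cong refl) (simp add: algebra_simps)
    finally show ?thesis .
  qed
  then have "\<Lambda> v (synth g) = (\<integral>x. (\<integral>s. Re (cnj (g s) * \<gamma> v s x) \<partial>\<mu>) \<partial>Q)"
    unfolding \<Lambda>_def by simp
  also have "\<dots> = (\<integral>s. Re (cnj (g s) * (\<integral>x. \<gamma> v s x \<partial>Q)) \<partial>\<mu>)"
  proof (rule integral_Q_synth[OF g \<gamma>_measurable integrable_\<gamma>])
    let ?B = "\<lambda>s x. cmod (g s) * \<bar>inner s ?Cv\<bar> + cmod (g s) * (norm v * norm (Y x))"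
    let ?b = "\<lambda>x. (\<integral>s. cmod (g s) * \<bar>inner s ?Cv\<bar> \<partial>\<mu>) + (\<integral>s. cmod (g s) \<partial>\<mu>) * (norm v * norm (Y x))"
    have le: "cmod (g s) * cmod (\<gamma> v s x) \<le> ?B s x" for s x
      using mult_left_mono[OF norm_\<gamma>_le[of v s x] norm_ge_zero[of "g s"]] by (simp add: distrib_left)
    have B: "integrable \<mu> (\<lambda>s. ?B s x)" for x
      using integrable_norm_L2[OF g] integrable_L2_inner[OF g] by simp
    show "integrable \<mu> (\<lambda>s. cmod (g s) * cmod (\<gamma> v s x))" for x
    proof (rule Bochner_Integration.integrable_bound[OF B[of x]])
      show "AE s in \<mu>. norm (cmod (g s) * cmod (\<gamma> v s x)) \<le> norm (?B s x)"
        using le by (intro AE_I2) simp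
      show "(\<lambda>s. cmod (g s) * cmod (\<gamma> v s x)) \<in> borel_measurable \<mu>"
        unfolding \<gamma>_def by measurable
    qed
    show "(\<integral>s. cmod (g s) * cmod (\<gamma> v s x) \<partial>\<mu>) \<le> ?b x" for x
    proof -
      have "norm (\<integral>s. cmod (g s) * cmod (\<gamma> v s x) \<partial>\<mu>) \<le> (\<integral>s. ?B s x \<partial>\<mu>)"
        using le by (intro norm_integral_le B) simp
      also have "\<dots> = ?b x" using integrable_norm_L2[OF g] integrable_L2_inner[OF g] by simp
      finally show ?thesis by simp
    qed
    show "integrable Q ?b" using integrable_norm_Y by simp
  qed
  finally show ?thesis unfolding \<theta>_def .
qed

lemma ex_representer: "\<exists>h\<in>H. (\<forall>f\<in>H. \<Lambda> v f = ip h f) \<and> ip h h = (\<integral>s. (cmod (\<theta> v s))\<^sup>2 \<partial>\<mu>)"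
proof -
  obtain h where "h \<in> H" "\<And>f. f \<in> H \<Longrightarrow> \<Lambda> v f = ip h f" "ip h h = (\<integral>s. (cmod (\<theta> v s))\<^sup>2 \<partial>\<mu>)"
  proof (rule representer[of "\<Lambda> v" "lip * norm (blinfun_apply C v) + sqrt (k 0 0) * norm v * (\<integral>x. norm (Y x) \<partial>Q)" "\<theta> v"])
    show "\<Lambda> v (\<lambda>x. a * f x + b * g x) = a * \<Lambda> v f + b * \<Lambda> v g" if "f \<in> H" "g \<in> H" for f g a b
    proof -
      have "inner (Gamma_op C U (\<lambda>x. a * f x + b * g x) x) v = a * inner (Gamma_op C U f x) v + b * inner (Gamma_op C U g x) v" for x
        by (simp add: inner_Gamma_op grad_comb that inner_add_left algebra_simps)
      then show ?thesis unfolding \<Lambda>_def using integrable_inner_Gamma_op that by simp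
    qed
    show "\<bar>\<Lambda> v f\<bar> \<le> (lip * norm (blinfun_apply C v) + sqrt (k 0 0) * norm v * (\<integral>x. norm (Y x) \<partial>Q)) * nrm f" if f: "f \<in> H" for f
    proof -
      have "norm (\<Lambda> v f) \<le> (\<integral>x. (lip * norm (blinfun_apply C v) + sqrt (k 0 0) * norm v * norm (Y x)) * nrm f \<partial>Q)"
        unfolding \<Lambda>_def using abs_inner_Gamma_op_le[OF f] by (intro norm_integral_le) (simp_all add: integrable_norm_Y)
      then show ?thesis using integrable_norm_Y by (simp add: Q.prob_space)
    qed
  qed (use \<theta>_L2 \<Lambda>_synth in auto)
  then show ?thesis by blast
qed

definition Z :: "'a \<Rightarrow> 'a \<times> 'a" where "Z s = (\<integral>x. Gamma_op_complex C U (wave s) x \<partial>Q)"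

lemma Z_measurable [measurable]: "Z \<in> borel_measurable \<mu>"
  unfolding Z_def[abs_def]
proof (rule Q.borel_measurable_lebesgue_integral)
  show "(\<lambda>(s, x). Gamma_op_complex C U (wave s) x) \<in> borel_measurable (\<mu> \<Otimes>\<^sub>M Q)"
    unfolding Gamma_op_complex_wave by measurable
qed

lemma integrable_Gamma_wave: "integrable Q (Gamma_op_complex C U (wave s))"
proof (rule Bochner_Integration.integrable_bound)
  show "integrable Q (\<lambda>x. 2 * (norm (blinfun_apply C s) + norm (Y x)))"
    using integrable_norm_Y by simp
  show "Gamma_op_complex C U (wave s) \<in> borel_measurable Q"
    unfolding Gamma_op_complex_wave[abs_def] by measurable
  show "AE x in Q. norm (Gamma_op_complex C U (wave s) x) \<le> norm (2 * (norm (blinfun_apply C s) + norm (Y x)))"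
  proof (intro AE_I2)
    fix x
    have le: "norm (a *\<^sub>R blinfun_apply C s - b *\<^sub>R Y x) \<le> norm (blinfun_apply C s) + norm (Y x)" if "\<bar>a\<bar> \<le> 1" "\<bar>b\<bar> \<le> 1" for a b
    proof -
      have "norm (a *\<^sub>R blinfun_apply C s - b *\<^sub>R Y x) \<le> \<bar>a\<bar> * norm (blinfun_apply C s) + \<bar>b\<bar> * norm (Y x)"
        using norm_triangle_ineq4[of "a *\<^sub>R blinfun_apply C s" "b *\<^sub>R Y x"] by simp
      also have "\<dots> \<le> 1 * norm (blinfun_apply C s) + 1 * norm (Y x)"
        using that by (intro add_mono mult_right_mono) auto
      finally show ?thesis by simp
    qed
    have "norm (Gamma_op_complex C U (wave s) x) \<le> norm ((- sin (inner s x)) *\<^sub>R blinfun_apply C s - cos (inner s x) *\<^sub>R Y x)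
        + norm (cos (inner s x) *\<^sub>R blinfun_apply C s - sin (inner s x) *\<^sub>R Y x)"
      unfolding Gamma_op_complex_wave by (rule norm_Pair_le)
    also have "\<dots> \<le> 2 * (norm (blinfun_apply C s) + norm (Y x))"
      using le[of "- sin (inner s x)" "cos (inner s x)"] le[of "cos (inner s x)" "sin (inner s x)"] by simp
    finally show "norm (Gamma_op_complex C U (wave s) x) \<le> norm (2 * (norm (blinfun_apply C s) + norm (Y x)))" by simp
  qed
qed

text \<open>\<open>Z s\<close> is a Bochner integral in the product space; pairing each of its two
  parts with \<open>v\<close> commutes with the integral, which yields the real and imaginary parts
  of \<open>\<theta> v s\<close>.\<close>

lemma norm_\<theta>_power2: "(cmod (\<theta> v s))\<^sup>2 = (inner (fst (Z s)) v)\<^sup>2 + (inner (snd (Z s)) v)\<^sup>2"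
proof -
  have bl: "bounded_linear (\<lambda>z :: 'a \<times> 'a. inner (fst z) v)" "bounded_linear (\<lambda>z :: 'a \<times> 'a. inner (snd z) v)"
    by (intro bounded_linear_compose[OF bounded_linear_inner_left] bounded_linear_fst bounded_linear_snd)+
  have "Re (\<theta> v s) = (\<integral>x. inner (fst (Gamma_op_complex C U (wave s) x)) v \<partial>Q)"
    unfolding \<theta>_def using integrable_\<gamma>[of v s] by (subst integral_Re[symmetric]) (simp_all add: \<gamma>_eq)
  then have 1: "Re (\<theta> v s) = inner (fst (Z s)) v"
    unfolding Z_def using integral_bounded_linear[OF bl(1) integrable_Gamma_wave[of s]] by simp
  have "Im (\<theta> v s) = (\<integral>x. inner (snd (Gamma_op_complex C U (wave s) x)) v \<partial>Q)"
    unfolding \<theta>_def using integrable_\<gamma>[of v s] by (subst integral_Im[symmetric]) (simp_all add: \<gamma>_eq)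
  then have 2: "Im (\<theta> v s) = inner (snd (Z s)) v"
    unfolding Z_def using integral_bounded_linear[OF bl(2) integrable_Gamma_wave[of s]] by simp
  show ?thesis unfolding cmod_power2 1 2 ..
qed

lemma has_sum_norm_\<theta>: "((\<lambda>e. (cmod (\<theta> e s))\<^sup>2) has_sum (norm (Z s))\<^sup>2) some_onb"
  unfolding norm_\<theta>_power2
  using has_sum_add[OF Parseval_norm[OF onb_some_onb, of "fst (Z s)"] Parseval_norm[OF onb_some_onb, of "snd (Z s)"]]
  by (simp add: norm_prod_def)

section \<open>Regularity of functions in the vector-valued space\<close>

abbreviation vnrm :: "('a \<Rightarrow> 'a) \<Rightarrow> real" where "vnrm \<equiv> vrkhs_norm ip"

context
  fixes F :: "'a \<Rightarrow> 'a"
  assumes F: "F \<in> vrkhs H ip"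
begin

lemma component_in: "e \<in> some_onb \<Longrightarrow> (\<lambda>x. inner (F x) e) \<in> H"
  using F by (simp add: vrkhs_def)

lemma vnrm_has_sum: "((\<lambda>e. (nrm (\<lambda>x. inner (F x) e))\<^sup>2) has_sum (vnrm F)\<^sup>2) some_onb"
proof -
  have "(\<lambda>e. (nrm (\<lambda>x. inner (F x) e))\<^sup>2) summable_on some_onb" using F by (simp add: vrkhs_def)
  moreover have "(vnrm F)\<^sup>2 = (\<Sum>\<^sub>\<infinity>e\<in>some_onb. (nrm (\<lambda>x. inner (F x) e))\<^sup>2)"
    unfolding vrkhs_norm_def by (simp add: infsum_nonneg)
  ultimately show ?thesis by simp
qed

lemma vnrm_nonneg: "0 \<le> vnrm F"
  unfolding vrkhs_norm_def by (simp add: infsum_nonneg)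

lemma norm_vrkhs_le: "norm (F x) \<le> sqrt (k 0 0) * vnrm F"
proof (rule power2_le_imp_le)
  have "(norm (F x))\<^sup>2 \<le> k 0 0 * (vnrm F)\<^sup>2"
  proof (rule has_sum_mono[OF Parseval_norm[OF onb_some_onb] has_sum_cmult_right[OF vnrm_has_sum]])
    fix e :: 'a assume "e \<in> some_onb"
    then show "(inner (F x) e)\<^sup>2 \<le> k 0 0 * (nrm (\<lambda>x. inner (F x) e))\<^sup>2"
      using power_mono[OF abs_le_nrm_diag[OF component_in] abs_ge_zero, of e x 2]
      by (simp add: power_mult_distrib kernel_diag_nonneg)
  qed
  then show "(norm (F x))\<^sup>2 \<le> (sqrt (k 0 0) * vnrm F)\<^sup>2"
    by (simp add: power_mult_distrib kernel_diag_nonneg)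
qed (simp add: kernel_diag_nonneg vnrm_nonneg)

text \<open>Partial basis expansions of \<open>F\<close> are differentiable because their components
  lie in \<open>H\<close>. The derivatives of two of them differ by at most \<open>lip\<close> times
  the root of a piece of the convergent series for \<open>(vnrm F)\<^sup>2\<close>, uniformly in
  \<open>x\<close>.\<close>

lemma differentiable_vrkhs: "F differentiable (at x)"
proof -
  obtain E where E: "\<And>n. finite (E n)" "\<And>n. E n \<subseteq> (some_onb :: 'a set)" "incseq E"
    "filterlim E (finite_subsets_at_top some_onb) sequentially"
    using countable_finite_exhaustion[OF countable_onb[OF onb_some_onb]] by metis
  define \<sigma> where "\<sigma> n = (\<Sum>e\<in>E n. (nrm (\<lambda>x. inner (F x) e))\<^sup>2)" for n
  define D where "D n x h = (\<Sum>e\<in>E n. inner h (grad (\<lambda>x. inner (F x) e) x) *\<^sub>R e)" for n x h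
  show ?thesis
  proof (rule has_derivative_uniform_Cauchy[where f="\<lambda>n x. \<Sum>e\<in>E n. inner (F x) e *\<^sub>R e" and f'=D and c="\<lambda>m n. lip * sqrt \<bar>\<sigma> m - \<sigma> n\<bar>"])
    show "((\<lambda>x. \<Sum>e\<in>E n. inner (F x) e *\<^sub>R e) has_derivative D n x) (at x)" for n x
      unfolding D_def using E(2)[of n]
      by (intro has_derivative_sum has_derivative_scaleR_left has_derivative_grad_H component_in) auto
    have le: "norm (D m x h - D n x h) \<le> lip * sqrt \<bar>\<sigma> m - \<sigma> n\<bar> * norm h" if "n \<le> m" for m n x h
    proof (rule power2_le_imp_le)
      have sub: "E n \<subseteq> E m" using E(3) that by (simp add: monoD)
      let ?E = "E m - E n"
      have fin: "finite ?E" "?E \<subseteq> some_onb" using E by auto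
      have "D m x h - D n x h = (\<Sum>e\<in>?E. inner h (grad (\<lambda>x. inner (F x) e) x) *\<^sub>R e)"
        unfolding D_def by (simp add: sum_diff[OF E(1) sub])
      \<comment> \<open>Pythagoras, as the case of the vector \<open>0\<close> in the distance
        formula.\<close>
      then have "(norm (D m x h - D n x h))\<^sup>2 = (\<Sum>e\<in>?E. (inner h (grad (\<lambda>x. inner (F x) e) x))\<^sup>2)"
        using norm_diff_onb_sum[OF onb_some_onb fin, of 0 "\<lambda>e. inner h (grad (\<lambda>x. inner (F x) e) x)"] by simp
      also have "\<dots> \<le> (\<Sum>e\<in>?E. (lip * norm h)\<^sup>2 * (nrm (\<lambda>x. inner (F x) e))\<^sup>2)"
      proof (rule sum_mono)
        fix e assume "e \<in> ?E"
        then have "(\<lambda>x. inner (F x) e) \<in> H" using E(2) by (intro component_in) auto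
        from power_mono[OF inner_grad_le[OF this, of h x] abs_ge_zero, of 2]
        show "(inner h (grad (\<lambda>x. inner (F x) e) x))\<^sup>2 \<le> (lip * norm h)\<^sup>2 * (nrm (\<lambda>x. inner (F x) e))\<^sup>2"
          by (simp add: power_mult_distrib mult_ac)
      qed
      also have "\<dots> = (lip * norm h)\<^sup>2 * (\<sigma> m - \<sigma> n)"
        unfolding \<sigma>_def by (simp add: sum_distrib_left[symmetric] sum_diff[OF E(1) sub])
      also have "\<dots> \<le> (lip * norm h)\<^sup>2 * \<bar>\<sigma> m - \<sigma> n\<bar>" by (rule mult_left_mono) simp_all
      also have "\<dots> = (lip * sqrt \<bar>\<sigma> m - \<sigma> n\<bar> * norm h)\<^sup>2" by (simp add: power_mult_distrib)
      finally show "(norm (D m x h - D n x h))\<^sup>2 \<le> (lip * sqrt \<bar>\<sigma> m - \<sigma> n\<bar> * norm h)\<^sup>2" .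
    qed (simp add: lip_nonneg)
    show "norm (D m x h - D n x h) \<le> lip * sqrt \<bar>\<sigma> m - \<sigma> n\<bar> * norm h" for m n x h
      using le[of n m] le[of m n] by (cases "n \<le> m") (simp_all add: norm_minus_commute abs_minus_commute)
    show "\<exists>N. \<forall>m\<ge>N. \<forall>n\<ge>N. lip * sqrt \<bar>\<sigma> m - \<sigma> n\<bar> \<le> e" if e: "e > 0" for e
    proof -
      define \<delta> where "\<delta> = e / (lip + 1)"
      have \<delta>: "\<delta> > 0" "lip * \<delta> \<le> e" using e lip_nonneg by (simp_all add: \<delta>_def field_simps)
      have "Cauchy \<sigma>"
        unfolding \<sigma>_def using has_sum_sequence[OF vnrm_has_sum E(4)] LIMSEQ_imp_Cauchy by blast
      then obtain N where N: "\<And>m n. m \<ge> N \<Longrightarrow> n \<ge> N \<Longrightarrow> norm (\<sigma> m - \<sigma> n) < \<delta>\<^sup>2"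
        using CauchyD[of \<sigma> "\<delta>\<^sup>2"] \<delta> by auto
      have "lip * sqrt \<bar>\<sigma> m - \<sigma> n\<bar> \<le> e" if "m \<ge> N" "n \<ge> N" for m n
      proof -
        have "sqrt \<bar>\<sigma> m - \<sigma> n\<bar> \<le> \<delta>" using N[OF that] \<delta> by (simp add: real_le_lsqrt)
        then have "lip * sqrt \<bar>\<sigma> m - \<sigma> n\<bar> \<le> lip * \<delta>" using lip_nonneg by (rule mult_left_mono)
        then show ?thesis using \<delta> by simp
      qed
      then show ?thesis by blast
    qed
    show "(\<lambda>n. \<Sum>e\<in>E n. inner (F x) e *\<^sub>R e) \<longlonglongrightarrow> F x" for x
      by (rule has_sum_sequence[OF onb_expansion[OF onb_some_onb] E(4)])
  qed
qed

lemma vrkhs_derivative: "(F has_derivative frechet_derivative F (at x)) (at x)"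
  using differentiable_vrkhs by (simp add: frechet_derivative_works)

lemma norm_vrkhs_derivative_le: "norm (frechet_derivative F (at x) h) \<le> lip * vnrm F * norm h"
proof (rule power2_le_imp_le)
  have "(norm (frechet_derivative F (at x) h))\<^sup>2 \<le> (lip * norm h)\<^sup>2 * (vnrm F)\<^sup>2"
  proof (rule has_sum_mono[OF Parseval_norm[OF onb_some_onb] has_sum_cmult_right[OF vnrm_has_sum]])
    fix e :: 'a assume e: "e \<in> some_onb"
    have "((\<lambda>x. inner (F x) e) has_derivative (\<lambda>h. inner (frechet_derivative F (at x) h) e)) (at x)"
      by (intro bounded_linear.has_derivative[OF bounded_linear_inner_left] vrkhs_derivative)
    from power_mono[OF derivative_le[OF component_in[OF e] this, of h] abs_ge_zero, of 2]
    show "(inner (frechet_derivative F (at x) h) e)\<^sup>2 \<le> (lip * norm h)\<^sup>2 * (nrm (\<lambda>x. inner (F x) e))\<^sup>2"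
      by (simp add: power_mult_distrib mult_ac)
  qed
  then show "(norm (frechet_derivative F (at x) h))\<^sup>2 \<le> (lip * vnrm F * norm h)\<^sup>2"
    by (simp add: power_mult_distrib mult_ac)
qed (simp add: lip_nonneg vnrm_nonneg)

lemma stein_op_v_vrkhs:
  "stein_op_v C U F x = (\<integral>z. inner (frechet_derivative F (at x) z) z \<partial>N) - inner (F x) (Y x)"
  unfolding stein_op_v_def Y_def by (simp add: op_trace_C has_derivative_bounded_linear[OF vrkhs_derivative])

lemma abs_stein_op_v_le: "\<bar>stein_op_v C U F x\<bar> \<le> (lip * trC + sqrt (k 0 0) * norm (Y x)) * vnrm F"
proof -
  have "\<bar>\<integral>z. inner (frechet_derivative F (at x) z) z \<partial>N\<bar> \<le> (lip * vnrm F) * trC"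
    by (rule abs_integral_N_quadratic_le) (rule norm_vrkhs_derivative_le)
  moreover have "\<bar>inner (F x) (Y x)\<bar> \<le> (sqrt (k 0 0) * vnrm F) * norm (Y x)"
    by (rule order_trans[OF Cauchy_Schwarz_ineq2]) (rule mult_right_mono[OF norm_vrkhs_le norm_ge_zero])
  ultimately show ?thesis unfolding stein_op_v_vrkhs by (simp add: algebra_simps)
qed

end

section \<open>Finite expansions and their tails\<close>

context
  fixes E :: "'a set"
  assumes E: "finite E" "E \<subseteq> some_onb"
begin

lemma has_derivative_onb_sum:
  assumes "\<And>e. e \<in> E \<Longrightarrow> f e \<in> H"
  shows "((\<lambda>x. \<Sum>e\<in>E. f e x *\<^sub>R e) has_derivative (\<lambda>h. \<Sum>e\<in>E. inner h (grad (f e) x) *\<^sub>R e)) (at x)"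
  by (intro has_derivative_sum has_derivative_scaleR_left has_derivative_grad_H assms)

text \<open>The derivative of \<open>f e x *\<^sub>R e\<close> has rank one, so the trace against
  \<open>C\<close> pairs \<open>grad (f e) x\<close> with \<open>C e\<close>; that is the derivative
  part of the \<open>e\<close>-component of \<open>Gamma_op\<close>.\<close>

lemma stein_op_v_onb_sum:
  assumes f: "\<And>e. e \<in> E \<Longrightarrow> f e \<in> H"
  shows "stein_op_v C U (\<lambda>x. \<Sum>e\<in>E. f e x *\<^sub>R e) x = (\<Sum>e\<in>E. inner (Gamma_op C U (f e) x) e)"
proof -
  note D = has_derivative_onb_sum[OF f, where x=x]
  have fd: "frechet_derivative (\<lambda>x. \<Sum>e\<in>E. f e x *\<^sub>R e) (at x) = (\<lambda>h. \<Sum>e\<in>E. inner h (grad (f e) x) *\<^sub>R e)"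
    using frechet_derivative_at[OF D] by simp
  have "op_trace (\<lambda>h. blinfun_apply C (frechet_derivative (\<lambda>x. \<Sum>e\<in>E. f e x *\<^sub>R e) (at x) h))
      = (\<integral>z. inner (\<Sum>e\<in>E. inner z (grad (f e) x) *\<^sub>R e) z \<partial>N)"
    unfolding fd by (rule op_trace_C[OF has_derivative_bounded_linear[OF D]])
  also have "\<dots> = (\<integral>z. (\<Sum>e\<in>E. inner (grad (f e) x) z * inner e z) \<partial>N)"
    unfolding inner_sum_left inner_scaleR_left by (simp add: inner_commute)
  also have "\<dots> = (\<Sum>e\<in>E. inner (grad (f e) x) (blinfun_apply C e))"
    by (simp add: integrable_N_inner integral_N_inner C_sym)
  finally show ?thesis
    unfolding stein_op_v_def inner_Gamma_op by (simp add: Y_def[symmetric] inner_sum_left sum_subtractf)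
qed

lemma inner_onb_sum_component:
  "e \<in> some_onb \<Longrightarrow> inner (\<Sum>e\<in>E. c e *\<^sub>R e) e = (if e \<in> E then c e else 0)"
  by (rule inner_onb_sum[OF onb_some_onb E])

lemma nrm_zero: "nrm (\<lambda>x. 0) = 0"
  using nrm_scale[OF zero_in, of 0] by simp

lemma onb_sum_vrkhs:
  assumes f: "\<And>e. e \<in> E \<Longrightarrow> f e \<in> H"
  shows "(\<lambda>x. \<Sum>e\<in>E. f e x *\<^sub>R e) \<in> vrkhs H ip" (is "?F \<in> _")
    and "(vnrm (\<lambda>x. \<Sum>e\<in>E. f e x *\<^sub>R e))\<^sup>2 = (\<Sum>e\<in>E. (nrm (f e))\<^sup>2)"
proof -
  have comp: "(\<lambda>x. inner (?F x) e) = (if e \<in> E then f e else (\<lambda>x. 0))" if "e \<in> some_onb" for e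
    using inner_onb_sum_component[OF that] by auto
  have hs: "((\<lambda>e. (nrm (\<lambda>x. inner (?F x) e))\<^sup>2) has_sum (\<Sum>e\<in>E. (nrm (f e))\<^sup>2)) some_onb"
  proof (subst has_sum_cong_neutral[where T=E and g="\<lambda>e. (nrm (f e))\<^sup>2"])
    show "((\<lambda>e. (nrm (f e))\<^sup>2) has_sum (\<Sum>e\<in>E. (nrm (f e))\<^sup>2)) E" using E(1) by simp
  qed (use E comp nrm_zero in auto)
  show F: "?F \<in> vrkhs H ip"
    unfolding vrkhs_def using hs comp f zero_in by (auto simp: summable_on_def)
  show "(vnrm ?F)\<^sup>2 = (\<Sum>e\<in>E. (nrm (f e))\<^sup>2)"
    using has_sum_unique[OF vnrm_has_sum[OF F] hs] .
qed

text \<open>Subtracting finitely many components removes exactly their share of the norm series, so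
  tails become small in \<open>vnrm\<close> along an exhaustion of the basis.\<close>

lemma vrkhs_tail:
  assumes F: "F \<in> vrkhs H ip"
  shows "(\<lambda>x. F x - (\<Sum>e\<in>E. inner (F x) e *\<^sub>R e)) \<in> vrkhs H ip" (is "?G \<in> _")
    and "(vnrm (\<lambda>x. F x - (\<Sum>e\<in>E. inner (F x) e *\<^sub>R e)))\<^sup>2 = (vnrm F)\<^sup>2 - (\<Sum>e\<in>E. (nrm (\<lambda>x. inner (F x) e))\<^sup>2)"
proof -
  have comp: "(\<lambda>x. inner (?G x) e) = (if e \<in> E then (\<lambda>x. 0) else (\<lambda>x. inner (F x) e))" if "e \<in> some_onb" for e
    using inner_onb_sum_component[OF that] by (auto simp: inner_diff_left)
  let ?n = "\<lambda>e. (nrm (\<lambda>x. inner (F x) e))\<^sup>2"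
  have "((\<lambda>e. if e \<in> E then - ?n e else 0) has_sum (- (\<Sum>e\<in>E. ?n e))) some_onb"
  proof (subst has_sum_cong_neutral[where T=E and g="\<lambda>e. - ?n e"])
    show "((\<lambda>e. - ?n e) has_sum (- (\<Sum>e\<in>E. ?n e))) E"
      using has_sum_finite[OF E(1), of "\<lambda>e. - ?n e"] by (simp add: sum_negf)
  qed (use E in auto)
  from has_sum_add[OF vnrm_has_sum[OF F] this]
  have "((\<lambda>e. ?n e + (if e \<in> E then - ?n e else 0)) has_sum (vnrm F)\<^sup>2 - (\<Sum>e\<in>E. ?n e)) some_onb" by simp
  moreover have "(nrm (\<lambda>x. inner (?G x) e))\<^sup>2 = ?n e + (if e \<in> E then - ?n e else 0)" if "e \<in> some_onb" for e
    using comp[OF that] nrm_zero by simp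
  ultimately have hs: "((\<lambda>e. (nrm (\<lambda>x. inner (?G x) e))\<^sup>2) has_sum (vnrm F)\<^sup>2 - (\<Sum>e\<in>E. ?n e)) some_onb"
    by (simp cong: has_sum_cong)
  show G: "?G \<in> vrkhs H ip"
    unfolding vrkhs_def using hs comp component_in[OF F] zero_in by (auto simp: summable_on_def)
  show "(vnrm ?G)\<^sup>2 = (vnrm F)\<^sup>2 - (\<Sum>e\<in>E. ?n e)"
    using has_sum_unique[OF vnrm_has_sum[OF G] hs] .
qed

lemma stein_op_v_tail:
  assumes F: "F \<in> vrkhs H ip"
  shows "stein_op_v C U F x = (\<Sum>e\<in>E. inner (Gamma_op C U (\<lambda>x. inner (F x) e) x) e)
    + stein_op_v C U (\<lambda>x. F x - (\<Sum>e\<in>E. inner (F x) e *\<^sub>R e)) x"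
proof -
  have c: "(\<lambda>x. inner (F x) e) \<in> H" if "e \<in> E" for e using component_in[OF F] E that by auto
  let ?P = "\<lambda>x. \<Sum>e\<in>E. inner (F x) e *\<^sub>R e"
  let ?G = "\<lambda>x. F x - ?P x"
  have P: "?P \<in> vrkhs H ip" by (rule onb_sum_vrkhs(1)) (rule c)
  have G: "?G \<in> vrkhs H ip" by (rule vrkhs_tail(1)[OF F])
  have "((\<lambda>x. ?P x + ?G x) has_derivative (\<lambda>h. frechet_derivative ?P (at x) h + frechet_derivative ?G (at x) h)) (at x)"
    by (rule has_derivative_add[OF vrkhs_derivative[OF P] vrkhs_derivative[OF G]])
  then have D: "frechet_derivative F (at x) = (\<lambda>h. frechet_derivative ?P (at x) h + frechet_derivative ?G (at x) h)"
    using vrkhs_derivative[OF F, of x] by (simp add: has_derivative_unique)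
  have int: "integrable N (\<lambda>z. inner (frechet_derivative K (at x) z) z)" if "K \<in> vrkhs H ip" for K
    by (intro integrable_N_quadratic has_derivative_bounded_linear[OF vrkhs_derivative] that)
  have aP: "stein_op_v C U ?P x = (\<integral>z. inner (frechet_derivative ?P (at x) z) z \<partial>N) - inner (?P x) (Y x)"
    by (rule stein_op_v_vrkhs[OF P])
  have aG: "stein_op_v C U ?G x = (\<integral>z. inner (frechet_derivative ?G (at x) z) z \<partial>N) - inner (?G x) (Y x)"
    by (rule stein_op_v_vrkhs[OF G])
  have "stein_op_v C U F x = stein_op_v C U ?P x + stein_op_v C U ?G x"
    unfolding stein_op_v_vrkhs[OF F] aP aG D inner_add_left Bochner_Integration.integral_add[OF int[OF P] int[OF G]]
    by (simp add: inner_diff_left)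
  also have "stein_op_v C U ?P x = (\<Sum>e\<in>E. inner (Gamma_op C U (\<lambda>x. inner (F x) e) x) e)"
    by (rule stein_op_v_onb_sum[OF c])
  finally show ?thesis .
qed

end

text \<open>The discrepancy functional is bounded by a constant times \<open>vnrm\<close>, and the
  tails of \<open>F\<close> tend to \<open>0\<close> in that norm; so it is the limit of its values
  on finite expansions, which decompose into the scalar functionals
  \<open>\<Lambda> e\<close>.\<close>

lemma tendsto_\<Lambda>_sum:
  assumes F: "F \<in> vrkhs H ip"
    and E: "\<And>n. finite (E n)" "\<And>n. E n \<subseteq> (some_onb :: 'a set)"
      "filterlim E (finite_subsets_at_top some_onb) sequentially"
  shows "(\<lambda>n. \<Sum>e\<in>E n. \<Lambda> e (\<lambda>x. inner (F x) e)) \<longlonglongrightarrow> (\<integral>x. stein_op_v C U F x \<partial>Q)"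
proof -
  define G where "G n x = F x - (\<Sum>e\<in>E n. inner (F x) e *\<^sub>R e)" for n x
  define S where "S n x = (\<Sum>e\<in>E n. inner (Gamma_op C U (\<lambda>x. inner (F x) e) x) e)" for n x
  have G: "G n \<in> vrkhs H ip" for n
    unfolding G_def by (rule vrkhs_tail(1)[OF E(1,2) F])
  have A_eq: "stein_op_v C U F x = S n x + stein_op_v C U (G n) x" for n x
    unfolding S_def G_def by (rule stein_op_v_tail[OF E(1,2) F])
  have "(\<lambda>n. (vnrm F)\<^sup>2 - (\<Sum>e\<in>E n. (nrm (\<lambda>x. inner (F x) e))\<^sup>2)) \<longlonglongrightarrow> (vnrm F)\<^sup>2 - (vnrm F)\<^sup>2"
    by (intro tendsto_diff tendsto_const has_sum_sequence[OF vnrm_has_sum[OF F] E(3)])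
  then have "(\<lambda>n. (vnrm (G n))\<^sup>2) \<longlonglongrightarrow> 0"
    unfolding G_def by (simp add: vrkhs_tail(2)[OF E(1,2) F])
  then have G0: "(\<lambda>n. vnrm (G n)) \<longlonglongrightarrow> 0" by (simp add: tendsto_power2_zero_iff)
  have comp: "(\<lambda>x. inner (F x) e) \<in> H" if "e \<in> E n" for e n using component_in[OF F] E that by auto
  have S_int: "integrable Q (S n)" for n
    unfolding S_def by (intro Bochner_Integration.integrable_sum integrable_inner_Gamma_op comp)
  have S_lim: "(\<lambda>n. S n x) \<longlonglongrightarrow> stein_op_v C U F x" for x
  proof -
    have "(\<lambda>n. stein_op_v C U (G n) x) \<longlonglongrightarrow> 0"
    proof (rule Lim_null_comparison)
      show "\<forall>\<^sub>F n in sequentially. norm (stein_op_v C U (G n) x) \<le> (lip * trC + sqrt (k 0 0) * norm (Y x)) * vnrm (G n)"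
        using abs_stein_op_v_le[OF G] by simp
      show "(\<lambda>n. (lip * trC + sqrt (k 0 0) * norm (Y x)) * vnrm (G n)) \<longlonglongrightarrow> 0"
        by (rule tendsto_mult_right_zero[OF G0])
    qed
    from tendsto_diff[OF tendsto_const[of "stein_op_v C U F x"] this]
    moreover have "S n x = stein_op_v C U F x - stein_op_v C U (G n) x" for n using A_eq[of x n] by simp
    ultimately show ?thesis by simp
  qed
  \<comment> \<open>Measurability of the trace term is inherited from the finite expansions, where
    it is known componentwise.\<close>
  have [measurable]: "stein_op_v C U F \<in> borel_measurable Q"
    by (rule borel_measurable_LIMSEQ_real[OF S_lim]) (use S_int in auto)
  have A_int: "integrable Q (stein_op_v C U F)"
  proof (rule Bochner_Integration.integrable_bound)
    show "integrable Q (\<lambda>x. (lip * trC + sqrt (k 0 0) * norm (Y x)) * vnrm F)"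
      using integrable_norm_Y by simp
    show "AE x in Q. norm (stein_op_v C U F x) \<le> norm ((lip * trC + sqrt (k 0 0) * norm (Y x)) * vnrm F)"
      using abs_stein_op_v_le[OF F] by (intro AE_I2) (smt (verit) real_norm_def)
  qed measurable
  have "(\<lambda>n. (\<integral>x. S n x \<partial>Q) - (\<integral>x. stein_op_v C U F x \<partial>Q)) \<longlonglongrightarrow> 0"
  proof (rule Lim_null_comparison)
    show "\<forall>\<^sub>F n in sequentially. norm ((\<integral>x. S n x \<partial>Q) - (\<integral>x. stein_op_v C U F x \<partial>Q))
        \<le> (lip * trC + sqrt (k 0 0) * (\<integral>x. norm (Y x) \<partial>Q)) * vnrm (G n)"
    proof (intro always_eventually allI)
      fix n
      have "(\<integral>x. S n x \<partial>Q) - (\<integral>x. stein_op_v C U F x \<partial>Q) = (\<integral>x. S n x - stein_op_v C U F x \<partial>Q)"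
        using S_int A_int by simp
      also have "\<dots> = (\<integral>x. - stein_op_v C U (G n) x \<partial>Q)"
        using A_eq[of _ n] by simp
      also have "norm \<dots> \<le> (\<integral>x. (lip * trC + sqrt (k 0 0) * norm (Y x)) * vnrm (G n) \<partial>Q)"
        using abs_stein_op_v_le[OF G] by (intro norm_integral_le) (simp_all add: integrable_norm_Y)
      also have "\<dots> = (lip * trC + sqrt (k 0 0) * (\<integral>x. norm (Y x) \<partial>Q)) * vnrm (G n)"
        using integrable_norm_Y by (simp add: Q.prob_space)
      finally show "norm ((\<integral>x. S n x \<partial>Q) - (\<integral>x. stein_op_v C U F x \<partial>Q))
        \<le> (lip * trC + sqrt (k 0 0) * (\<integral>x. norm (Y x) \<partial>Q)) * vnrm (G n)" .
    qed
    show "(\<lambda>n. (lip * trC + sqrt (k 0 0) * (\<integral>x. norm (Y x) \<partial>Q)) * vnrm (G n)) \<longlonglongrightarrow> 0"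
      by (rule tendsto_mult_right_zero[OF G0])
  qed
  then have "(\<lambda>n. \<integral>x. S n x \<partial>Q) \<longlonglongrightarrow> (\<integral>x. stein_op_v C U F x \<partial>Q)" by (rule LIM_zero_cancel)
  moreover have "(\<integral>x. S n x \<partial>Q) = (\<Sum>e\<in>E n. \<Lambda> e (\<lambda>x. inner (F x) e))" for n
    unfolding S_def \<Lambda>_def by (intro Bochner_Integration.integral_sum integrable_inner_Gamma_op comp)
  ultimately show ?thesis by simp
qed

text \<open>With \<open>h e\<close> the scalar representer in direction \<open>e\<close>, the
  partial sums \<open>S n\<close> of \<open>(nrm (h e))\<^sup>2\<close> increase to the right-hand
  side by monotone convergence and Parseval. Cauchy--Schwarz over \<open>E n\<close> bounds the
  squared partial functional by \<open>S n\<close>, and the normalised field with components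
  \<open>h e\<close> for \<open>e \<in> E n\<close> attains this value; both comparisons make sense
  in \<open>[0, \<infinity>]\<close>.\<close>

theorem KSD_v_power2:
  "(KSD_v C U H ip Q)\<^sup>2 = (\<integral>\<^sup>+s. ennreal ((norm (Z s))\<^sup>2) \<partial>\<mu>)" (is "_ = ?R")
proof -
  obtain h where h: "\<And>v. h v \<in> H" "\<And>v f. f \<in> H \<Longrightarrow> \<Lambda> v f = ip (h v) f"
    "\<And>v. ip (h v) (h v) = (\<integral>s. (cmod (\<theta> v s))\<^sup>2 \<partial>\<mu>)"
    using ex_representer by metis
  obtain E where E: "\<And>n. finite (E n)" "\<And>n. E n \<subseteq> (some_onb :: 'a set)" "incseq E"
    "filterlim E (finite_subsets_at_top some_onb) sequentially"
    using countable_finite_exhaustion[OF countable_onb[OF onb_some_onb]] by metis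
  define S where "S n = (\<Sum>e\<in>E n. (nrm (h e))\<^sup>2)" for n
  have S0: "0 \<le> S n" for n unfolding S_def by (intro sum_nonneg) simp
  have S_eq: "(\<integral>\<^sup>+s. ennreal (\<Sum>e\<in>E n. (cmod (\<theta> e s))\<^sup>2) \<partial>\<mu>) = ennreal (S n)" for n
  proof -
    have int: "integrable \<mu> (\<lambda>s. (cmod (\<theta> e s))\<^sup>2)" for e using \<theta>_L2[of e] by (rule integrable_L2)
    have "(\<integral>\<^sup>+s. ennreal (\<Sum>e\<in>E n. (cmod (\<theta> e s))\<^sup>2) \<partial>\<mu>) = ennreal (\<integral>s. (\<Sum>e\<in>E n. (cmod (\<theta> e s))\<^sup>2) \<partial>\<mu>)"
      by (intro nn_integral_eq_integral Bochner_Integration.integrable_sum int AE_I2 sum_nonneg) simp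
    then show ?thesis
      unfolding S_def by (simp add: int nrm_power2 h)
  qed
  have "(\<lambda>n. \<integral>\<^sup>+s. ennreal (\<Sum>e\<in>E n. (cmod (\<theta> e s))\<^sup>2) \<partial>\<mu>) \<longlonglongrightarrow> ?R"
  proof (rule nn_integral_LIMSEQ)
    show "incseq (\<lambda>n s. ennreal (\<Sum>e\<in>E n. (cmod (\<theta> e s))\<^sup>2))"
      using E(1,3) by (intro incseq_SucI le_funI ennreal_leI sum_mono2) (auto simp: incseq_SucD)
    show "(\<lambda>s. ennreal (\<Sum>e\<in>E n. (cmod (\<theta> e s))\<^sup>2)) \<in> borel_measurable \<mu>" for n
      using L2_measurable[OF \<theta>_L2] by measurable
    show "(\<lambda>n. ennreal (\<Sum>e\<in>E n. (cmod (\<theta> e s))\<^sup>2)) \<longlonglongrightarrow> ennreal ((norm (Z s))\<^sup>2)" for s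
      by (intro tendsto_ennrealI has_sum_sequence[OF has_sum_norm_\<theta> E(4)])
  qed
  then have S_lim: "(\<lambda>n. ennreal (S n)) \<longlonglongrightarrow> ?R" unfolding S_eq .
  have S_inc: "incseq (\<lambda>n. ennreal (S n))"
    unfolding S_def using E(1,3) by (intro incseq_SucI ennreal_leI sum_mono2) (auto simp: incseq_SucD)
  show ?thesis
  proof (rule antisym)
    show "(KSD_v C U H ip Q)\<^sup>2 \<le> ?R"
      unfolding KSD_v_def
    proof (rule ennreal_SUP_power2_le)
      fix F assume "F \<in> {F \<in> vrkhs H ip. vnrm F \<le> 1}"
      then have F: "F \<in> vrkhs H ip" "vnrm F \<le> 1" by auto
      have V: "(vnrm F)\<^sup>2 \<le> 1" using power_mono[OF F(2) vnrm_nonneg[OF F(1)], of 2] by simp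
      have "(\<Sum>e\<in>E n. \<Lambda> e (\<lambda>x. inner (F x) e))\<^sup>2 \<le> S n" for n
      proof -
        have comp: "(\<lambda>x. inner (F x) e) \<in> H" if "e \<in> E n" for e using component_in[OF F(1)] E that by auto
        have "\<bar>\<Sum>e\<in>E n. \<Lambda> e (\<lambda>x. inner (F x) e)\<bar> \<le> (\<Sum>e\<in>E n. \<bar>nrm (h e)\<bar> * \<bar>nrm (\<lambda>x. inner (F x) e)\<bar>)"
          using ip_le_nrm[OF h(1) comp] by (intro order_trans[OF sum_abs] sum_mono) (simp add: h(2) comp nrm_nonneg h(1))
        also have "\<dots> \<le> L2_set (\<lambda>e. nrm (h e)) (E n) * L2_set (\<lambda>e. nrm (\<lambda>x. inner (F x) e)) (E n)"
          by (rule L2_set_mult_ineq)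
        finally have "(\<Sum>e\<in>E n. \<Lambda> e (\<lambda>x. inner (F x) e))\<^sup>2
            \<le> (L2_set (\<lambda>e. nrm (h e)) (E n) * L2_set (\<lambda>e. nrm (\<lambda>x. inner (F x) e)) (E n))\<^sup>2"
          by (metis abs_ge_zero power2_abs power_mono)
        also have "\<dots> = S n * (\<Sum>e\<in>E n. (nrm (\<lambda>x. inner (F x) e))\<^sup>2)"
          unfolding S_def by (simp add: power_mult_distrib L2_set_def sum_nonneg)
        also have "(\<Sum>e\<in>E n. (nrm (\<lambda>x. inner (F x) e))\<^sup>2) \<le> (vnrm F)\<^sup>2"
          using has_sum_mono'[OF has_sum_finite[OF E(1)] vnrm_has_sum[OF F(1)] E(2)] by simp
        finally show ?thesis using V S0[of n] mult_left_mono[OF V S0[of n]]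
          by (smt (verit, best) mult_left_mono mult.right_neutral)
      qed
      then have le: "ennreal ((\<Sum>e\<in>E n. \<Lambda> e (\<lambda>x. inner (F x) e))\<^sup>2) \<le> ennreal (S n)" for n
        by (rule ennreal_leI)
      have "(\<lambda>n. ennreal ((\<Sum>e\<in>E n. \<Lambda> e (\<lambda>x. inner (F x) e))\<^sup>2)) \<longlonglongrightarrow> ennreal ((\<integral>x. stein_op_v C U F x \<partial>Q)\<^sup>2)"
        by (intro tendsto_ennrealI tendsto_power tendsto_\<Lambda>_sum F E)
      from tendsto_le[OF _ S_lim this] le
      show "(ennreal \<bar>\<integral>x. stein_op_v C U F x \<partial>Q\<bar>)\<^sup>2 \<le> ?R"
        by (simp add: ennreal_power)
    qed
    show "?R \<le> (KSD_v C U H ip Q)\<^sup>2"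
    proof (rule LIMSEQ_le_const2[OF S_lim], intro exI allI impI)
      fix n :: nat
      show "ennreal (S n) \<le> (KSD_v C U H ip Q)\<^sup>2"
      proof (cases "S n = 0")
        case False
        then have pos: "S n > 0" using S0[of n] by simp
        \<comment> \<open>Dividing by \<open>sqrt (S n)\<close> gives the field norm one; its
          functional value is then \<open>S n / sqrt (S n)\<close>.\<close>
        define f where "f e x = (1 / sqrt (S n)) * h e x" for e x
        have f: "f e \<in> H" for e
          unfolding f_def using comb_in[OF h(1) h(1), of "1 / sqrt (S n)" e 0 e] by simp
        have f_nrm: "(nrm (f e))\<^sup>2 = (nrm (h e))\<^sup>2 / S n" for e
          unfolding f_def using nrm_scale[OF h(1), of "1 / sqrt (S n)" e] pos by (simp add: power_divide)
        let ?F = "\<lambda>x. \<Sum>e\<in>E n. f e x *\<^sub>R e"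
        have F: "?F \<in> vrkhs H ip" by (rule onb_sum_vrkhs(1)[OF E(1,2) f])
        have "(vnrm ?F)\<^sup>2 = 1"
          using onb_sum_vrkhs(2)[OF E(1)[of n] E(2) f] pos by (simp add: f_nrm sum_divide_distrib[symmetric] S_def[symmetric])
        then have "vnrm ?F \<le> 1" using vnrm_nonneg[OF F] by (simp add: power2_eq_1_iff)
        moreover have "(\<integral>x. stein_op_v C U ?F x \<partial>Q) = sqrt (S n)"
        proof -
          have "(\<integral>x. stein_op_v C U ?F x \<partial>Q) = (\<Sum>e\<in>E n. \<Lambda> e (f e))"
            unfolding stein_op_v_onb_sum[OF E(1,2) f] \<Lambda>_def
            by (intro Bochner_Integration.integral_sum integrable_inner_Gamma_op f)
          also have "\<dots> = (\<Sum>e\<in>E n. (1 / sqrt (S n)) * (nrm (h e))\<^sup>2)"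
          proof (intro sum.cong refl)
            fix e
            show "\<Lambda> e (f e) = (1 / sqrt (S n)) * (nrm (h e))\<^sup>2"
              using h(2)[OF f, of e e] ip_comb_right[OF h(1) h(1) h(1), of e "1 / sqrt (S n)" e 0 e]
              by (simp add: f_def[abs_def] nrm_power2 h(1))
          qed
          also have "\<dots> = S n / sqrt (S n)" unfolding S_def by (simp add: sum_divide_distrib)
          also have "\<dots> = sqrt (S n)" by (simp add: real_div_sqrt S0)
          finally show ?thesis .
        qed
        ultimately have "ennreal (sqrt (S n)) \<le> KSD_v C U H ip Q"
          unfolding KSD_v_def using F S0[of n] by (intro SUP_upper2[of ?F]) auto
        then have "(ennreal (sqrt (S n)))\<^sup>2 \<le> (KSD_v C U H ip Q)\<^sup>2" by (rule power_mono) simp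
        then show ?thesis using S0[of n] by (simp add: ennreal_power)
      qed simp
    qed
  qed
qed

end

theorem theorem4p1:
  fixes C :: "'a::{real_inner, banach, second_countable_topology} \<Rightarrow>\<^sub>L 'a"
    and U :: "'a \<Rightarrow> real"
    and N P Q \<mu> :: "'a measure"
    and k :: "'a \<Rightarrow> 'a \<Rightarrow> real"
    and H :: "('a \<Rightarrow> real) set"
    and ip :: "('a \<Rightarrow> real) \<Rightarrow> ('a \<Rightarrow> real) \<Rightarrow> real"
  assumes C: "C \<in> L1_plus"
    and U: "\<forall>x. U differentiable (at x)"
    and N: "centred_gaussian C N"
    and P: "prob_space P" "sets P = sets borel"
    and Q: "prob_space Q" "sets Q = sets borel"
    and P_density: "\<exists>Z>0. P = density N (\<lambda>x. ennreal (exp (- U x) / Z))"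
    and Q_moment: "integrable Q (\<lambda>x. (norm x)\<^sup>2)"
    and Q_grad: "integrable Q (\<lambda>x. norm (blinfun_apply C (grad U x)))"
    and U_sobolev: "(\<lambda>x. exp (- U x / 2)) \<in> malliavin_W12 C N"
    and N_grad: "integrable N (\<lambda>x. (norm (blinfun_apply (op_sqrt C) (grad U x)))\<^sup>2)"
    and k: "pd_kernel k"
    and \<mu>: "finite_measure \<mu>" "sets \<mu> = sets borel"
    and k_fourier: "\<forall>x y. complex_of_real (k x y) = fourier \<mu> (x - y)"
    and H: "rkhs k H ip"
  shows "(k \<in> Cb_2_2 \<longrightarrow>
            (KSD C U H ip Q)\<^sup>2 =
              (\<integral>\<^sup>+s. ennreal ((cmod (\<integral>x. stein_op_complex C U (wave s) x \<partial>Q))\<^sup>2) \<partial>\<mu>)) \<and>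
         (k \<in> Cb_1_1 \<longrightarrow>
            (KSD_v C U H ip Q)\<^sup>2 =
              (\<integral>\<^sup>+s. ennreal ((cplx_norm (\<integral>x. Gamma_op_complex C U (wave s) x \<partial>Q))\<^sup>2) \<partial>\<mu>))"
proof (intro conjI impI)
  interpret Q: prob_space Q by (rule Q(1))
  interpret \<mu>: finite_measure \<mu> by (rule \<mu>(1))
  interpret stein_kernel C N Q U k H ip \<mu>
    using assms by unfold_locales auto
  show "(KSD C U H ip Q)\<^sup>2 = (\<integral>\<^sup>+s. ennreal ((cmod (\<integral>x. stein_op_complex C U (wave s) x \<partial>Q))\<^sup>2) \<partial>\<mu>)" if "k \<in> Cb_2_2"
  proof -
    interpret stein_kernel_C2 C N Q U k H ip \<mu> by unfold_locales (rule that)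
    show ?thesis using KSD_power2 unfolding \<theta>_def .
  qed
  show "(KSD_v C U H ip Q)\<^sup>2 = (\<integral>\<^sup>+s. ennreal ((cplx_norm (\<integral>x. Gamma_op_complex C U (wave s) x \<partial>Q))\<^sup>2) \<partial>\<mu>)" if "k \<in> Cb_1_1"
  proof -
    interpret stein_kernel_C1 C N Q U k H ip \<mu> by unfold_locales (rule that)
    show ?thesis using KSD_v_power2 unfolding Z_def cplx_norm_eq_norm .
  qed
qed

end
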